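(* Let $n\ge 3$ and let $\alpha,\gamma$ be integers with $\gamma>n\alpha\ge 0$. Let $Q$ be an algebraic vector bundle on $\mathbb P^n$ (over $\mathbb C$) described by an exact sequence $$0\to\mathcal O_{\mathbb P^n}(-\gamma)\to\bigoplus_{k=0}^{n}\mathcal O_{\mathbb P^n}((n-2k)\alpha)\to Q\to 0,$$ and let $$\mathcal V=S^{2(n-1)}(\mathcal O_{\mathbb P^n}(\alpha)\oplus\mathcal O_{\mathbb P^n}(-\alpha))=\bigoplus_{k=0}^{2(n-1)}\mathcal O_{\mathbb P^n}((2n-2-2k)\alpha).$$ Then there exists an exact sequence of algebraic vector bundles on $\mathbb P^n$ $$0\to Q(-\gamma)\to\mathcal V\to F(\gamma)\to 0$$ with $F$ an algebraic vector bundle of rank $n-1$.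
   Context: $S^{2(n-1)}$ denotes the symmetric power; $\mathcal V$ has rank $2n-1$ and $Q$ has rank $n$. The twist is $E(t)=E\otimes\mathcal O_{\mathbb P^n}(t)$. *)

theory Defs
  imports
    Complex_Main
    "HOL-Library.Poly_Mapping"
    "Jordan_Normal_Form.Matrix"
    "Jordan_Normal_Form.Matrix_Kernel"
begin

section \<open>Complex projective space as an algebraic variety\<close>

text \<open>A point of \<open>\<P>\<^sup>n\<close> is the set of all its homogeneous coordinate vectors.\<close>

type_synonym point = "complex vec set"

definition proportional :: "nat \<Rightarrow> (complex vec \<times> complex vec) set" where
  "proportional n =
     {(v, w). v \<in> carrier_vec (n + 1) - {0\<^sub>v (n + 1)} \<and> (\<exists>c. c \<noteq> 0 \<and> w = c \<cdot>\<^sub>v v)}"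

definition proj_space :: "nat \<Rightarrow> point set" where
  "proj_space n = (carrier_vec (n + 1) - {0\<^sub>v (n + 1)}) // proportional n"

text \<open>Polynomials in countably many variables \<open>x\<^sub>0, x\<^sub>1, \<dots>\<close>, as finitely supported maps from
  exponents to coefficients. Forms on \<open>\<P>\<^sup>n\<close> involve only \<open>x\<^sub>0, \<dots>, x\<^sub>n\<close>.\<close>

type_synonym cpoly = "(nat \<Rightarrow>\<^sub>0 nat) \<Rightarrow>\<^sub>0 complex"

definition poly_at :: "cpoly \<Rightarrow> complex vec \<Rightarrow> complex" where
  "poly_at f v = (\<Sum>m\<in>Poly_Mapping.keys f. Poly_Mapping.lookup f m *
      (\<Prod>i\<in>Poly_Mapping.keys m. (v $ i) ^ Poly_Mapping.lookup m i))"

definition homogeneous :: "nat \<Rightarrow> nat \<Rightarrow> cpoly \<Rightarrow> bool" where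
  "homogeneous n d f \<longleftrightarrow>
     (\<forall>m\<in>Poly_Mapping.keys f. Poly_Mapping.keys m \<subseteq> {..n} \<and>
        (\<Sum>i\<in>Poly_Mapping.keys m. Poly_Mapping.lookup m i) = d)"

definition zariski_closed :: "nat \<Rightarrow> point set \<Rightarrow> bool" where
  "zariski_closed n Z \<longleftrightarrow>
     (\<exists>T. (\<forall>f\<in>T. \<exists>d. homogeneous n d f) \<and>
          Z = {p \<in> proj_space n. \<forall>f\<in>T. \<forall>v\<in>p. poly_at f v = 0})"

definition zariski_open :: "nat \<Rightarrow> point set \<Rightarrow> bool" where
  "zariski_open n U \<longleftrightarrow> U \<subseteq> proj_space n \<and> zariski_closed n (proj_space n - U)"

definition regular_on :: "nat \<Rightarrow> point set \<Rightarrow> (point \<Rightarrow> complex) \<Rightarrow> bool" where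
  "regular_on n U h \<longleftrightarrow>
     (\<forall>p\<in>U. \<exists>W d f g. zariski_open n W \<and> p \<in> W \<and> W \<subseteq> U \<and>
        homogeneous n d f \<and> homogeneous n d g \<and>
        (\<forall>q\<in>W. \<forall>v\<in>q. poly_at g v \<noteq> 0 \<and> h q = poly_at f v / poly_at g v))"

definition regular_mat_on ::
    "nat \<Rightarrow> point set \<Rightarrow> nat \<Rightarrow> nat \<Rightarrow> (point \<Rightarrow> complex mat) \<Rightarrow> bool" where
  "regular_mat_on n U r s M \<longleftrightarrow>
     (\<forall>p\<in>U. M p \<in> carrier_mat r s) \<and>
     (\<forall>a<r. \<forall>b<s. regular_on n U (\<lambda>p. M p $$ (a, b)))"

section \<open>Algebraic vector bundles\<close>

text \<open>A vector bundle is given by an open cover, indexed by a set of charts, over whose members it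
  is trivialised, and by its regular transition matrices. The matrix \<open>transition E i j p\<close> converts
  coordinates of the fibre at \<open>p\<close> in chart \<open>j\<close> into coordinates in chart \<open>i\<close>; its values
  outside \<open>chart_dom E i \<inter> chart_dom E j\<close> are irrelevant. The rank is constant because \<open>\<P>\<^sup>n\<close> is
  connected.\<close>

record 'i vbundle =
  charts :: "'i set"
  chart_dom :: "'i \<Rightarrow> point set"
  bundle_rank :: nat
  transition :: "'i \<Rightarrow> 'i \<Rightarrow> point \<Rightarrow> complex mat"

definition vector_bundle :: "nat \<Rightarrow> 'i vbundle \<Rightarrow> bool" where
  "vector_bundle n E \<longleftrightarrow>
     (\<forall>i\<in>charts E. zariski_open n (chart_dom E i)) \<and>
     (\<Union>i\<in>charts E. chart_dom E i) = proj_space n \<and>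
     (\<forall>i\<in>charts E. \<forall>j\<in>charts E.
        regular_mat_on n (chart_dom E i \<inter> chart_dom E j)
          (bundle_rank E) (bundle_rank E) (transition E i j)) \<and>
     (\<forall>i\<in>charts E. \<forall>p\<in>chart_dom E i. transition E i i p = 1\<^sub>m (bundle_rank E)) \<and>
     (\<forall>i\<in>charts E. \<forall>j\<in>charts E. \<forall>k\<in>charts E.
        \<forall>p\<in>chart_dom E i \<inter> chart_dom E j \<inter> chart_dom E k.
          transition E i j p * transition E j k p = transition E i k p)"

text \<open>In a morphism \<open>\<phi>\<close> from \<open>E\<close> to \<open>F\<close>, \<open>\<phi> j i p\<close> is the matrix of the linear map of fibres
  at \<open>p\<close> with respect to chart \<open>i\<close> of \<open>E\<close> and chart \<open>j\<close> of \<open>F\<close>.\<close>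

definition bundle_morphism ::
    "nat \<Rightarrow> 'i vbundle \<Rightarrow> 'j vbundle \<Rightarrow> ('j \<Rightarrow> 'i \<Rightarrow> point \<Rightarrow> complex mat) \<Rightarrow> bool" where
  "bundle_morphism n E F \<phi> \<longleftrightarrow>
     (\<forall>i\<in>charts E. \<forall>j\<in>charts F.
        regular_mat_on n (chart_dom E i \<inter> chart_dom F j)
          (bundle_rank F) (bundle_rank E) (\<phi> j i)) \<and>
     (\<forall>i\<in>charts E. \<forall>i'\<in>charts E. \<forall>j\<in>charts F. \<forall>j'\<in>charts F.
        \<forall>p\<in>chart_dom E i \<inter> chart_dom E i' \<inter> chart_dom F j \<inter> chart_dom F j'.
          \<phi> j' i' p = transition F j' j p * \<phi> j i p * transition E i i' p)"

definition isomorphic_bundles :: "nat \<Rightarrow> 'i vbundle \<Rightarrow> 'j vbundle \<Rightarrow> bool" where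
  "isomorphic_bundles n E F \<longleftrightarrow>
     vector_bundle n E \<and> vector_bundle n F \<and>
     (\<exists>\<phi>. bundle_morphism n E F \<phi> \<and>
        (\<forall>i\<in>charts E. \<forall>j\<in>charts F. \<forall>p\<in>chart_dom E i \<inter> chart_dom F j.
           invertible_mat (\<phi> j i p)))"

text \<open>Exactness of \<open>0 \<rightarrow> E \<rightarrow> F \<rightarrow> G \<rightarrow> 0\<close> as a sequence of vector bundles, that is, in every
  fibre. For morphisms of vector bundles this is the same as exactness of the sequence of sheaves
  of sections.\<close>

definition short_exact :: "nat \<Rightarrow> 'i vbundle \<Rightarrow> 'j vbundle \<Rightarrow> 'k vbundle \<Rightarrow> bool" where
  "short_exact n E F G \<longleftrightarrow>
     vector_bundle n E \<and> vector_bundle n F \<and> vector_bundle n G \<and>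
     (\<exists>\<phi> \<psi>. bundle_morphism n E F \<phi> \<and> bundle_morphism n F G \<psi> \<and>
        (\<forall>i\<in>charts E. \<forall>j\<in>charts F. \<forall>k\<in>charts G.
           \<forall>p\<in>chart_dom E i \<inter> chart_dom F j \<inter> chart_dom G k.
             inj_on (\<lambda>v. \<phi> j i p *\<^sub>v v) (carrier_vec (bundle_rank E)) \<and>
             (\<lambda>v. \<phi> j i p *\<^sub>v v) ` carrier_vec (bundle_rank E) = mat_kernel (\<psi> k j p) \<and>
             (\<lambda>w. \<psi> k j p *\<^sub>v w) ` carrier_vec (bundle_rank F) = carrier_vec (bundle_rank G)))"

section \<open>Line bundles, direct sums, tensor products and symmetric powers\<close>

text \<open>The ratio does not depend on the chosen representative.\<close>

definition coord_ratio :: "nat \<Rightarrow> nat \<Rightarrow> point \<Rightarrow> complex" where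
  "coord_ratio j i p = (let v = (SOME v. v \<in> p) in v $ j / v $ i)"

text \<open>Sections of \<open>\<O>(t)\<close> are homogeneous functions \<open>s\<close> of degree \<open>t\<close>, with coordinate
  \<open>s / x\<^sub>i\<^sup>t\<close> in the chart \<open>x\<^sub>i \<noteq> 0\<close>.\<close>

definition line_bundle :: "nat \<Rightarrow> int \<Rightarrow> nat vbundle" where
  "line_bundle n t =
     \<lparr>charts = {..n},
      chart_dom = (\<lambda>i. {p \<in> proj_space n. \<forall>v\<in>p. v $ i \<noteq> 0}),
      bundle_rank = 1,
      transition = (\<lambda>i j p. mat 1 1 (\<lambda>_. coord_ratio j i p powi t))\<rparr>"

text \<open>Direct sums and tensor products use the common refinement of the given covers.\<close>

definition bundle_sum :: "nat \<Rightarrow> 'i vbundle list \<Rightarrow> 'i list vbundle" where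
  "bundle_sum n Es =
     \<lparr>charts = listset (map charts Es),
      chart_dom = (\<lambda>is. {p \<in> proj_space n. \<forall>k<length Es. p \<in> chart_dom (Es ! k) (is ! k)}),
      bundle_rank = (\<Sum>E\<leftarrow>Es. bundle_rank E),
      transition = (\<lambda>is js p. diag_block_mat
        (map (\<lambda>k. transition (Es ! k) (is ! k) (js ! k) p) [0..<length Es]))\<rparr>"

definition kronecker :: "complex mat \<Rightarrow> complex mat \<Rightarrow> complex mat" where
  "kronecker A B = mat (dim_row A * dim_row B) (dim_col A * dim_col B)
     (\<lambda>(a, b). A $$ (a div dim_row B, b div dim_col B) * B $$ (a mod dim_row B, b mod dim_col B))"

definition tensor_bundle :: "'i vbundle \<Rightarrow> 'j vbundle \<Rightarrow> ('i \<times> 'j) vbundle" where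
  "tensor_bundle E F =
     \<lparr>charts = charts E \<times> charts F,
      chart_dom = (\<lambda>(i, j). chart_dom E i \<inter> chart_dom F j),
      bundle_rank = bundle_rank E * bundle_rank F,
      transition = (\<lambda>(i, j) (i', j') p. kronecker (transition E i i' p) (transition F j j' p))\<rparr>"

definition twist :: "nat \<Rightarrow> 'i vbundle \<Rightarrow> int \<Rightarrow> ('i \<times> nat) vbundle" where
  "twist n E t = tensor_bundle E (line_bundle n t)"

text \<open>A basis of the symmetric power \<open>S\<^sup>d(\<complex>\<^sup>r)\<close>: the products \<open>e\<^bsub>w\<^sub>0\<^esub> \<cdots> e\<^bsub>w\<^sub>d\<^sub>-\<^sub>1\<^esub>\<close> for
  weakly increasing words \<open>w\<close> of length \<open>d\<close> in \<open>{0..<r}\<close>.\<close>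

definition sym_basis :: "nat \<Rightarrow> nat \<Rightarrow> nat list list" where
  "sym_basis r d = filter sorted (List.n_lists d [0..<r])"

text \<open>The matrix of \<open>S\<^sup>d A\<close> in this basis: expand the product of the images \<open>A e\<^bsub>u\<^sub>k\<^esub>\<close> and
  collect the words that are rearrangements of the target word.\<close>

definition sym_mat :: "nat \<Rightarrow> nat \<Rightarrow> complex mat \<Rightarrow> complex mat" where
  "sym_mat r d A = mat (length (sym_basis r d)) (length (sym_basis r d))
     (\<lambda>(a, b). \<Sum>w | mset w = mset (sym_basis r d ! a).
        \<Prod>k<d. A $$ (w ! k, sym_basis r d ! b ! k))"

definition sym_power :: "nat \<Rightarrow> 'i vbundle \<Rightarrow> 'i vbundle" where
  "sym_power d E =
     \<lparr>charts = charts E,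
      chart_dom = chart_dom E,
      bundle_rank = length (sym_basis (bundle_rank E) d),
      transition = (\<lambda>i j p. sym_mat (bundle_rank E) d (transition E i j p))\<rparr>"

end

theory Submission
  imports Defs "Jordan_Normal_Form.Determinant"
begin

text \<open>Write \<open>f\<close> for the map \<open>\<O>(-\<gamma>) \<rightarrow> S\<^sup>n(\<O>(\<alpha>) \<oplus> \<O>(-\<alpha>))\<close> defining \<open>Q\<close>. Binary forms of degree \<open>n\<close>
  have an \<open>SL\<^sub>2\<close>-invariant skew pairing with values in degree \<open>2n - 2\<close>, the Jacobian. In one variable
  it is the Wronskian \<open>f g' - f' g\<close>, whose vanishing for a nonzero \<open>f\<close> means that \<open>g\<close> is a multiple
  of \<open>f\<close>. Since \<open>f\<close> vanishes at no point, pairing with \<open>f\<close> embeds \<open>Q(-\<gamma>)\<close> into \<open>V\<close> as a subbundle, and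
  \<open>F\<close> is the quotient twisted by \<open>-\<gamma>\<close>. Locally the quotient is trivialised by suitable coordinates
  of \<open>V\<close>; regularity of all matrices involved follows from Cramer's rule in graded form.\<close>

section \<open>Homogeneous polynomials and the Zariski topology\<close>

text \<open>The twist by \<gamma> comes from a count of degrees. The Jacobian sends basis vectors
  \<open>j\<close> and \<open>k\<close> to \<open>k - j\<close> times basis vector
  \<open>j + k - 1\<close>, and the degrees of the summands obey
  \<open>s j + s k = w (j + k - 1)\<close>. Component \<open>j\<close> of the map f has degree
  \<open>\<gamma> + s j\<close>, so pairing with f raises all degrees by exactly \<gamma>: it is a
  map from Q to V(\<gamma>). Its image has rank n, which leaves 2n - 1 - n = n - 1 for the quotient.
  The obstacle is that bundles are given by charts and cocycles, while lifts, factorisations and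
  inverses are at hand only point by point, through existence statements. All maps are therefore
  turned into functions of a point, evaluated at one fixed coordinate vector and graded by degree;
  chart entries are the case of degree 0. Lifts are ambiguous along f. Requiring the coordinate at
  some index where f does not vanish to be 0 removes the ambiguity, and the lift becomes the
  solution of a square system with homogeneous entries. The same bordering by a unit row serves for
  the embedding of Q and for the splittings of V.\<close>

definition mon :: "(nat \<Rightarrow>\<^sub>0 nat) \<Rightarrow> complex vec \<Rightarrow> complex" where
  "mon m v = (\<Prod>i\<in>Poly_Mapping.keys m. (v $ i) ^ Poly_Mapping.lookup m i)"

definition mon_deg :: "(nat \<Rightarrow>\<^sub>0 nat) \<Rightarrow> nat" where
  "mon_deg m = (\<Sum>i\<in>Poly_Mapping.keys m. Poly_Mapping.lookup m i)"

lemma mon_superset: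
  assumes "finite S" "Poly_Mapping.keys m \<subseteq> S"
  shows "mon m v = (\<Prod>i\<in>S. (v $ i) ^ Poly_Mapping.lookup m i)"
  unfolding mon_def using assms
  by (intro prod.mono_neutral_left) (auto simp: in_keys_iff)

lemma mon_deg_superset:
  assumes "finite S" "Poly_Mapping.keys m \<subseteq> S"
  shows "mon_deg m = (\<Sum>i\<in>S. Poly_Mapping.lookup m i)"
  unfolding mon_deg_def using assms
  by (intro sum.mono_neutral_left) (auto simp: in_keys_iff)

lemma mon_add: "mon (a + b) v = mon a v * mon b v"
proof -
  let ?S = "Poly_Mapping.keys a \<union> Poly_Mapping.keys b"
  have "mon (a + b) v = (\<Prod>i\<in>?S. (v $ i) ^ Poly_Mapping.lookup (a + b) i)"
    by (rule mon_superset) (auto dest: subsetD[OF keys_add])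
  moreover have "mon a v = (\<Prod>i\<in>?S. (v $ i) ^ Poly_Mapping.lookup a i)"
    by (rule mon_superset) auto
  moreover have "mon b v = (\<Prod>i\<in>?S. (v $ i) ^ Poly_Mapping.lookup b i)"
    by (rule mon_superset) auto
  ultimately show ?thesis
    by (simp add: lookup_add power_add prod.distrib)
qed

lemma mon_deg_add: "mon_deg (a + b) = mon_deg a + mon_deg b"
proof -
  let ?S = "Poly_Mapping.keys a \<union> Poly_Mapping.keys b"
  have "mon_deg (a + b) = (\<Sum>i\<in>?S. Poly_Mapping.lookup (a + b) i)"
    by (rule mon_deg_superset) (auto dest: subsetD[OF keys_add])
  moreover have "mon_deg a = (\<Sum>i\<in>?S. Poly_Mapping.lookup a i)"
    by (rule mon_deg_superset) auto
  moreover have "mon_deg b = (\<Sum>i\<in>?S. Poly_Mapping.lookup b i)"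
    by (rule mon_deg_superset) auto
  ultimately show ?thesis
    by (simp add: lookup_add sum.distrib)
qed

lemma mon_scale:
  assumes "Poly_Mapping.keys m \<subseteq> {..n}" "v \<in> carrier_vec (n + 1)"
  shows "mon m (c \<cdot>\<^sub>v v) = c ^ mon_deg m * mon m v"
proof -
  have "mon m (c \<cdot>\<^sub>v v) = (\<Prod>i\<in>Poly_Mapping.keys m. c ^ Poly_Mapping.lookup m i * (v $ i) ^ Poly_Mapping.lookup m i)"
    unfolding mon_def using assms
    by (intro prod.cong refl) (auto simp: power_mult_distrib subset_iff le_less_Suc_eq)
  then show ?thesis
    by (simp add: prod.distrib mon_def mon_deg_def power_sum)
qed

lemma poly_at_superset:
  assumes "finite S" "Poly_Mapping.keys f \<subseteq> S"
  shows "poly_at f v = (\<Sum>m\<in>S. Poly_Mapping.lookup f m * mon m v)"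
  unfolding poly_at_def mon_def[symmetric] using assms
  by (intro sum.mono_neutral_left) (auto simp: in_keys_iff)

lemma poly_at_add: "poly_at (f + g) v = poly_at f v + poly_at g v"
proof -
  let ?S = "Poly_Mapping.keys f \<union> Poly_Mapping.keys g"
  have "poly_at (f + g) v = (\<Sum>m\<in>?S. Poly_Mapping.lookup (f + g) m * mon m v)"
    by (rule poly_at_superset) (auto dest: subsetD[OF keys_add])
  moreover have "poly_at f v = (\<Sum>m\<in>?S. Poly_Mapping.lookup f m * mon m v)"
    by (rule poly_at_superset) auto
  moreover have "poly_at g v = (\<Sum>m\<in>?S. Poly_Mapping.lookup g m * mon m v)"
    by (rule poly_at_superset) auto
  ultimately show ?thesis
    by (simp add: lookup_add algebra_simps sum.distrib)
qed

lemma poly_at_zero [simp]: "poly_at 0 v = 0"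
  by (simp add: poly_at_def)

lemma poly_at_single: "poly_at (Poly_Mapping.single m c) v = c * mon m v"
  by (subst poly_at_superset[of "{m}"]) auto

text \<open>\<open>update_induct\<close> builds a polynomial by setting one new coefficient at a
  time. This turns such a step into the addition of a monomial, where distributivity
  applies.\<close>

lemma update_eq_single_add:
  assumes "a \<notin> Poly_Mapping.keys f"
  shows "Poly_Mapping.update a b f = Poly_Mapping.single a b + f"
  using assms
  by (intro poly_mapping_eqI)
     (auto simp: lookup_update lookup_add lookup_single in_keys_iff when_def)

lemma poly_at_mult: "poly_at (f * g) v = poly_at f v * poly_at g v"
proof -
  \<comment> \<open>The two factors are taken apart one after the other: a monomial against any
    polynomial here, by induction on the second factor, and the general product below, by induction
    on the first.\<close>
  have single: "poly_at (Poly_Mapping.single m c * g) v = c * mon m v * poly_at g v" for m c g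
  proof (induction g rule: update_induct)
    case (update g a b)
    then show ?case
      by (simp add: update_eq_single_add ring_distribs mult_single poly_at_add poly_at_single mon_add)
  qed simp
  show ?thesis
  proof (induction f rule: update_induct)
    case (update f a b)
    then show ?case
      by (simp add: update_eq_single_add ring_distribs single poly_at_add poly_at_single)
  qed simp
qed

lemma homogeneous_alt:
  "homogeneous n d f \<longleftrightarrow> (\<forall>m\<in>Poly_Mapping.keys f. Poly_Mapping.keys m \<subseteq> {..n} \<and> mon_deg m = d)"
  by (simp add: homogeneous_def mon_deg_def)

lemma homogeneous_add: "homogeneous n d f \<Longrightarrow> homogeneous n d g \<Longrightarrow> homogeneous n d (f + g)"
  unfolding homogeneous_alt using keys_add[of f g] by blast

lemma homogeneous_mult:
  assumes "homogeneous n d f" "homogeneous n e g"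
  shows "homogeneous n (d + e) (f * g)"
  unfolding homogeneous_alt
proof
  fix m assume "m \<in> Poly_Mapping.keys (f * g)"
  then obtain a b where ab: "m = a + b" "a \<in> Poly_Mapping.keys f" "b \<in> Poly_Mapping.keys g"
    using keys_mult[of f g] by blast
  then show "Poly_Mapping.keys m \<subseteq> {..n} \<and> mon_deg m = d + e"
    using assms keys_add[of a b] by (fastforce simp: homogeneous_alt mon_deg_add)
qed

lemma homogeneous_zero [simp]: "homogeneous n d 0"
  by (simp add: homogeneous_def)

lemma homogeneous_const: "homogeneous n 0 (Poly_Mapping.single 0 c)"
  by (simp add: homogeneous_def)

lemma homogeneous_one [simp]: "homogeneous n 0 1"
  using homogeneous_const[of n 1] by simp

lemma homogeneous_var:
  "i \<le> n \<Longrightarrow> homogeneous n 1 (Poly_Mapping.single (Poly_Mapping.single i 1) c)"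
  by (auto simp: homogeneous_def)

lemma poly_at_const [simp]: "poly_at (Poly_Mapping.single 0 c) v = c"
  by (simp add: poly_at_single mon_def)

lemma poly_at_one [simp]: "poly_at 1 v = 1"
  using poly_at_const[of 1 v] by simp

lemma poly_at_var [simp]: "poly_at (Poly_Mapping.single (Poly_Mapping.single i (Suc 0)) c) v = c * v $ i"
  by (simp add: poly_at_single mon_def)

lemma poly_at_scale:
  assumes "homogeneous n d f" "v \<in> carrier_vec (n + 1)"
  shows "poly_at f (c \<cdot>\<^sub>v v) = c ^ d * poly_at f v"
proof -
  have "poly_at f (c \<cdot>\<^sub>v v) = (\<Sum>m\<in>Poly_Mapping.keys f. c ^ d * (Poly_Mapping.lookup f m * mon m v))"
    unfolding poly_at_superset[OF finite_keys order_refl]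
  proof (intro sum.cong refl)
    fix m assume "m \<in> Poly_Mapping.keys f"
    then show "Poly_Mapping.lookup f m * mon m (c \<cdot>\<^sub>v v) = c ^ d * (Poly_Mapping.lookup f m * mon m v)"
      using assms mon_scale[of m n v c] by (simp add: homogeneous_alt)
  qed
  then show ?thesis
    by (simp add: poly_at_superset[OF finite_keys order_refl] sum_distrib_left)
qed

text \<open>A choice of homogeneous coordinates at each point, with no regularity as the point
  varies. It allows homogeneous functions of nonzero degree to be treated as functions of a
  point.\<close>

definition rep :: "point \<Rightarrow> complex vec" where
  "rep p = (SOME v. v \<in> p)"

definition coord :: "nat \<Rightarrow> point \<Rightarrow> complex" where
  "coord i p = rep p $ i"

lemma coord_ratio_eq: "coord_ratio j i p = coord j p / coord i p"
  by (simp add: coord_ratio_def coord_def rep_def Let_def)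

lemma proj_space_point:
  assumes "p \<in> proj_space n"
  obtains v where "v \<in> carrier_vec (n + 1)" "v \<noteq> 0\<^sub>v (n + 1)" "p = {c \<cdot>\<^sub>v v | c. c \<noteq> 0}"
proof -
  from assms obtain v where "v \<in> carrier_vec (n + 1) - {0\<^sub>v (n + 1)}" "p = proportional n `` {v}"
    unfolding proj_space_def by (rule quotientE)
  moreover from this have "p = {c \<cdot>\<^sub>v v | c. c \<noteq> 0}"
    by (simp add: proportional_def Image_def) blast
  ultimately show ?thesis
    using that[of v] by blast
qed

lemma rep_point:
  assumes "p \<in> proj_space n"
  shows "rep p \<in> carrier_vec (n + 1)" "rep p \<noteq> 0\<^sub>v (n + 1)"
    "p = {c \<cdot>\<^sub>v rep p | c. c \<noteq> 0}" "rep p \<in> p"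
proof -
  from assms obtain v where v: "v \<in> carrier_vec (n + 1)" "v \<noteq> 0\<^sub>v (n + 1)" "p = {c \<cdot>\<^sub>v v | c. c \<noteq> 0}"
    by (rule proj_space_point)
  have "1 \<cdot>\<^sub>v v = v" by simp
  then have "v \<in> p" unfolding v(3) by (intro CollectI exI[of _ 1]) simp
  then show "rep p \<in> p" unfolding rep_def by (rule someI)
  then obtain c where c: "c \<noteq> 0" "rep p = c \<cdot>\<^sub>v v" using v(3) by auto
  show "rep p \<in> carrier_vec (n + 1)" using c v by simp
  have vr: "v = (1 / c) \<cdot>\<^sub>v rep p" unfolding c(2) using c(1) by (simp add: smult_smult_assoc)
  show "rep p \<noteq> 0\<^sub>v (n + 1)"
  proof
    assume "rep p = 0\<^sub>v (n + 1)"
    then have "v = 0\<^sub>v (n + 1)" unfolding vr by (intro eq_vecI) auto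
    then show False using v by simp
  qed
  show "p = {c \<cdot>\<^sub>v rep p | c. c \<noteq> 0}"
  proof (intro equalityI subsetI)
    fix w assume "w \<in> p"
    then obtain b where "b \<noteq> 0" "w = b \<cdot>\<^sub>v v" using v(3) by auto
    then have "w = (b / c) \<cdot>\<^sub>v rep p" "b / c \<noteq> 0" unfolding c(2) using c(1) by (simp_all add: smult_smult_assoc)
    then show "w \<in> {c \<cdot>\<^sub>v rep p | c. c \<noteq> 0}" by blast
  next
    fix w assume "w \<in> {c \<cdot>\<^sub>v rep p | c. c \<noteq> 0}"
    then obtain b where "b \<noteq> 0" "w = b \<cdot>\<^sub>v rep p" by auto
    then have "w = (b * c) \<cdot>\<^sub>v v" "b * c \<noteq> 0" using c(1) by (simp_all add: c(2) smult_smult_assoc)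
    then show "w \<in> p" unfolding v(3) by blast
  qed
qed

lemma coord_nonzero: "p \<in> proj_space n \<Longrightarrow> \<exists>i\<le>n. coord i p \<noteq> 0"
proof (rule ccontr)
  assume p: "p \<in> proj_space n" and "\<not> (\<exists>i\<le>n. coord i p \<noteq> 0)"
  then have "rep p = 0\<^sub>v (n + 1)"
    using rep_point(1)[OF p] by (intro eq_vecI) (auto simp: coord_def less_Suc_eq_le)
  then show False using rep_point(2)[OF p] by simp
qed

text \<open>The basic definitions quantify over all coordinate vectors of a point. For conditions
  invariant under scaling it is enough to look at \<open>rep p\<close>.\<close>

lemma all_representatives:
  assumes "p \<in> proj_space n" "\<And>c v. v \<in> carrier_vec (n + 1) \<Longrightarrow> c \<noteq> 0 \<Longrightarrow> P (c \<cdot>\<^sub>v v) \<longleftrightarrow> P v"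
  shows "(\<forall>v\<in>p. P v) \<longleftrightarrow> P (rep p)"
proof
  assume "P (rep p)"
  show "\<forall>v\<in>p. P v"
  proof
    fix v assume "v \<in> p"
    then obtain c where "c \<noteq> 0" "v = c \<cdot>\<^sub>v rep p" using rep_point(3)[OF assms(1)] by auto
    then show "P v" using assms(2)[OF rep_point(1)[OF assms(1)]] \<open>P (rep p)\<close> by simp
  qed
qed (use rep_point(4)[OF assms(1)] in blast)

lemma poly_at_zero_iff:
  assumes "p \<in> proj_space n" "homogeneous n d f"
  shows "(\<forall>v\<in>p. poly_at f v = 0) \<longleftrightarrow> poly_at f (rep p) = 0"
    and "(\<forall>v\<in>p. poly_at f v \<noteq> 0) \<longleftrightarrow> poly_at f (rep p) \<noteq> 0"
  by (rule all_representatives[OF assms(1)], simp add: poly_at_scale[OF assms(2)])+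

section \<open>Zariski open sets and the filter of neighbourhoods of a point\<close>

lemma zariski_closed_alt:
  "zariski_closed n Z \<longleftrightarrow> (\<exists>T. (\<forall>f\<in>T. \<exists>d. homogeneous n d f) \<and>
     Z = {p \<in> proj_space n. \<forall>f\<in>T. poly_at f (rep p) = 0})"
proof -
  have "{p \<in> proj_space n. \<forall>f\<in>T. \<forall>v\<in>p. poly_at f v = 0} = {p \<in> proj_space n. \<forall>f\<in>T. poly_at f (rep p) = 0}"
    if "\<forall>f\<in>T. \<exists>d. homogeneous n d f" for T
    using that poly_at_zero_iff(1) by (intro Collect_cong conj_cong ball_cong refl) blast
  then show ?thesis
    unfolding zariski_closed_def by (intro ex_cong) simp
qed

text \<open>In this form an open set is a union of nonvanishing loci of forms, so that intersections
  of open sets come from products of forms.\<close>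

lemma zariski_open_alt:
  "zariski_open n U \<longleftrightarrow> (\<exists>T. (\<forall>f\<in>T. \<exists>d. homogeneous n d f) \<and>
     U = {p \<in> proj_space n. \<exists>f\<in>T. poly_at f (rep p) \<noteq> 0})"
proof
  assume "zariski_open n U"
  then obtain T where T: "U \<subseteq> proj_space n" "\<forall>f\<in>T. \<exists>d. homogeneous n d f"
     "proj_space n - U = {p \<in> proj_space n. \<forall>f\<in>T. poly_at f (rep p) = 0}"
    unfolding zariski_open_def zariski_closed_alt by auto
  then have "U = {p \<in> proj_space n. \<exists>f\<in>T. poly_at f (rep p) \<noteq> 0}" by blast
  then show "\<exists>T. (\<forall>f\<in>T. \<exists>d. homogeneous n d f) \<and>
     U = {p \<in> proj_space n. \<exists>f\<in>T. poly_at f (rep p) \<noteq> 0}" using T(2) by blast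
next
  assume "\<exists>T. (\<forall>f\<in>T. \<exists>d. homogeneous n d f) \<and>
     U = {p \<in> proj_space n. \<exists>f\<in>T. poly_at f (rep p) \<noteq> 0}"
  then obtain T where T: "\<forall>f\<in>T. \<exists>d. homogeneous n d f"
     "U = {p \<in> proj_space n. \<exists>f\<in>T. poly_at f (rep p) \<noteq> 0}" by blast
  then have "proj_space n - U = {p \<in> proj_space n. \<forall>f\<in>T. poly_at f (rep p) = 0}" by blast
  then show "zariski_open n U"
    unfolding zariski_open_def zariski_closed_alt using T by blast
qed

lemma zariski_open_nonvanishing:
  "homogeneous n d f \<Longrightarrow> zariski_open n {p \<in> proj_space n. poly_at f (rep p) \<noteq> 0}"
  unfolding zariski_open_alt by (intro exI[of _ "{f}"]) auto

lemma zariski_open_proj_space: "zariski_open n (proj_space n)"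
  using zariski_open_nonvanishing[OF homogeneous_const[of n 1]] by simp

lemma zariski_open_coord: "i \<le> n \<Longrightarrow> zariski_open n {p \<in> proj_space n. coord i p \<noteq> 0}"
  using zariski_open_nonvanishing[OF homogeneous_var[of i n 1]] by (simp add: coord_def)

lemma zariski_open_subset: "zariski_open n U \<Longrightarrow> U \<subseteq> proj_space n"
  by (simp add: zariski_open_def)

lemma zariski_open_Int:
  assumes "zariski_open n U" "zariski_open n U'"
  shows "zariski_open n (U \<inter> U')"
proof -
  obtain T T' where T: "\<forall>f\<in>T. \<exists>d. homogeneous n d f"
     "U = {p \<in> proj_space n. \<exists>f\<in>T. poly_at f (rep p) \<noteq> 0}"
     and T': "\<forall>f\<in>T'. \<exists>d. homogeneous n d f"
     "U' = {p \<in> proj_space n. \<exists>f\<in>T'. poly_at f (rep p) \<noteq> 0}"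
    using assms unfolding zariski_open_alt by auto
  let ?T = "{f * g | f g. f \<in> T \<and> g \<in> T'}"
  have "\<forall>f\<in>?T. \<exists>d. homogeneous n d f" using T(1) T'(1) homogeneous_mult by blast
  moreover have "U \<inter> U' = {p \<in> proj_space n. \<exists>f\<in>?T. poly_at f (rep p) \<noteq> 0}"
  proof (intro equalityI subsetI)
    fix p assume "p \<in> U \<inter> U'"
    then obtain f g where "p \<in> proj_space n" "f \<in> T" "g \<in> T'" "poly_at (f * g) (rep p) \<noteq> 0"
      unfolding T(2) T'(2) by (auto simp: poly_at_mult)
    then show "p \<in> {p \<in> proj_space n. \<exists>f\<in>?T. poly_at f (rep p) \<noteq> 0}" by blast
  next
    fix p assume "p \<in> {p \<in> proj_space n. \<exists>f\<in>?T. poly_at f (rep p) \<noteq> 0}"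
    then obtain f g where "p \<in> proj_space n" "f \<in> T" "g \<in> T'" "poly_at (f * g) (rep p) \<noteq> 0" by blast
    then show "p \<in> U \<inter> U'" unfolding T(2) T'(2) by (auto simp: poly_at_mult)
  qed
  ultimately show ?thesis unfolding zariski_open_alt by blast
qed

text \<open>Packing neighbourhoods into a filter leaves all shrinking of open sets to
  \<open>eventually_elim\<close>. The neighbourhoods are not punctured, so what holds eventually
  holds at \<open>p\<close> itself.\<close>

definition zar :: "nat \<Rightarrow> point \<Rightarrow> point filter" where
  "zar n p = (INF U\<in>{U. zariski_open n U \<and> p \<in> U}. principal U)"

lemma eventually_zar:
  assumes "p \<in> proj_space n"
  shows "eventually P (zar n p) \<longleftrightarrow> (\<exists>U. zariski_open n U \<and> p \<in> U \<and> (\<forall>q\<in>U. P q))"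
proof -
  have "eventually P (zar n p) \<longleftrightarrow>
    (\<exists>U\<in>{U. zariski_open n U \<and> p \<in> U}. eventually P (principal U))"
    unfolding zar_def
  proof (rule eventually_INF_base)
    show "{U. zariski_open n U \<and> p \<in> U} \<noteq> {}"
      using assms zariski_open_proj_space[of n] by auto
    fix a b assume "a \<in> {U. zariski_open n U \<and> p \<in> U}" "b \<in> {U. zariski_open n U \<and> p \<in> U}"
    then show "\<exists>x\<in>{U. zariski_open n U \<and> p \<in> U}. principal x \<le> inf (principal a) (principal b)"
      by (intro bexI[of _ "a \<inter> b"]) (auto simp: zariski_open_Int)
  qed
  then show ?thesis by (auto simp: eventually_principal)
qed

lemma eventually_zar_open:
  assumes "zariski_open n U" "p \<in> U"
  shows "eventually (\<lambda>q. q \<in> U) (zar n p)"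
  using assms zariski_open_subset[OF assms(1)] by (subst eventually_zar) auto

lemma eventually_zar_self:
  assumes "p \<in> proj_space n" "eventually P (zar n p)"
  shows "P p"
  using assms by (auto simp: eventually_zar)

section \<open>Germs of homogeneous rational functions\<close>

text \<open>\<open>hreg n t p s\<close>: near \<open>p\<close>, \<open>s q\<close> is the value at the chosen homogeneous coordinates \<open>rep q\<close>
  of a quotient of two forms whose degrees differ by \<open>t\<close>. Unless \<open>t = 0\<close>, this depends on the choice
  of coordinates.\<close>

definition hreg :: "nat \<Rightarrow> int \<Rightarrow> point \<Rightarrow> (point \<Rightarrow> complex) \<Rightarrow> bool" where
  "hreg n t p s \<longleftrightarrow> p \<in> proj_space n \<and>
     (\<exists>d e f g. homogeneous n d f \<and> homogeneous n e g \<and> int d - int e = t \<and>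
        eventually (\<lambda>q. poly_at g (rep q) \<noteq> 0 \<and> s q = poly_at f (rep q) / poly_at g (rep q)) (zar n p))"

lemma hreg_cong:
  assumes "hreg n t p s" "eventually (\<lambda>q. s q = s' q) (zar n p)"
  shows "hreg n t p s'"
proof -
  from assms(1) obtain d e f g where "p \<in> proj_space n" "homogeneous n d f" "homogeneous n e g" "int d - int e = t"
     and ev: "eventually (\<lambda>q. poly_at g (rep q) \<noteq> 0 \<and> s q = poly_at f (rep q) / poly_at g (rep q)) (zar n p)"
    unfolding hreg_def by blast
  moreover have "eventually (\<lambda>q. poly_at g (rep q) \<noteq> 0 \<and> s' q = poly_at f (rep q) / poly_at g (rep q)) (zar n p)"
    using ev assms(2) by eventually_elim auto
  ultimately show ?thesis unfolding hreg_def by blast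
qed

lemma hregI:
  assumes "p \<in> proj_space n" "homogeneous n d f" "homogeneous n e g" "int d - int e = t"
   "eventually (\<lambda>q. poly_at g (rep q) \<noteq> 0 \<and> s q = poly_at f (rep q) / poly_at g (rep q)) (zar n p)"
  shows "hreg n t p s"
  using assms unfolding hreg_def by blast

lemma hregE:
  assumes "hreg n t p s"
  obtains d e f g where "p \<in> proj_space n" "homogeneous n d f" "homogeneous n e g" "int d - int e = t"
   "eventually (\<lambda>q. poly_at g (rep q) \<noteq> 0 \<and> s q = poly_at f (rep q) / poly_at g (rep q)) (zar n p)"
  using assms unfolding hreg_def by blast

lemma hreg_point: "hreg n t p s \<Longrightarrow> p \<in> proj_space n"
  by (simp add: hreg_def)

lemma hreg_mult:
  assumes "hreg n t p s" "hreg n t' p s'"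
  shows "hreg n (t + t') p (\<lambda>q. s q * s' q)"
  using assms(1)
proof (rule hregE)
  fix d e f g assume 1: "p \<in> proj_space n" "homogeneous n d f" "homogeneous n e g" "int d - int e = t"
   "eventually (\<lambda>q. poly_at g (rep q) \<noteq> 0 \<and> s q = poly_at f (rep q) / poly_at g (rep q)) (zar n p)"
  show ?thesis using assms(2)
  proof (rule hregE)
    fix d' e' f' g' assume 2: "homogeneous n d' f'" "homogeneous n e' g'" "int d' - int e' = t'"
     "eventually (\<lambda>q. poly_at g' (rep q) \<noteq> 0 \<and> s' q = poly_at f' (rep q) / poly_at g' (rep q)) (zar n p)"
    show ?thesis
    proof (rule hregI[OF 1(1) homogeneous_mult[OF 1(2) 2(1)] homogeneous_mult[OF 1(3) 2(2)]])
      show "int (d + d') - int (e + e') = t + t'" using 1(4) 2(3) by simp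
      show "\<forall>\<^sub>F q in zar n p. poly_at (g * g') (rep q) \<noteq> 0 \<and>
            s q * s' q = poly_at (f * f') (rep q) / poly_at (g * g') (rep q)"
        using 1(5) 2(4) by eventually_elim (simp add: poly_at_mult)
    qed
  qed
qed

lemma hreg_add:
  assumes "hreg n t p s" "hreg n t p s'"
  shows "hreg n t p (\<lambda>q. s q + s' q)"
  using assms(1)
proof (rule hregE)
  fix d e f g assume 1: "p \<in> proj_space n" "homogeneous n d f" "homogeneous n e g" "int d - int e = t"
   "eventually (\<lambda>q. poly_at g (rep q) \<noteq> 0 \<and> s q = poly_at f (rep q) / poly_at g (rep q)) (zar n p)"
  show ?thesis using assms(2)
  proof (rule hregE)
    fix d' e' f' g' assume 2: "homogeneous n d' f'" "homogeneous n e' g'" "int d' - int e' = t"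
     "eventually (\<lambda>q. poly_at g' (rep q) \<noteq> 0 \<and> s' q = poly_at f' (rep q) / poly_at g' (rep q)) (zar n p)"
    \<comment> \<open>Both quotients have degree \<open>t\<close>, so the two cross products in the
      numerator of the sum have the same degree and add up to a form.\<close>
    have "e + d' = d + e'" using 1(4) 2(3) by linarith
    then have "homogeneous n (d + e') (f * g' + g * f')"
      using homogeneous_mult[OF 1(2) 2(2)] homogeneous_mult[OF 1(3) 2(1)] by (simp add: homogeneous_add)
    then show ?thesis
    proof (rule hregI[OF 1(1) _ homogeneous_mult[OF 1(3) 2(2)]])
      show "int (d + e') - int (e + e') = t" using 1(4) 2(3) by simp
      show "\<forall>\<^sub>F q in zar n p. poly_at (g * g') (rep q) \<noteq> 0 \<and>
            s q + s' q = poly_at (f * g' + g * f') (rep q) / poly_at (g * g') (rep q)"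
        using 1(5) 2(4) by eventually_elim (simp add: poly_at_mult poly_at_add field_simps)
    qed
  qed
qed

lemma hreg_zero: "p \<in> proj_space n \<Longrightarrow> hreg n t p (\<lambda>_. 0)"
proof (cases "t \<ge> 0")
  case True
  assume "p \<in> proj_space n"
  then show ?thesis using True
    by (intro hregI[where f=0 and g="Poly_Mapping.single 0 1" and d="nat t" and e=0])
       (auto simp: homogeneous_const)
next
  case False
  assume p: "p \<in> proj_space n"
  then obtain i where i: "i \<le> n" "coord i p \<noteq> 0" using coord_nonzero by blast
  \<comment> \<open>For negative \<open>t\<close> the denominator must have positive degree and must
    not vanish near \<open>p\<close>; a power of a coordinate that is nonzero at \<open>p\<close>
    does this.\<close>
  define g :: "cpoly" where "g = Poly_Mapping.single (Poly_Mapping.single i (nat (- t))) 1"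
  have at: "poly_at g v = v $ i ^ nat (- t)" for v
    using False by (simp add: g_def poly_at_single mon_def)
  have "eventually (\<lambda>q. q \<in> {p \<in> proj_space n. coord i p \<noteq> 0}) (zar n p)"
    using eventually_zar_open[OF zariski_open_coord[OF i(1)], of p] p i by simp
  then have "eventually (\<lambda>q. poly_at g (rep q) \<noteq> 0 \<and> 0 = poly_at 0 (rep q) / poly_at g (rep q)) (zar n p)"
    by eventually_elim (simp add: at coord_def)
  then show ?thesis
  proof (intro hregI[where f = 0 and d = 0, OF p])
    show "homogeneous n (nat (- t)) g"
      using i by (auto simp: homogeneous_def g_def)
    show "int 0 - int (nat (- t)) = t" using False by simp
  qed simp
qed

lemma hreg_const: "p \<in> proj_space n \<Longrightarrow> hreg n 0 p (\<lambda>_. c)"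
  by (rule hregI[where f="Poly_Mapping.single 0 c" and g="Poly_Mapping.single 0 1" and d=0 and e=0])
     (auto simp: homogeneous_const)

lemma hreg_coord: "p \<in> proj_space n \<Longrightarrow> i \<le> n \<Longrightarrow> hreg n 1 p (coord i)"
  by (rule hregI[where f="Poly_Mapping.single (Poly_Mapping.single i 1) 1" and g="Poly_Mapping.single 0 1" and d=1 and e=0])
     (auto simp: homogeneous_const homogeneous_var[unfolded One_nat_def] coord_def)

lemma hreg_nonzero:
  assumes "hreg n t p s" "s p \<noteq> 0"
  shows "eventually (\<lambda>q. s q \<noteq> 0) (zar n p)"
  using assms(1)
proof (rule hregE)
  fix d e f g assume 1: "p \<in> proj_space n" "homogeneous n d f" "homogeneous n e g" "int d - int e = t"
   and ev: "eventually (\<lambda>q. poly_at g (rep q) \<noteq> 0 \<and> s q = poly_at f (rep q) / poly_at g (rep q)) (zar n p)"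
  have "poly_at f (rep p) \<noteq> 0" using eventually_zar_self[OF 1(1) ev] assms(2) by auto
  then have "eventually (\<lambda>q. q \<in> {q \<in> proj_space n. poly_at f (rep q) \<noteq> 0}) (zar n p)"
    using 1(1) by (intro eventually_zar_open zariski_open_nonvanishing[OF 1(2)]) auto
  then show ?thesis using ev by eventually_elim auto
qed

lemma hreg_inverse:
  assumes "hreg n t p s" "s p \<noteq> 0"
  shows "hreg n (- t) p (\<lambda>q. inverse (s q))"
  using assms(1)
proof (rule hregE)
  fix d e f g assume 1: "p \<in> proj_space n" "homogeneous n d f" "homogeneous n e g" "int d - int e = t"
   and ev: "eventually (\<lambda>q. poly_at g (rep q) \<noteq> 0 \<and> s q = poly_at f (rep q) / poly_at g (rep q)) (zar n p)"
  have "eventually (\<lambda>q. poly_at f (rep q) \<noteq> 0 \<and> inverse (s q) = poly_at g (rep q) / poly_at f (rep q)) (zar n p)"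
    using hreg_nonzero[OF assms] ev by eventually_elim auto
  then show ?thesis using 1 by (intro hregI[OF 1(1) 1(3) 1(2)]) auto
qed

lemma hreg_sum:
  assumes "p \<in> proj_space n" "\<And>a. a \<in> A \<Longrightarrow> hreg n t p (s a)"
  shows "hreg n t p (\<lambda>q. \<Sum>a\<in>A. s a q)"
  using assms(2)
  by (induction A rule: infinite_finite_induct) (auto intro: hreg_add hreg_zero assms(1))

lemma hreg_prod:
  assumes "p \<in> proj_space n" "finite A" "\<And>a. a \<in> A \<Longrightarrow> hreg n (t a) p (s a)"
  shows "hreg n (\<Sum>a\<in>A. t a) p (\<lambda>q. \<Prod>a\<in>A. s a q)"
  using assms(2,3)
  by (induction A rule: finite_induct) (auto intro: hreg_mult hreg_const assms(1))

lemma hreg_power: "hreg n t p s \<Longrightarrow> hreg n (int k * t) p (\<lambda>q. s q ^ k)"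
proof (induction k)
  case (Suc k)
  from hreg_mult[OF Suc.prems Suc.IH[OF Suc.prems]] show ?case by (simp add: algebra_simps)
qed (auto simp: hreg_const hreg_point)

lemma hreg_powi:
  assumes "hreg n t p s" "s p \<noteq> 0"
  shows "hreg n (k * t) p (\<lambda>q. s q powi k)"
proof (cases "k \<ge> 0")
  case True
  then show ?thesis using hreg_power[OF assms(1), of "nat k"] by (simp add: power_int_def)
next
  case False
  then show ?thesis using hreg_power[OF hreg_inverse[OF assms], of "nat (- k)"]
    by (simp add: power_int_def)
qed

lemma hreg_coord_powi:
  "p \<in> proj_space n \<Longrightarrow> i \<le> n \<Longrightarrow> coord i p \<noteq> 0 \<Longrightarrow> hreg n k p (\<lambda>q. coord i q powi k)"
  using hreg_powi[OF hreg_coord] by fastforce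

lemma hreg_divide:
  assumes "hreg n t p s" "hreg n t' p s'" "s' p \<noteq> 0"
  shows "hreg n (t - t') p (\<lambda>q. s q / s' q)"
  using hreg_mult[OF assms(1) hreg_inverse[OF assms(2,3)]] by (simp add: divide_inverse)

section \<open>Regular functions are exactly the germs of degree 0\<close>

lemma regular_onD:
  assumes "regular_on n U h" "p \<in> U"
  shows "hreg n 0 p h"
proof -
  from assms obtain W d f g where W: "zariski_open n W" "p \<in> W" "homogeneous n d f" "homogeneous n d g"
    "\<forall>q\<in>W. \<forall>v\<in>q. poly_at g v \<noteq> 0 \<and> h q = poly_at f v / poly_at g v"
    unfolding regular_on_def by blast
  have p: "p \<in> proj_space n" using W zariski_open_subset by blast
  have "eventually (\<lambda>q. poly_at g (rep q) \<noteq> 0 \<and> h q = poly_at f (rep q) / poly_at g (rep q)) (zar n p)"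
    unfolding eventually_zar[OF p]
    using W rep_point(4) zariski_open_subset[OF W(1)] by (intro exI[of _ W]) blast
  then show ?thesis using W by (intro hregI[OF p W(3) W(4)]) auto
qed

lemma regular_onI:
  assumes "zariski_open n U" "\<And>p. p \<in> U \<Longrightarrow> hreg n 0 p h"
  shows "regular_on n U h"
  unfolding regular_on_def
proof
  fix p assume "p \<in> U"
  from assms(2)[OF this]
  show "\<exists>W d f g. zariski_open n W \<and> p \<in> W \<and> W \<subseteq> U \<and> homogeneous n d f \<and> homogeneous n d g \<and>
        (\<forall>q\<in>W. \<forall>v\<in>q. poly_at g v \<noteq> 0 \<and> h q = poly_at f v / poly_at g v)"
  proof (rule hregE)
    fix d e f g assume 1: "p \<in> proj_space n" "homogeneous n d f" "homogeneous n e g" "int d - int e = 0"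
      and ev: "eventually (\<lambda>q. poly_at g (rep q) \<noteq> 0 \<and> h q = poly_at f (rep q) / poly_at g (rep q)) (zar n p)"
    from ev obtain W where W: "zariski_open n W" "p \<in> W"
      "\<forall>q\<in>W. poly_at g (rep q) \<noteq> 0 \<and> h q = poly_at f (rep q) / poly_at g (rep q)"
      unfolding eventually_zar[OF 1(1)] by blast
    \<comment> \<open>With equal degrees, a rescaling of the coordinate vector multiplies numerator
      and denominator by the same factor. This carries the formula from \<open>rep q\<close> to
      every vector in \<open>q\<close>.\<close>
    have [simp]: "e = d" using 1(4) by simp
    have "poly_at g v \<noteq> 0 \<and> h q = poly_at f v / poly_at g v" if q: "q \<in> W \<inter> U" "v \<in> q" for q v
    proof -
      have qp: "q \<in> proj_space n" using q assms(1) zariski_open_subset by blast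
      from rep_point(3)[OF qp] q(2) obtain c where "c \<noteq> 0" "v = c \<cdot>\<^sub>v rep q" by auto
      then show ?thesis
        using W(3) q(1) poly_at_scale[OF 1(2) rep_point(1)[OF qp], of c]
           poly_at_scale[OF 1(3) rep_point(1)[OF qp], of c] by auto
    qed
    then show ?thesis using 1 W zariski_open_Int[OF W(1) assms(1)] \<open>p \<in> U\<close>
      by (intro exI[of _ "W \<inter> U"] exI[of _ d] exI[of _ f] exI[of _ g]) auto
  qed
qed

lemma regular_mat_onI:
  assumes "zariski_open n U" "\<And>p. p \<in> U \<Longrightarrow> M p \<in> carrier_mat r s"
    "\<And>p a b. p \<in> U \<Longrightarrow> a < r \<Longrightarrow> b < s \<Longrightarrow> hreg n 0 p (\<lambda>q. M q $$ (a, b))"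
  shows "regular_mat_on n U r s M"
  unfolding regular_mat_on_def using assms by (auto intro!: regular_onI)

lemma regular_mat_onD:
  assumes "regular_mat_on n U r s M" "p \<in> U"
  shows "M p \<in> carrier_mat r s" "a < r \<Longrightarrow> b < s \<Longrightarrow> hreg n 0 p (\<lambda>q. M q $$ (a, b))"
  using assms unfolding regular_mat_on_def by (auto intro: regular_onD)

section \<open>Linear algebra\<close>

lemma sum_single_left:
  fixes f g :: "'a \<Rightarrow> complex"
  assumes "finite S" "a \<in> S"
  shows "(\<Sum>h\<in>S. (if a = h then g h else 0) * f h) = g a * f a"
    "(\<Sum>h\<in>S. (if h = a then g h else 0) * f h) = g a * f a"
proof -
  show "(\<Sum>h\<in>S. (if h = a then g h else 0) * f h) = g a * f a"
    using assms by (subst sum.remove[of S a]) auto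
  moreover have "(\<Sum>h\<in>S. (if a = h then g h else 0) * f h) = (\<Sum>h\<in>S. (if h = a then g h else 0) * f h)"
    by (intro sum.cong) auto
  ultimately show "(\<Sum>h\<in>S. (if a = h then g h else 0) * f h) = g a * f a"
    by simp
qed

lemma sum_lessThan_add: "(\<Sum>k<a + b. g k) = (\<Sum>k<a. g k) + (\<Sum>l<b. g (a + l) :: complex)" for a b :: nat
  by (induction b) (simp_all add: add.assoc)

lemma mult_mat_vec_index:
  "A \<in> carrier_mat m k \<Longrightarrow> v \<in> carrier_vec k \<Longrightarrow> i < m \<Longrightarrow> (A *\<^sub>v v) $ i = (\<Sum>j<k. A $$ (i, j) * v $ j)"
  by (auto simp: scalar_prod_def lessThan_atLeast0 intro!: sum.cong)

lemma mult_mat_index: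
  "A \<in> carrier_mat m k \<Longrightarrow> B \<in> carrier_mat k l \<Longrightarrow> i < m \<Longrightarrow> j < l \<Longrightarrow>
    (A * B) $$ (i, j) = (\<Sum>h<k. A $$ (i, h) * B $$ (h, j))"
  by (auto simp: scalar_prod_def lessThan_atLeast0 intro!: sum.cong)

lemma mat_eqI_vec:
  assumes "A \<in> carrier_mat m k" "B \<in> carrier_mat m k"
    "\<And>v. v \<in> carrier_vec k \<Longrightarrow> A *\<^sub>v v = B *\<^sub>v (v :: complex vec)"
  shows "A = B"
proof (rule eq_matI)
  have unit: "(M *\<^sub>v unit_vec k j) $ i = M $$ (i, j)" if "M \<in> carrier_mat m k" "i < m" "j < k" for M :: "complex mat" and i j
    using that by simp
  fix i j assume "i < dim_row B" "j < dim_col B"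
  then show "A $$ (i, j) = B $$ (i, j)"
    using assms(1,2) unit[OF assms(1), of i j] unit[OF assms(2), of i j] assms(3)[of "unit_vec k j"] by auto
qed (use assms in auto)

text \<open>Padded with zero rows to a square matrix, \<open>A\<close> becomes singular: the
  transpose kills \<open>unit_vec k m\<close>.\<close>

lemma wide_mat_kernel:
  fixes A :: "complex mat"
  assumes A: "A \<in> carrier_mat m k" and "m < k"
  shows "\<exists>v\<in>carrier_vec k. v \<noteq> 0\<^sub>v k \<and> A *\<^sub>v v = 0\<^sub>v m"
proof -
  define M where "M = mat k k (\<lambda>(i, j). if i < m then A $$ (i, j) else 0)"
  have M: "M \<in> carrier_mat k k" by (simp add: M_def)
  have row: "row M i \<bullet> v = (if i < m then (A *\<^sub>v v) $ i else 0)" if "i < k" "v \<in> carrier_vec k" for i v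
    using that A \<open>m < k\<close> by (auto simp: M_def scalar_prod_def)
  have "transpose_mat M *\<^sub>v unit_vec k m = 0\<^sub>v k"
    using \<open>m < k\<close> by (intro eq_vecI) (auto simp: M_def scalar_prod_def)
  then have "det (transpose_mat M) = 0"
    using M \<open>m < k\<close> by (subst det_0_iff_vec_prod_zero_field) (auto intro!: exI[of _ "unit_vec k m"])
  then have "det M = 0" using det_transpose[OF M] by simp
  then obtain v where v: "v \<in> carrier_vec k" "v \<noteq> 0\<^sub>v k" "M *\<^sub>v v = 0\<^sub>v k"
    using det_0_iff_vec_prod_zero_field[OF M] by blast
  have "A *\<^sub>v v = 0\<^sub>v m"
  proof (rule eq_vecI)
    fix i assume "i < dim_vec (0\<^sub>v m)"
    then have i: "i < m" by simp
    then have "(M *\<^sub>v v) $ i = 0" using v(3) \<open>m < k\<close> by simp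
    then show "(A *\<^sub>v v) $ i = 0\<^sub>v m $ i"
      using row[of i v] i v(1) \<open>m < k\<close> M A by auto
  qed (use A in auto)
  then show ?thesis using v by blast
qed

text \<open>Every term of the Leibniz formula uses each row and each column once, so all terms have
  the same degree as soon as the degree of an entry splits into a row part and a column
  part.\<close>

lemma hreg_det:
  assumes "p \<in> proj_space n" "eventually (\<lambda>q. M q \<in> carrier_mat k k) (zar n p)"
    and reg: "\<And>a b. a < k \<Longrightarrow> b < k \<Longrightarrow> hreg n (r a + c b) p (\<lambda>q. M q $$ (a, b))"
  shows "hreg n ((\<Sum>a<k. r a) + (\<Sum>b<k. c b)) p (\<lambda>q. det (M q))"
proof (rule hreg_cong)
  show "hreg n ((\<Sum>a<k. r a) + (\<Sum>b<k. c b)) p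
     (\<lambda>q. \<Sum>\<pi> | \<pi> permutes {0..<k}. signof \<pi> * (\<Prod>i = 0..<k. M q $$ (i, \<pi> i)))"
  proof (rule hreg_sum[OF assms(1)])
    fix \<pi> assume "\<pi> \<in> {\<pi>. \<pi> permutes {0..<k}}"
    then have \<pi>: "\<pi> permutes {0..<k}" by simp
    then have "hreg n (0 + (\<Sum>i = 0..<k. r i + c (\<pi> i))) p (\<lambda>q. signof \<pi> * (\<Prod>i = 0..<k. M q $$ (i, \<pi> i)))"
      using permutes_in_image[OF \<pi>]
      by (intro hreg_mult hreg_prod hreg_const assms(1) reg) auto
    moreover have "(\<Sum>i = 0..<k. c (\<pi> i)) = (\<Sum>i = 0..<k. c i)"
      using sum.permute[OF \<pi>, of c] by (simp add: o_def)
    ultimately show "hreg n ((\<Sum>a<k. r a) + (\<Sum>b<k. c b)) p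
        (\<lambda>q. signof \<pi> * (\<Prod>i = 0..<k. M q $$ (i, \<pi> i)))"
      by (simp add: sum.distrib lessThan_atLeast0)
  qed
  show "eventually (\<lambda>q. (\<Sum>\<pi> | \<pi> permutes {0..<k}. signof \<pi> * (\<Prod>i = 0..<k. M q $$ (i, \<pi> i))) = det (M q)) (zar n p)"
    using assms(2) by eventually_elim (simp add: det_def')
qed

text \<open>Gives regularity of a solution \<open>y\<close> that is known only pointwise. Replacing
  column \<open>b\<close> by the right-hand side changes the degree of that column from
  \<open>c b\<close> to \<open>t\<close>, so the quotient of determinants has degree
  \<open>t - c b\<close>.\<close>

lemma hreg_cramer:
  assumes p: "p \<in> proj_space n" and M: "eventually (\<lambda>q. M q \<in> carrier_mat k k) (zar n p)"
    and reg: "\<And>a b. a < k \<Longrightarrow> b < k \<Longrightarrow> hreg n (r a + c b) p (\<lambda>q. M q $$ (a, b))"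
    and det: "det (M p) \<noteq> 0"
    and y: "eventually (\<lambda>q. y q \<in> carrier_vec k) (zar n p)"
    and rhs: "\<And>a. a < k \<Longrightarrow> hreg n (r a + t) p (\<lambda>q. (M q *\<^sub>v y q) $ a)"
    and b: "b < k"
  shows "hreg n (t - c b) p (\<lambda>q. y q $ b)"
proof -
  let ?N = "\<lambda>q. replace_col (M q) (M q *\<^sub>v y q) b"
  define c' where "c' = c(b := t)"
  have N: "eventually (\<lambda>q. ?N q \<in> carrier_mat k k) (zar n p)"
    using M by eventually_elim (auto simp: replace_col_def)
  have regM: "hreg n ((\<Sum>a<k. r a) + (\<Sum>b<k. c b)) p (\<lambda>q. det (M q))"
    by (rule hreg_det[OF p M reg])
  have regN: "hreg n ((\<Sum>a<k. r a) + (\<Sum>b<k. c' b)) p (\<lambda>q. det (?N q))"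
  proof (rule hreg_det[OF p N])
    fix a j assume "a < k" "j < k"
    show "hreg n (r a + c' j) p (\<lambda>q. ?N q $$ (a, j))"
    proof (rule hreg_cong)
      show "hreg n (r a + c' j) p (\<lambda>q. if j = b then (M q *\<^sub>v y q) $ a else M q $$ (a, j))"
        using reg rhs \<open>a < k\<close> \<open>j < k\<close> by (auto simp: c'_def)
      show "eventually (\<lambda>q. (if j = b then (M q *\<^sub>v y q) $ a else M q $$ (a, j)) = ?N q $$ (a, j)) (zar n p)"
        using M by eventually_elim (use \<open>a < k\<close> \<open>j < k\<close> in \<open>auto simp: replace_col_def\<close>)
    qed
  qed
  have "(\<Sum>b<k. c' b) = (\<Sum>j<k. c j) + (t - c b)"
    using b by (simp add: c'_def sum.remove[of "{..<k}" b])
  then have "hreg n (t - c b) p (\<lambda>q. det (?N q) / det (M q))"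
    using hreg_divide[OF regN regM det] by simp
  then show ?thesis
  proof (rule hreg_cong)
    show "eventually (\<lambda>q. det (?N q) / det (M q) = y q $ b) (zar n p)"
      using hreg_nonzero[OF regM det] M y
      by eventually_elim (use b in \<open>simp add: cramer_lemma_mat\<close>)
  qed
qed

section \<open>Sums of line bundles\<close>

definition diag :: "nat \<Rightarrow> (nat \<Rightarrow> complex) \<Rightarrow> complex mat" where
  "diag N g = mat N N (\<lambda>(a, b). if a = b then g a else 0)"

lemma diag_carrier [simp]: "diag N g \<in> carrier_mat N N" "dim_row (diag N g) = N" "dim_col (diag N g) = N"
  by (simp_all add: diag_def)

lemma diag_index: "a < N \<Longrightarrow> b < N \<Longrightarrow> diag N g $$ (a, b) = (if a = b then g a else 0)"
  by (simp add: diag_def)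

lemma diag_mult_index:
  assumes "A \<in> carrier_mat N k" "a < N" "b < k"
  shows "(diag N g * A) $$ (a, b) = g a * A $$ (a, b)"
proof -
  have "(diag N g * A) $$ (a, b) = (\<Sum>h<N. (if h = a then g h else 0) * A $$ (h, b))"
    using assms by (subst mult_mat_index[of _ N N _ k]) (auto simp: diag_index intro!: sum.cong)
  then show ?thesis using assms by (simp only: sum_single_left finite_lessThan lessThan_iff)
qed

lemma mult_diag_index:
  assumes "A \<in> carrier_mat k N" "a < k" "b < N"
  shows "(A * diag N g) $$ (a, b) = A $$ (a, b) * g b"
proof -
  have "(A * diag N g) $$ (a, b) = (\<Sum>h<N. (if h = b then g h else 0) * A $$ (a, h))"
    using assms by (subst mult_mat_index[of _ k N _ N]) (auto simp: diag_index intro!: sum.cong)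
  also have "\<dots> = g b * A $$ (a, b)"
    by (rule sum_single_left) (use assms in auto)
  finally show ?thesis by simp
qed

lemma diag_mult_diag: "diag N g * diag N h = diag N (\<lambda>a. g a * h a)"
  by (rule eq_matI)
     (auto simp: diag_mult_index[OF diag_carrier(1)] diag_index simp del: index_mult_mat(1))

lemma diag_cong: "(\<And>a. a < N \<Longrightarrow> g a = h a) \<Longrightarrow> diag N g = diag N h"
  unfolding diag_def by (rule eq_matI) auto

lemma diag_one: "diag N (\<lambda>_. 1) = 1\<^sub>m N"
  unfolding diag_def by (rule eq_matI) auto

lemma diag_block_mat_singletons:
  "diag_block_mat (map (\<lambda>x. mat 1 1 (\<lambda>_. g x)) xs) = diag (length xs) (\<lambda>a. g (xs ! a))"
proof (induction xs)
  case Nil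
  then show ?case by (auto simp: diag_def)
next
  case (Cons x xs)
  show ?case
    unfolding list.map diag_block_mat.simps Let_def Cons.IH
    by (rule eq_matI) (auto simp: diag_def nth_Cons' less_Suc_eq_0_disj split: if_splits)
qed

text \<open>\<open>\<theta> i m\<close> is the frame of the \<open>m\<close>-th summand in chart \<open>i\<close>: a section given by
  functions \<open>s m\<close> of degree \<open>t m\<close> has coordinates \<open>s m / \<theta> i m\<close>.\<close>

definition diag_bundle ::
    "nat \<Rightarrow> 'i vbundle \<Rightarrow> nat \<Rightarrow> (nat \<Rightarrow> int) \<Rightarrow> ('i \<Rightarrow> nat \<Rightarrow> point \<Rightarrow> complex) \<Rightarrow> bool" where
  "diag_bundle n E N t \<theta> \<longleftrightarrow> bundle_rank E = N \<and>
     (\<forall>i\<in>charts E. zariski_open n (chart_dom E i)) \<and>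
     (\<Union>i\<in>charts E. chart_dom E i) = proj_space n \<and>
     (\<forall>i\<in>charts E. \<forall>p\<in>chart_dom E i. \<forall>m<N. hreg n (t m) p (\<theta> i m) \<and> \<theta> i m p \<noteq> 0) \<and>
     (\<forall>i\<in>charts E. \<forall>j\<in>charts E. \<forall>p\<in>chart_dom E i \<inter> chart_dom E j.
        transition E i j p = diag N (\<lambda>m. \<theta> j m p / \<theta> i m p))"

lemma diag_bundle_cong_degree:
  assumes "diag_bundle n E N t \<theta>" "\<And>m. m < N \<Longrightarrow> t m = t' m"
  shows "diag_bundle n E N t' \<theta>"
  using assms unfolding diag_bundle_def by simp

lemma hreg_eq_on_open:
  assumes "hreg n t p s" "zariski_open n U" "p \<in> U" "\<And>q. q \<in> U \<Longrightarrow> s' q = s q"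
  shows "hreg n t p s'"
proof (rule hreg_cong[OF assms(1)])
  show "eventually (\<lambda>q. s q = s' q) (zar n p)"
    using eventually_zar_open[OF assms(2,3)] by eventually_elim (simp add: assms(4))
qed

lemma regular_mat_on_diag:
  assumes "zariski_open n U" "\<And>p. p \<in> U \<Longrightarrow> M p = diag N (\<lambda>m. g m p / h m p)"
    "\<And>p m. p \<in> U \<Longrightarrow> m < N \<Longrightarrow> hreg n (t m) p (g m)"
    "\<And>p m. p \<in> U \<Longrightarrow> m < N \<Longrightarrow> hreg n (t m) p (h m) \<and> h m p \<noteq> 0"
  shows "regular_mat_on n U N N M"
proof (rule regular_mat_onI[OF assms(1)])
  fix p a b assume ab: "p \<in> U" "a < N" "b < N"
  show "hreg n 0 p (\<lambda>q. M q $$ (a, b))"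
  proof (cases "a = b")
    case True
    have "hreg n (t a - t a) p (\<lambda>q. g a q / h a q)"
      using ab assms(3,4) by (intro hreg_divide) auto
    then have "hreg n 0 p (\<lambda>q. g a q / h a q)" by simp
    then show ?thesis
      by (rule hreg_eq_on_open[OF _ assms(1)]) (use ab True in \<open>auto simp: assms(2) diag_index\<close>)
  next
    case False
    have "p \<in> proj_space n" using ab assms(1) zariski_open_subset by blast
    then show ?thesis
      by (rule hreg_eq_on_open[OF hreg_zero assms(1)]) (use ab False in \<open>auto simp: assms(2) diag_index\<close>)
  qed
qed (simp add: assms(2))

lemma diag_bundle_vector_bundle:
  assumes "diag_bundle n E N t \<theta>"
  shows "vector_bundle n E"
  unfolding vector_bundle_def
proof (intro conjI ballI)
  show "\<And>i. i \<in> charts E \<Longrightarrow> zariski_open n (chart_dom E i)"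
    "(\<Union>i\<in>charts E. chart_dom E i) = proj_space n"
    using assms by (auto simp: diag_bundle_def)
  have rank: "bundle_rank E = N" using assms by (simp add: diag_bundle_def)
  have nz: "\<theta> i m p \<noteq> 0" "hreg n (t m) p (\<theta> i m)" if "i \<in> charts E" "p \<in> chart_dom E i" "m < N" for i p m
    using assms that unfolding diag_bundle_def by blast+
  have trans: "transition E i j p = diag N (\<lambda>m. \<theta> j m p / \<theta> i m p)"
    if "i \<in> charts E" "j \<in> charts E" "p \<in> chart_dom E i" "p \<in> chart_dom E j" for i j p
    using assms that unfolding diag_bundle_def by blast
  fix i j assume ij: "i \<in> charts E" "j \<in> charts E"
  show "regular_mat_on n (chart_dom E i \<inter> chart_dom E j) (bundle_rank E) (bundle_rank E) (transition E i j)"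
    unfolding rank
  proof (rule regular_mat_on_diag)
    show "zariski_open n (chart_dom E i \<inter> chart_dom E j)"
      using assms ij by (auto simp: diag_bundle_def intro: zariski_open_Int)
  qed (use ij nz trans in auto)
  fix k p assume k: "k \<in> charts E" and p: "p \<in> chart_dom E i \<inter> chart_dom E j \<inter> chart_dom E k"
  show "transition E i j p * transition E j k p = transition E i k p"
    using p ij k nz by (auto simp: trans diag_mult_diag intro!: diag_cong)
next
  fix i p assume "i \<in> charts E" "p \<in> chart_dom E i"
  moreover from this have "\<And>m. m < N \<Longrightarrow> \<theta> i m p \<noteq> 0"
    using assms unfolding diag_bundle_def by blast
  ultimately show "transition E i i p = 1\<^sub>m (bundle_rank E)"
    using assms unfolding diag_one[symmetric] by (auto simp: diag_bundle_def intro!: diag_cong)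
qed

text \<open>The two bundles measure the same tuples of homogeneous functions in different frames.
  The change of frame \<theta> / \<mu> is a unit of degree 0 and telescopes with the transition
  functions.\<close>

lemma diag_bundle_isomorphic:
  assumes E: "diag_bundle n E N t \<theta>" and F: "diag_bundle n F N t \<mu>"
  shows "isomorphic_bundles n E F"
proof -
  define \<phi> where "\<phi> j i p = diag N (\<lambda>m. \<theta> i m p / \<mu> j m p)" for j i p
  have rank: "bundle_rank E = N" "bundle_rank F = N" using E F by (auto simp: diag_bundle_def)
  have nzE: "\<theta> i m p \<noteq> 0" "hreg n (t m) p (\<theta> i m)" if "i \<in> charts E" "p \<in> chart_dom E i" "m < N" for i p m
    using E that unfolding diag_bundle_def by blast+
  have nzF: "\<mu> i m p \<noteq> 0" "hreg n (t m) p (\<mu> i m)" if "i \<in> charts F" "p \<in> chart_dom F i" "m < N" for i p m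
    using F that unfolding diag_bundle_def by blast+
  have transE: "transition E i j p = diag N (\<lambda>m. \<theta> j m p / \<theta> i m p)"
    if "i \<in> charts E" "j \<in> charts E" "p \<in> chart_dom E i" "p \<in> chart_dom E j" for i j p
    using E that unfolding diag_bundle_def by blast
  have transF: "transition F i j p = diag N (\<lambda>m. \<mu> j m p / \<mu> i m p)"
    if "i \<in> charts F" "j \<in> charts F" "p \<in> chart_dom F i" "p \<in> chart_dom F j" for i j p
    using F that unfolding diag_bundle_def by blast
  have "bundle_morphism n E F \<phi>"
    unfolding bundle_morphism_def rank
  proof (intro conjI ballI)
    fix i j assume ij: "i \<in> charts E" "j \<in> charts F"
    show "regular_mat_on n (chart_dom E i \<inter> chart_dom F j) N N (\<phi> j i)"
    proof (rule regular_mat_on_diag)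
      show "zariski_open n (chart_dom E i \<inter> chart_dom F j)"
        using E F ij by (auto simp: diag_bundle_def intro: zariski_open_Int)
    qed (use ij nzE nzF in \<open>auto simp: \<phi>_def\<close>)
    fix i' j' p assume "i' \<in> charts E" "j' \<in> charts F"
      "p \<in> chart_dom E i \<inter> chart_dom E i' \<inter> chart_dom F j \<inter> chart_dom F j'"
    then show "\<phi> j' i' p = transition F j' j p * \<phi> j i p * transition E i i' p"
      using ij nzE nzF by (auto simp: \<phi>_def transE transF diag_mult_diag intro!: diag_cong)
  qed
  moreover have "invertible_mat (\<phi> j i p)"
    if "i \<in> charts E" "j \<in> charts F" "p \<in> chart_dom E i \<inter> chart_dom F j" for i j p
    unfolding invertible_mat_def inverts_mat_def
  proof (intro conjI exI[of _ "diag N (\<lambda>m. \<mu> j m p / \<theta> i m p)"])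
    show "\<phi> j i p * diag N (\<lambda>m. \<mu> j m p / \<theta> i m p) = 1\<^sub>m (dim_row (\<phi> j i p))"
      "diag N (\<lambda>m. \<mu> j m p / \<theta> i m p) * \<phi> j i p = 1\<^sub>m (dim_row (diag N (\<lambda>m. \<mu> j m p / \<theta> i m p)))"
      using that nzE nzF unfolding \<phi>_def diag_mult_diag diag_carrier diag_one[symmetric] by (auto intro!: diag_cong)
  qed (simp add: \<phi>_def)
  ultimately show ?thesis
    unfolding isomorphic_bundles_def
    using diag_bundle_vector_bundle[OF E] diag_bundle_vector_bundle[OF F] by blast
qed

section \<open>Line bundles and their direct sums as diagonal bundles\<close>

lemma mem_listset: "is \<in> listset As \<longleftrightarrow> length is = length As \<and> (\<forall>k<length As. is ! k \<in> As ! k)"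
proof (induction As arbitrary: "is")
  case (Cons A As)
  show ?case
    by (cases "is") (auto simp: set_Cons_def Cons.IH nth_Cons' less_Suc_eq_0_disj split: if_splits)
qed auto

lemma line_bundle_charts:
  "charts (line_bundle n t) = {..n}" "bundle_rank (line_bundle n t) = 1"
  "transition (line_bundle n t) i j p = mat 1 1 (\<lambda>_. (coord j p / coord i p) powi t)"
  by (simp_all add: line_bundle_def coord_ratio_eq)

lemma line_bundle_chart_dom:
  assumes "i \<le> n"
  shows "chart_dom (line_bundle n t) i = {p \<in> proj_space n. coord i p \<noteq> 0}"
proof -
  have "(\<forall>v\<in>p. v $ i \<noteq> 0) \<longleftrightarrow> rep p $ i \<noteq> 0" if "p \<in> proj_space n" for p
    by (rule all_representatives[OF that]) (use assms in auto)
  then show ?thesis by (auto simp: line_bundle_def coord_def)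
qed

lemma line_sum_charts:
  fixes ts :: "int list" and n :: nat
  defines "E \<equiv> bundle_sum n (map (line_bundle n) ts)"
  shows "is \<in> charts E \<longleftrightarrow> length is = length ts \<and> (\<forall>k<length ts. is ! k \<le> n)"
    "bundle_rank E = length ts"
    "is \<in> charts E \<Longrightarrow> chart_dom E is = {p \<in> proj_space n. \<forall>k<length ts. coord (is ! k) p \<noteq> 0}"
    "transition E is js p = diag (length ts) (\<lambda>k. (coord (js ! k) p / coord (is ! k) p) powi (ts ! k))"
proof -
  show ch: "is \<in> charts E \<longleftrightarrow> length is = length ts \<and> (\<forall>k<length ts. is ! k \<le> n)" for "is"
    by (auto simp: E_def bundle_sum_def mem_listset line_bundle_charts)
  show "bundle_rank E = length ts"
    by (simp add: E_def bundle_sum_def line_bundle_charts comp_def sum_list_triv)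
  show "is \<in> charts E \<Longrightarrow> chart_dom E is = {p \<in> proj_space n. \<forall>k<length ts. coord (is ! k) p \<noteq> 0}"
    unfolding ch by (auto simp: E_def bundle_sum_def line_bundle_chart_dom)
  have "transition E is js p = diag_block_mat (map (\<lambda>k. mat 1 1 (\<lambda>_. (coord (js ! k) p / coord (is ! k) p) powi (ts ! k))) [0..<length ts])"
    by (auto simp: E_def bundle_sum_def line_bundle_charts intro!: arg_cong[of _ _ diag_block_mat])
  then show "transition E is js p = diag (length ts) (\<lambda>k. (coord (js ! k) p / coord (is ! k) p) powi (ts ! k))"
    by (simp only: diag_block_mat_singletons) (auto intro: diag_cong)
qed

lemma zariski_open_coords:
  assumes "\<forall>i\<in>set is. i \<le> n"
  shows "zariski_open n {p \<in> proj_space n. \<forall>i\<in>set is. coord i p \<noteq> 0}"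
  using assms
proof (induction "is")
  case Nil
  then show ?case by (simp add: zariski_open_proj_space)
next
  case (Cons i "is")
  have "{p \<in> proj_space n. \<forall>i\<in>set (i # is). coord i p \<noteq> 0} =
     {p \<in> proj_space n. coord i p \<noteq> 0} \<inter> {p \<in> proj_space n. \<forall>i\<in>set is. coord i p \<noteq> 0}" by auto
  then show ?case using Cons by (simp add: zariski_open_Int zariski_open_coord)
qed

lemma line_sum_open_cover:
  fixes ts :: "int list" and n :: nat
  defines "E \<equiv> bundle_sum n (map (line_bundle n) ts)"
  shows "is \<in> charts E \<Longrightarrow> zariski_open n (chart_dom E is)"
    "(\<Union>is\<in>charts E. chart_dom E is) = proj_space n"
proof -
  show "zariski_open n (chart_dom E is)" if "is \<in> charts E"
  proof -
    have "chart_dom E is = {p \<in> proj_space n. \<forall>i\<in>set is. coord i p \<noteq> 0}"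
      using that line_sum_charts(3)[of "is" n ts] line_sum_charts(1)[of "is" n ts]
      unfolding E_def by (simp add: all_set_conv_all_nth)
    then show ?thesis
      using that line_sum_charts(1)[of "is" n ts]
      by (simp add: E_def) (auto intro!: zariski_open_coords simp: in_set_conv_nth)
  qed
  show "(\<Union>is\<in>charts E. chart_dom E is) = proj_space n"
  proof (intro equalityI subsetI)
    fix p assume p: "p \<in> proj_space n"
    then obtain i where "i \<le> n" "coord i p \<noteq> 0" using coord_nonzero by blast
    then have "replicate (length ts) i \<in> charts E" "p \<in> chart_dom E (replicate (length ts) i)"
      using p line_sum_charts(1,3)[of "replicate (length ts) i" n ts] by (auto simp: E_def)
    then show "p \<in> (\<Union>is\<in>charts E. chart_dom E is)" by blast
  next
    fix p assume "p \<in> (\<Union>is\<in>charts E. chart_dom E is)"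
    then show "p \<in> proj_space n" using line_sum_charts(3)[of _ n ts] by (auto simp: E_def)
  qed
qed

lemma line_sum_diag_bundle:
  "diag_bundle n (bundle_sum n (map (line_bundle n) ts)) (length ts) (\<lambda>k. ts ! k)
     (\<lambda>is k p. coord (is ! k) p powi (ts ! k))"
  unfolding diag_bundle_def
  using line_sum_open_cover[where n=n and ts=ts]
  by (auto simp: line_sum_charts hreg_coord_powi power_int_divide_distrib intro!: diag_cong)

section \<open>Symmetric powers of a sum of two line bundles\<close>

lemma sym_basis_2:
  "sym_basis 2 d = map (\<lambda>m. replicate (d - m) 0 @ replicate m 1) [0..<d + 1]"
proof (induction d)
  case 0
  then show ?case by (simp add: sym_basis_def)
next
  case (Suc d)
  define w :: "nat \<Rightarrow> nat list" where "w m = replicate (d - m) 0 @ replicate m 1" for m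
  \<comment> \<open>The letters that may be put in front of a sorted word without unsorting it. The
    letter 1 is allowed only if no 0 occurs, hence only for \<open>w d\<close>; every other word of
    length \<open>d\<close> has a single extension.\<close>
  define ext :: "nat list \<Rightarrow> nat list list"
    where "ext ys = (0 # ys) # (if \<forall>y\<in>set ys. 1 \<le> y then [1 # ys] else [])" for ys
  have filt: "filter sorted (concat (map (\<lambda>ys. [0 # ys, 1 # ys]) yss)) = concat (map ext (filter sorted yss))"
    for yss :: "nat list list"
    by (induction yss) (auto simp: ext_def)
  have "filter sorted (List.n_lists d [0..<2]) = map w [0..<d + 1]"
    using Suc.IH by (simp add: sym_basis_def w_def)
  then have "sym_basis 2 (Suc d) = concat (map (ext \<circ> w) [0..<d + 1])"
    by (simp add: sym_basis_def upt_rec[of 0 2] upt_rec[of 1 2] filt flip: numeral_2_eq_2 One_nat_def)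
  also have "\<dots> = concat (map (\<lambda>m. [0 # w m]) [0..<d]) @ [0 # w d, 1 # w d]"
  proof -
    have "map (ext \<circ> w) [0..<d] = map (\<lambda>m. [0 # w m]) [0..<d]"
      by (rule map_cong) (auto simp: ext_def w_def)
    moreover have "ext (w d) = [0 # w d, 1 # w d]" by (simp add: ext_def w_def)
    moreover have "concat (map (ext \<circ> w) [0..<d + 1]) = concat (map (ext \<circ> w) [0..<d]) @ ext (w d)" by simp
    ultimately show ?thesis by (simp only:)
  qed
  also have "concat (map (\<lambda>m. [0 # w m]) [0..<d]) = map (\<lambda>m. 0 # w m) [0..<d]"
    by (induction d) auto
  also have "\<dots> = map (\<lambda>m. replicate (Suc d - m) 0 @ replicate m 1) [0..<d]"
    by (rule map_cong) (auto simp: w_def Suc_diff_le)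
  finally show ?case by (simp add: w_def)
qed

lemma finite_mset_eq: "finite {w. mset w = mset u}"
proof (rule finite_subset)
  show "{w. mset w = mset u} \<subseteq> {w. set w \<subseteq> set u \<and> length w = length u}"
    by (auto dest: mset_eq_setD mset_eq_length)
qed (simp add: finite_lists_length_eq)

text \<open>For a diagonal matrix only the word equal to the source word contributes. It is a
  rearrangement of the target word only if both contain equally many ones, that is, if
  \<open>a = b\<close>.\<close>

lemma sym_mat_diag: "sym_mat 2 d (diag 2 g) = diag (d + 1) (\<lambda>m. g 0 ^ (d - m) * g 1 ^ m)"
proof (rule eq_matI)
  define u :: "nat \<Rightarrow> nat list" where "u m = replicate (d - m) 0 @ replicate m 1" for m
  have len: "length (sym_basis 2 d) = d + 1" by (simp add: sym_basis_2)
  have nth: "sym_basis 2 d ! m = u m" if "m < d + 1" for m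
    using that unfolding sym_basis_2 u_def by (subst nth_map) (auto simp del: upt_Suc)
  show "dim_row (sym_mat 2 d (diag 2 g)) = dim_row (diag (d + 1) (\<lambda>m. g 0 ^ (d - m) * g 1 ^ m))"
    "dim_col (sym_mat 2 d (diag 2 g)) = dim_col (diag (d + 1) (\<lambda>m. g 0 ^ (d - m) * g 1 ^ m))"
    by (simp_all add: sym_mat_def len)
  fix a b assume "a < dim_row (diag (d + 1) (\<lambda>m. g 0 ^ (d - m) * g 1 ^ m))"
    "b < dim_col (diag (d + 1) (\<lambda>m. g 0 ^ (d - m) * g 1 ^ m))"
  then have ab: "a < d + 1" "b < d + 1" by simp_all
  have lu: "length (u m) = d" if "m < d + 1" for m using that by (simp add: u_def)
  have "(\<Prod>k<d. diag 2 g $$ (w ! k, u b ! k)) = (if w = u b then g 0 ^ (d - b) * g 1 ^ b else 0)"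
    if w: "mset w = mset (u a)" for w
  proof -
    have lw: "length w = d" using mset_eq_length[OF w] lu ab by simp
    have "set w \<subseteq> {0, 1}" using mset_eq_setD[OF w] by (auto simp: u_def)
    then have w2: "w ! k < 2" if "k < d" for k using that lw nth_mem[of k w] by fastforce
    have "set (u b) \<subseteq> {0, 1}" by (auto simp: u_def)
    then have u2: "u b ! k < 2" if "k < d" for k using that lu ab nth_mem[of k "u b"] by fastforce
    show ?thesis
    proof (cases "w = u b")
      case True
      have "(\<Prod>k<d. diag 2 g $$ (w ! k, u b ! k)) = (\<Prod>k<d. g (u b ! k))"
        using u2 True by (intro prod.cong) (auto simp: diag_index)
      also have "\<dots> = prod_list (map g (u b))"
        using lu[OF ab(2)] by (simp add: prod.list_conv_set_nth lessThan_atLeast0)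
      finally show ?thesis using True by (simp add: u_def)
    next
      case False
      then obtain k where "k < d" "w ! k \<noteq> u b ! k" using lw lu ab by (metis nth_equalityI)
      then have "\<exists>k\<in>{..<d}. diag 2 g $$ (w ! k, u b ! k) = 0"
        using w2 u2 by (intro bexI[of _ k]) (auto simp: diag_index)
      then show ?thesis using False by (auto simp: prod_zero_iff)
    qed
  qed
  then have "sym_mat 2 d (diag 2 g) $$ (a, b) =
     (\<Sum>w | mset w = mset (u a). if w = u b then g 0 ^ (d - b) * g 1 ^ b else 0)"
    using ab by (simp add: sym_mat_def len nth)
  also have "\<dots> = (if mset (u b) = mset (u a) then g 0 ^ (d - b) * g 1 ^ b else 0)"
    using finite_mset_eq[of "u a"] by (simp add: sum.delta)
  also have "mset (u b) = mset (u a) \<longleftrightarrow> a = b"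
  proof
    assume "mset (u b) = mset (u a)"
    then have "count (mset (u b)) 1 = count (mset (u a)) 1" by simp
    then show "a = b" using ab by (simp add: u_def)
  qed simp
  finally show "sym_mat 2 d (diag 2 g) $$ (a, b) = diag (d + 1) (\<lambda>m. g 0 ^ (d - m) * g 1 ^ m) $$ (a, b)"
    using ab by (auto simp: diag_index)
qed

lemma sym_power_diag_bundle:
  "diag_bundle n (sym_power d (bundle_sum n [line_bundle n t, line_bundle n u])) (d + 1)
     (\<lambda>m. int (d - m) * t + int m * u)
     (\<lambda>is m p. (coord (is ! 0) p powi t) ^ (d - m) * (coord (is ! 1) p powi u) ^ m)"
proof -
  have E: "diag_bundle n (bundle_sum n [line_bundle n t, line_bundle n u]) 2 (\<lambda>k. [t, u] ! k)
     (\<lambda>is k p. coord (is ! k) p powi ([t, u] ! k))" (is "diag_bundle n ?E 2 ?t ?\<theta>")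
    using line_sum_diag_bundle[of n "[t, u]"] by (simp add: numeral_2_eq_2)
  have rank: "bundle_rank ?E = 2" using E by (simp add: diag_bundle_def)
  have nz: "?\<theta> i m p \<noteq> 0" "hreg n (?t m) p (?\<theta> i m)" if "i \<in> charts ?E" "p \<in> chart_dom ?E i" "m < 2" for i p m
    using E that unfolding diag_bundle_def by blast+
  have trans: "transition ?E i j p = diag 2 (\<lambda>m. ?\<theta> j m p / ?\<theta> i m p)"
    if "i \<in> charts ?E" "j \<in> charts ?E" "p \<in> chart_dom ?E i" "p \<in> chart_dom ?E j" for i j p
    using E that unfolding diag_bundle_def by blast
  show ?thesis
    unfolding diag_bundle_def
  proof (intro conjI ballI allI impI)
    show "bundle_rank (sym_power d ?E) = d + 1" by (simp add: sym_power_def rank sym_basis_2)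
    show "\<And>i. i \<in> charts (sym_power d ?E) \<Longrightarrow> zariski_open n (chart_dom (sym_power d ?E) i)"
      "(\<Union>i\<in>charts (sym_power d ?E). chart_dom (sym_power d ?E) i) = proj_space n"
      using E by (auto simp: sym_power_def diag_bundle_def)
    fix i assume i: "i \<in> charts (sym_power d ?E)"
    {
      fix p m assume p: "p \<in> chart_dom (sym_power d ?E) i"
      have "hreg n (int (d - m) * t + int m * u) p (\<lambda>p. (?\<theta> i 0 p) ^ (d - m) * (?\<theta> i 1 p) ^ m)"
        using i p nz[of i p 0] nz[of i p 1] by (intro hreg_mult hreg_power) (auto simp: sym_power_def)
      then show "hreg n (int (d - m) * t + int m * u) p
        (\<lambda>p. (coord (i ! 0) p powi t) ^ (d - m) * (coord (i ! 1) p powi u) ^ m)" by simp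
      show "(coord (i ! 0) p powi t) ^ (d - m) * (coord (i ! 1) p powi u) ^ m \<noteq> 0"
        using i p nz(1)[of i p 0] nz(1)[of i p 1] by (auto simp: sym_power_def)
    }
    fix j p assume j: "j \<in> charts (sym_power d ?E)"
      and p: "p \<in> chart_dom (sym_power d ?E) i \<inter> chart_dom (sym_power d ?E) j"
    have "transition ?E i j p = diag 2 (\<lambda>m. ?\<theta> j m p / ?\<theta> i m p)"
      using i j p by (intro trans) (auto simp: sym_power_def)
    then show "transition (sym_power d ?E) i j p = diag (d + 1)
       (\<lambda>m. ((coord (j ! 0) p powi t) ^ (d - m) * (coord (j ! 1) p powi u) ^ m) /
            ((coord (i ! 0) p powi t) ^ (d - m) * (coord (i ! 1) p powi u) ^ m))"
      by (auto simp: sym_power_def rank sym_mat_diag power_divide intro!: diag_cong)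
  qed
qed

section \<open>Twists\<close>

lemma kronecker_singleton: "kronecker A (mat 1 1 (\<lambda>_. c)) = c \<cdot>\<^sub>m A"
  unfolding kronecker_def by (rule eq_matI) auto

lemma twist_charts:
  shows "charts (twist n E t) = charts E \<times> {..n}"
    "i \<le> n \<Longrightarrow> chart_dom (twist n E t) (j, i) = chart_dom E j \<inter> {p \<in> proj_space n. coord i p \<noteq> 0}"
    "bundle_rank (twist n E t) = bundle_rank E"
    "transition (twist n E t) (j, i) (j', i') p = ((coord i' p / coord i p) powi t) \<cdot>\<^sub>m transition E j j' p"
  by (simp_all add: twist_def tensor_bundle_def line_bundle_charts line_bundle_chart_dom kronecker_singleton
        del: One_nat_def)

lemma powi_ratio_trans:
  "(a :: complex) \<noteq> 0 \<Longrightarrow> b \<noteq> 0 \<Longrightarrow> (b / a) powi t * (c / b) powi t = (c / a) powi t"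
  by (simp add: power_int_divide_distrib)

lemma smult_mult_smult:
  "A \<in> carrier_mat m k \<Longrightarrow> B \<in> carrier_mat k l \<Longrightarrow> (x \<cdot>\<^sub>m A) * (y \<cdot>\<^sub>m B) = (x * y :: complex) \<cdot>\<^sub>m (A * B)"
  by (rule eq_matI) auto

lemma twist_vector_bundle:
  assumes E: "vector_bundle n E"
  shows "vector_bundle n (twist n E t)"
  unfolding vector_bundle_def twist_charts(1,3)
proof (intro conjI ballI)
  have openE: "zariski_open n (chart_dom E j)" if "j \<in> charts E" for j
    using E that by (simp add: vector_bundle_def)
  have open': "zariski_open n (chart_dom (twist n E t) ji)" if "ji \<in> charts E \<times> {..n}" for ji
    using that by (auto simp: twist_charts intro!: zariski_open_Int zariski_open_coord openE)
  then show "\<And>ji. ji \<in> charts E \<times> {..n} \<Longrightarrow> zariski_open n (chart_dom (twist n E t) ji)" .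
  have carr: "transition E j j' p \<in> carrier_mat (bundle_rank E) (bundle_rank E)"
    if "j \<in> charts E" "j' \<in> charts E" "p \<in> chart_dom E j" "p \<in> chart_dom E j'" for j j' p
    using E that unfolding vector_bundle_def regular_mat_on_def by blast
  show "(\<Union>ji\<in>charts E \<times> {..n}. chart_dom (twist n E t) ji) = proj_space n"
  proof (intro equalityI subsetI)
    fix p assume p: "p \<in> proj_space n"
    then obtain i where "i \<le> n" "coord i p \<noteq> 0" using coord_nonzero by blast
    moreover obtain j where "j \<in> charts E" "p \<in> chart_dom E j"
      using E p unfolding vector_bundle_def by blast
    ultimately show "p \<in> (\<Union>ji\<in>charts E \<times> {..n}. chart_dom (twist n E t) ji)"
      using p by (intro UN_I[of "(j, i)"]) (auto simp: twist_charts)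
  qed (auto simp: twist_charts)
  fix ji ji' assume a: "ji \<in> charts E \<times> {..n}" "ji' \<in> charts E \<times> {..n}"
  then obtain j i j' i' where ji [simp]: "ji = (j, i)" "ji' = (j', i')" and
     ch: "j \<in> charts E" "i \<le> n" "j' \<in> charts E" "i' \<le> n" by auto
  show "regular_mat_on n (chart_dom (twist n E t) ji \<inter> chart_dom (twist n E t) ji')
     (bundle_rank E) (bundle_rank E) (transition (twist n E t) ji ji')"
  proof (rule regular_mat_onI)
    show op: "zariski_open n (chart_dom (twist n E t) ji \<inter> chart_dom (twist n E t) ji')"
      using a open' by (intro zariski_open_Int) auto
    fix p assume p: "p \<in> chart_dom (twist n E t) ji \<inter> chart_dom (twist n E t) ji'"
    then have p': "p \<in> chart_dom E j" "p \<in> chart_dom E j'" "p \<in> proj_space n" "coord i p \<noteq> 0" "coord i' p \<noteq> 0"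
      using ch by (auto simp: twist_charts)
    show "transition (twist n E t) ji ji' p \<in> carrier_mat (bundle_rank E) (bundle_rank E)"
      using carr ch p' by (simp add: twist_charts)
    fix r s assume rs: "r < bundle_rank E" "s < bundle_rank E"
    have "regular_mat_on n (chart_dom E j \<inter> chart_dom E j') (bundle_rank E) (bundle_rank E) (transition E j j')"
      using E ch unfolding vector_bundle_def by blast
    then have "hreg n 0 p (\<lambda>q. transition E j j' q $$ (r, s))"
      using p' rs by (auto dest: regular_mat_onD(2)[where p = p])
    \<comment> \<open>A ratio of two coordinates has degree \<open>1 - 1\<close>. The degree is left
      in the shape that the rules for powers and quotients produce and is simplified only after the
      multiplication.\<close>
    moreover have "hreg n (t * (1 - 1)) p (\<lambda>q. (coord i' q / coord i q) powi t)"
      using p' ch by (intro hreg_powi hreg_divide hreg_coord) auto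
    ultimately have "hreg n (t * (1 - 1) + 0) p (\<lambda>q. (coord i' q / coord i q) powi t * transition E j j' q $$ (r, s))"
      by (intro hreg_mult)
    then have "hreg n 0 p (\<lambda>q. (coord i' q / coord i q) powi t * transition E j j' q $$ (r, s))" by simp
    then show "hreg n 0 p (\<lambda>q. transition (twist n E t) ji ji' q $$ (r, s))"
    proof (rule hreg_eq_on_open[OF _ op p])
      fix q assume "q \<in> chart_dom (twist n E t) ji \<inter> chart_dom (twist n E t) ji'"
      then have "transition E j j' q \<in> carrier_mat (bundle_rank E) (bundle_rank E)"
        using ch by (intro carr) (auto simp: twist_charts)
      then show "transition (twist n E t) ji ji' q $$ (r, s) =
         (coord i' q / coord i q) powi t * transition E j j' q $$ (r, s)"
        using rs by (simp add: twist_charts)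
    qed
  qed
  fix jk p assume b: "jk \<in> charts E \<times> {..n}"
    and p: "p \<in> chart_dom (twist n E t) ji \<inter> chart_dom (twist n E t) ji' \<inter> chart_dom (twist n E t) jk"
  then obtain j'' i'' where jk [simp]: "jk = (j'', i'')" and ch': "j'' \<in> charts E" "i'' \<le> n" by auto
  have p': "p \<in> chart_dom E j" "p \<in> chart_dom E j'" "p \<in> chart_dom E j''"
    "coord i p \<noteq> 0" "coord i' p \<noteq> 0" "coord i'' p \<noteq> 0"
    using p ch ch' by (auto simp: twist_charts)
  have "transition E j j' p * transition E j' j'' p = transition E j j'' p"
    using E ch ch' p' unfolding vector_bundle_def by blast
  then show "transition (twist n E t) ji ji' p * transition (twist n E t) ji' jk p = transition (twist n E t) ji jk p"
    using carr[of j j' p] carr[of j' j'' p] ch ch' p'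
    by (simp add: twist_charts smult_mult_smult powi_ratio_trans)
next
  fix ji p assume "ji \<in> charts E \<times> {..n}" "p \<in> chart_dom (twist n E t) ji"
  moreover then obtain j i where [simp]: "ji = (j, i)" by (cases ji)
  ultimately have ch: "j \<in> charts E" "i \<le> n" "p \<in> chart_dom E j" "coord i p \<noteq> 0" by (auto simp: twist_charts)
  then have "transition E j j p = 1\<^sub>m (bundle_rank E)" using E unfolding vector_bundle_def by blast
  then show "transition (twist n E t) ji ji p = 1\<^sub>m (bundle_rank E)"
    using ch by (simp add: twist_charts) (rule eq_matI; simp)
qed

section \<open>The Wronskian\<close>

text \<open>The matrix of \<open>g \<mapsto> f g' - f' g\<close> on polynomials of degree at most \<open>n\<close>, where \<open>f\<close> has
  coefficients \<open>F\<close>. In terms of binary forms it is, up to a factor, the projection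
  \<open>S\<^sup>n \<otimes> S\<^sup>n \<rightarrow> S\<^bsup>2n-2\<^esup>\<close>.\<close>

definition wronski :: "nat \<Rightarrow> (nat \<Rightarrow> complex) \<Rightarrow> complex mat" where
  "wronski n F = mat (2 * n - 1) (n + 1) (\<lambda>(m, k).
     if k \<le> m + 1 \<and> m + 1 - k \<le> n then (of_nat k - of_nat (m + 1 - k)) * F (m + 1 - k) else 0)"

lemma wronski_carrier [simp]: "wronski n F \<in> carrier_mat (2 * n - 1) (n + 1)"
  "dim_row (wronski n F) = 2 * n - 1" "dim_col (wronski n F) = n + 1"
  by (simp_all add: wronski_def)

text \<open>Compare leading terms. If f has degree a and y has degree b different from a, then the
  coefficient of \<open>f y' - f' y\<close> in degree a + b - 1 is (b - a) times the product of the
  leading coefficients. Requiring \<open>y $ a = 0\<close> excludes b = a. Only the n rows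
  \<open>a + k - 1\<close> with \<open>k \<noteq> a\<close> are inspected, and this leaves the other
  rows free for the complement in \<open>local_splitting\<close>.\<close>

lemma wronski_eq_zero:
  assumes y: "y \<in> carrier_vec (n + 1)" and a: "a \<le> n" "F a \<noteq> 0" "\<And>j. a < j \<Longrightarrow> j \<le> n \<Longrightarrow> F j = 0"
    and ya: "y $ a = 0"
    and rows: "\<And>k. k \<le> n \<Longrightarrow> k \<noteq> a \<Longrightarrow> (wronski n F *\<^sub>v y) $ (a + k - 1) = 0"
  shows "y = 0\<^sub>v (n + 1)"
proof (rule ccontr)
  assume "y \<noteq> 0\<^sub>v (n + 1)"
  then have "\<exists>k\<le>n. y $ k \<noteq> 0" using y by (metis eq_vecI carrier_vecD index_zero_vec less_Suc_eq_le Suc_eq_plus1)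
  then have ne: "{k. k \<le> n \<and> y $ k \<noteq> 0} \<noteq> {}" by blast
  have fin: "finite {k. k \<le> n \<and> y $ k \<noteq> 0}" by simp
  define b where "b = Max {k. k \<le> n \<and> y $ k \<noteq> 0}"
  have b: "b \<le> n" "y $ b \<noteq> 0" using Max_in[OF fin ne] by (simp_all add: b_def)
  have above: "y $ k = 0" if "b < k" "k \<le> n" for k
    using Max_ge[OF fin, of k] that by (fastforce simp: b_def)
  have ab: "a \<noteq> b" using b ya by auto
  \<comment> \<open>The expected degree of the Wronskian. As \<open>a \<noteq> b\<close>, the sum is
    at least 1 and the subtraction does not truncate.\<close>
  define m where "m = a + b - 1"
  have m: "m + 1 = a + b" "m < 2 * n - 1" using ab a(1) b(1) by (auto simp: m_def)
  have "0 = (wronski n F *\<^sub>v y) $ m" using rows[OF b(1)] ab by (simp add: m_def)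
  also have "\<dots> = (\<Sum>k<n+1. wronski n F $$ (m, k) * y $ k)"
    using y m(2) by (intro mult_mat_vec_index) auto
  also have "\<dots> = (\<Sum>k\<in>{b}. wronski n F $$ (m, k) * y $ k)"
  proof (rule sum.mono_neutral_right)
    show "\<forall>k\<in>{..<n + 1} - {b}. wronski n F $$ (m, k) * y $ k = 0"
    proof
      fix k assume k: "k \<in> {..<n + 1} - {b}"
      show "wronski n F $$ (m, k) * y $ k = 0"
      proof (cases "b < k")
        case True
        then show ?thesis using above k by simp
      next
        case False
        \<comment> \<open>A lower coefficient of \<open>y\<close> meets a coefficient of
          \<open>F\<close> beyond the last nonzero one.\<close>
        then have "a < m + 1 - k" using k m by auto
        then show ?thesis using a(3)[of "m + 1 - k"] k m(2) by (simp add: wronski_def)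
      qed
    qed
  qed (use b in auto)
  also have "\<dots> = (of_nat b - of_nat a) * F a * y $ b"
    using m b(1) a(1) by (simp add: wronski_def)
  finally show False using ab a(2) b(2) by simp
qed

text \<open>The substitution of \<open>m + 1 - k\<close> for \<open>k\<close> changes the sign of
  each summand, so the sum equals its negative.\<close>

lemma wronski_self: "wronski n F *\<^sub>v vec (n + 1) F = 0\<^sub>v (2 * n - 1)"
proof (rule eq_vecI)
  fix m assume "m < dim_vec (0\<^sub>v (2 * n - 1))"
  then have m: "m < 2 * n - 1" by simp
  let ?K = "{k. k < n + 1 \<and> k \<le> m + 1 \<and> m + 1 - k \<le> n}"
  let ?g = "\<lambda>k. (of_nat k - of_nat (m + 1 - k)) * F (m + 1 - k) * F k"
  have "(wronski n F *\<^sub>v vec (n + 1) F) $ m = (\<Sum>k<n+1. wronski n F $$ (m, k) * vec (n + 1) F $ k)"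
    using m by (intro mult_mat_vec_index) auto
  also have "\<dots> = (\<Sum>k\<in>?K. ?g k)"
    using m by (intro sum.mono_neutral_cong_right) (auto simp: wronski_def)
  finally have eq: "(wronski n F *\<^sub>v vec (n + 1) F) $ m = (\<Sum>k\<in>?K. ?g k)" .
  have "(\<Sum>k\<in>?K. ?g k) = (\<Sum>k\<in>?K. - ?g k)"
    by (rule sum.reindex_bij_witness[of _ "\<lambda>k. m + 1 - k" "\<lambda>k. m + 1 - k"]) (auto simp: algebra_simps)
  then have "(\<Sum>k\<in>?K. ?g k) = 0" by (simp add: sum_negf)
  then show "(wronski n F *\<^sub>v vec (n + 1) F) $ m = 0\<^sub>v (2 * n - 1) $ m" using eq m by simp
qed simp

lemma last_nonzero:
  fixes F :: "nat \<Rightarrow> complex"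
  assumes "\<exists>k\<le>n. F k \<noteq> 0"
  obtains a where "a \<le> n" "F a \<noteq> 0" "\<And>j. a < j \<Longrightarrow> j \<le> n \<Longrightarrow> F j = 0"
proof -
  have fin: "finite {k. k \<le> n \<and> F k \<noteq> 0}" and ne: "{k. k \<le> n \<and> F k \<noteq> 0} \<noteq> {}" using assms by auto
  show ?thesis
  proof (rule that[of "Max {k. k \<le> n \<and> F k \<noteq> 0}"])
    fix j assume "Max {k. k \<le> n \<and> F k \<noteq> 0} < j" "j \<le> n"
    then show "F j = 0" using Max_ge[OF fin, of j] by fastforce
  qed (use Max_in[OF fin ne] in auto)
qed

text \<open>Subtracting the multiple of \<open>F\<close> that agrees with \<open>y\<close> at the
  last nonzero index \<open>a\<close> of \<open>F\<close> gives a vector to which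
  \<open>wronski_eq_zero\<close> applies.\<close>

lemma wronski_kernel:
  assumes F: "\<exists>k\<le>n. F k \<noteq> 0" and y: "y \<in> carrier_vec (n + 1)" "wronski n F *\<^sub>v y = 0\<^sub>v (2 * n - 1)"
  shows "\<exists>c. y = c \<cdot>\<^sub>v vec (n + 1) F"
proof -
  obtain a where a: "a \<le> n" "F a \<noteq> 0" "\<And>j. a < j \<Longrightarrow> j \<le> n \<Longrightarrow> F j = 0"
    using last_nonzero[OF F] by blast
  define c where "c = y $ a / F a"
  define z where "z = y - c \<cdot>\<^sub>v vec (n + 1) F"
  have z: "z \<in> carrier_vec (n + 1)" using y by (simp add: z_def)
  have "wronski n F *\<^sub>v z = wronski n F *\<^sub>v y - c \<cdot>\<^sub>v (wronski n F *\<^sub>v vec (n + 1) F)"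
    unfolding z_def using y by (subst mult_minus_distrib_mat_vec[of _ "2 * n - 1" "n + 1"]) (auto simp: mult_mat_vec[of _ "2 * n - 1" "n + 1"])
  then have Wz: "wronski n F *\<^sub>v z = 0\<^sub>v (2 * n - 1)" using y unfolding wronski_self by (intro eq_vecI) auto
  have "z = 0\<^sub>v (n + 1)"
  proof (rule wronski_eq_zero[where F = F, OF z a])
    show "z $ a = 0" using a y by (simp add: z_def c_def)
    show "(wronski n F *\<^sub>v z) $ (a + k - 1) = 0" if "k \<le> n" "k \<noteq> a" for k
      using that a(1) unfolding Wz by auto
  qed auto
  then have "y = c \<cdot>\<^sub>v vec (n + 1) F"
    using y by (intro eq_vecI) (auto simp: z_def vec_eq_iff dest!: spec)
  then show ?thesis by blast
qed

section \<open>Matrices of an exact sequence\<close>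

lemma inverse_mat_exists:
  fixes M :: "complex mat"
  assumes M: "M \<in> carrier_mat k k" and d: "det M \<noteq> 0"
  obtains N where "N \<in> carrier_mat k k" "M * N = 1\<^sub>m k" "N * M = 1\<^sub>m k"
proof (rule that[of "(1 / det M) \<cdot>\<^sub>m adj_mat M"])
  show "(1 / det M) \<cdot>\<^sub>m adj_mat M \<in> carrier_mat k k" using adj_mat(1)[OF M] by simp
  show "M * ((1 / det M) \<cdot>\<^sub>m adj_mat M) = 1\<^sub>m k"
    using d by (subst mult_smult_distrib[OF M adj_mat(1)[OF M]]) (simp add: adj_mat(2)[OF M], rule eq_matI, auto)
  show "(1 / det M) \<cdot>\<^sub>m adj_mat M * M = 1\<^sub>m k"
    using d by (subst mult_smult_assoc_mat[OF adj_mat(1)[OF M] M]) (simp add: adj_mat(3)[OF M], rule eq_matI, auto)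
qed

lemma det_nonzero_if_injective:
  fixes M :: "complex mat"
  assumes M: "M \<in> carrier_mat k k" and "\<And>v. v \<in> carrier_vec k \<Longrightarrow> M *\<^sub>v v = 0\<^sub>v k \<Longrightarrow> v = 0\<^sub>v k"
  shows "det M \<noteq> 0"
  using det_0_iff_vec_prod_zero_field[OF M] assms(2) by blast

lemma mult_mat_vec_zero: "A \<in> carrier_mat m k \<Longrightarrow> A *\<^sub>v 0\<^sub>v k = (0\<^sub>v m :: complex vec)"
  by (rule eq_vecI) auto

lemma smult_mat_vec_assoc:
  "A \<in> carrier_mat m k \<Longrightarrow> v \<in> carrier_vec k \<Longrightarrow> (x \<cdot>\<^sub>m A) *\<^sub>v v = x \<cdot>\<^sub>v (A *\<^sub>v (v :: complex vec))"
  by (rule eq_vecI) auto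

lemma diag_vec_carrier [simp]: "diag N g *\<^sub>v v \<in> carrier_vec N"
  by (simp add: carrier_vecI)

lemma diag_inverse_vec:
  assumes "v \<in> carrier_vec N" "\<And>m. m < N \<Longrightarrow> g m \<noteq> 0"
  shows "diag N (\<lambda>m. 1 / g m) *\<^sub>v (diag N g *\<^sub>v v) = v" "diag N g *\<^sub>v (diag N (\<lambda>m. 1 / g m) *\<^sub>v v) = v"
proof -
  have "diag N (\<lambda>m. 1 / g m) * diag N g = 1\<^sub>m N" "diag N g * diag N (\<lambda>m. 1 / g m) = 1\<^sub>m N"
    unfolding diag_mult_diag diag_one[symmetric] using assms by (auto intro!: diag_cong)
  then show "diag N (\<lambda>m. 1 / g m) *\<^sub>v (diag N g *\<^sub>v v) = v" "diag N g *\<^sub>v (diag N (\<lambda>m. 1 / g m) *\<^sub>v v) = v"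
    using assms(1) by (metis assoc_mult_mat_vec diag_carrier(1) one_mult_mat_vec)+
qed

text \<open>Passage from homogeneous coordinates to charts: \<open>g\<close> is the frame of the
  middle bundle, \<open>x\<close> and \<open>y\<close> come from the frames of the two twists. All
  are nonzero scalars, so exactness survives.\<close>

lemma exact_rescale:
  fixes A R :: "complex mat"
  assumes A: "A \<in> carrier_mat N r" and R: "R \<in> carrier_mat k N"
    and g: "\<And>m. m < N \<Longrightarrow> g m \<noteq> 0" and xy: "x \<noteq> 0" "y \<noteq> 0"
    and inj: "\<And>z. z \<in> carrier_vec r \<Longrightarrow> A *\<^sub>v z = 0\<^sub>v N \<Longrightarrow> z = 0\<^sub>v r"
    and RA: "\<And>z. z \<in> carrier_vec r \<Longrightarrow> R *\<^sub>v (A *\<^sub>v z) = 0\<^sub>v k"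
    and ker: "\<And>u. u \<in> carrier_vec N \<Longrightarrow> R *\<^sub>v u = 0\<^sub>v k \<Longrightarrow> \<exists>z\<in>carrier_vec r. u = A *\<^sub>v z"
    and surj: "\<And>u. u \<in> carrier_vec k \<Longrightarrow> \<exists>v\<in>carrier_vec N. R *\<^sub>v v = u"
  defines "\<Phi> \<equiv> x \<cdot>\<^sub>m (diag N (\<lambda>m. 1 / g m) * A)" and "\<Psi> \<equiv> y \<cdot>\<^sub>m (R * diag N g)"
  shows "inj_on (\<lambda>v. \<Phi> *\<^sub>v v) (carrier_vec r)" (is ?inj)
    and "(\<lambda>v. \<Phi> *\<^sub>v v) ` carrier_vec r = mat_kernel \<Psi>" (is ?ker)
    and "(\<lambda>w. \<Psi> *\<^sub>v w) ` carrier_vec N = carrier_vec k" (is ?surj)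
proof -
  let ?D = "diag N g" and ?D' = "diag N (\<lambda>m. 1 / g m)"
  have \<Phi>: "\<Phi> *\<^sub>v z = x \<cdot>\<^sub>v (?D' *\<^sub>v (A *\<^sub>v z))" if "z \<in> carrier_vec r" for z
    unfolding \<Phi>_def using A that
    by (simp add: smult_mat_vec_assoc[OF mult_carrier_mat[OF diag_carrier(1) A]] assoc_mult_mat_vec[OF diag_carrier(1) A])
  have \<Psi>: "\<Psi> *\<^sub>v v = y \<cdot>\<^sub>v (R *\<^sub>v (?D *\<^sub>v v))" if "v \<in> carrier_vec N" for v
    unfolding \<Psi>_def using R that
    by (simp add: smult_mat_vec_assoc[OF mult_carrier_mat[OF R diag_carrier(1)]] assoc_mult_mat_vec[OF R diag_carrier(1)])
  have scale0: "c \<cdot>\<^sub>v v = 0\<^sub>v l \<Longrightarrow> c \<noteq> 0 \<Longrightarrow> v = 0\<^sub>v l" for c :: complex and v l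
    by (auto simp: vec_eq_iff)
  have \<Phi>c: "\<Phi> \<in> carrier_mat N r" and \<Psi>c: "\<Psi> \<in> carrier_mat k N"
    using A R by (auto simp: \<Phi>_def \<Psi>_def intro: mult_carrier_mat[OF diag_carrier(1)] mult_carrier_mat[OF _ diag_carrier(1)])
  show ?inj
  proof (rule inj_onI)
    fix v w assume v: "v \<in> carrier_vec r" and w: "w \<in> carrier_vec r" and "\<Phi> *\<^sub>v v = \<Phi> *\<^sub>v w"
    then have "\<Phi> *\<^sub>v (v - w) = 0\<^sub>v N" using \<Phi>c by (simp add: mult_minus_distrib_mat_vec[OF \<Phi>c])
    then have "x \<cdot>\<^sub>v (?D' *\<^sub>v (A *\<^sub>v (v - w))) = 0\<^sub>v N" using \<Phi> v w by simp
    then have "?D' *\<^sub>v (A *\<^sub>v (v - w)) = 0\<^sub>v N" by (rule scale0) (rule xy)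
    moreover have "?D *\<^sub>v (?D' *\<^sub>v (A *\<^sub>v (v - w))) = A *\<^sub>v (v - w)"
      using A v w g by (intro diag_inverse_vec) auto
    moreover have "?D *\<^sub>v 0\<^sub>v N = 0\<^sub>v N" by (rule mult_mat_vec_zero[OF diag_carrier(1)])
    ultimately have "A *\<^sub>v (v - w) = 0\<^sub>v N" by simp
    then have "v - w = 0\<^sub>v r" using v w by (intro inj) auto
    then show "v = w" using v w by (auto simp: vec_eq_iff)
  qed
  show ?ker
  proof (intro equalityI subsetI)
    fix u assume "u \<in> (\<lambda>v. \<Phi> *\<^sub>v v) ` carrier_vec r"
    then obtain z where z: "z \<in> carrier_vec r" "u = \<Phi> *\<^sub>v z" by blast
    have u: "u \<in> carrier_vec N" using z \<Phi>c by simp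
    have "?D *\<^sub>v u = x \<cdot>\<^sub>v (?D *\<^sub>v (?D' *\<^sub>v (A *\<^sub>v z)))"
      unfolding z(2) \<Phi>[OF z(1)]
      using mult_mat_vec_carrier[OF diag_carrier(1) mult_mat_vec_carrier[OF A z(1)]]
      by (intro mult_mat_vec[of _ N N]) auto
    also have "\<dots> = x \<cdot>\<^sub>v (A *\<^sub>v z)" using z A g by (subst diag_inverse_vec) auto
    finally have "R *\<^sub>v (?D *\<^sub>v u) = x \<cdot>\<^sub>v (R *\<^sub>v (A *\<^sub>v z))"
      using z A R by (simp add: mult_mat_vec[OF R])
    then have "\<Psi> *\<^sub>v u = 0\<^sub>v k" using \<Psi>[OF u] RA[OF z(1)] by (auto simp: vec_eq_iff)
    then show "u \<in> mat_kernel \<Psi>" using \<Psi>c u by (intro mat_kernelI)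
  next
    fix u assume "u \<in> mat_kernel \<Psi>"
    then have u: "u \<in> carrier_vec N" "\<Psi> *\<^sub>v u = 0\<^sub>v k" using mat_kernelD[OF \<Psi>c] by auto
    then have "R *\<^sub>v (?D *\<^sub>v u) = 0\<^sub>v k" using \<Psi>[OF u(1)] scale0 xy by metis
    then obtain z where z: "z \<in> carrier_vec r" "?D *\<^sub>v u = A *\<^sub>v z" using ker[of "?D *\<^sub>v u"] u by auto
    have "\<Phi> *\<^sub>v ((1 / x) \<cdot>\<^sub>v z) = (1 / x) \<cdot>\<^sub>v (\<Phi> *\<^sub>v z)" using z by (intro mult_mat_vec[OF \<Phi>c])
    also have "\<dots> = ?D' *\<^sub>v (A *\<^sub>v z)" using xy by (simp add: \<Phi>[OF z(1)] smult_smult_assoc)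
    also have "\<dots> = u" unfolding z(2)[symmetric] using u g by (intro diag_inverse_vec) auto
    finally show "u \<in> (\<lambda>v. \<Phi> *\<^sub>v v) ` carrier_vec r"
      using z by (intro image_eqI[of _ _ "(1 / x) \<cdot>\<^sub>v z"]) auto
  qed
  show ?surj
  proof (intro equalityI subsetI)
    fix u :: "complex vec" assume u: "u \<in> carrier_vec k"
    then obtain v where v: "v \<in> carrier_vec N" "R *\<^sub>v v = (1 / y) \<cdot>\<^sub>v u" using surj[of "(1 / y) \<cdot>\<^sub>v u"] by auto
    have "\<Psi> *\<^sub>v (?D' *\<^sub>v v) = u"
      using v g xy by (subst \<Psi>) (auto simp: diag_inverse_vec smult_smult_assoc)
    then show "u \<in> (\<lambda>w. \<Psi> *\<^sub>v w) ` carrier_vec N"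
      using v by (intro image_eqI[of _ _ "?D' *\<^sub>v v"]) auto
  qed (use \<Psi>c in auto)
qed

section \<open>The quotient bundle\<close>

text \<open>Over a point \<open>p\<close> with homogeneous coordinates \<open>rep p\<close>, the exact sequence defining \<open>Q\<close>
  becomes \<open>0 \<rightarrow> \<complex> \<rightarrow> \<complex>\<^bsup>n+1\<^esup> \<rightarrow> Q\<^sub>p \<rightarrow> 0\<close>: the first map is given by the vector of the \<open>f k p\<close>, the
  second one, in the chart \<open>c\<close> of \<open>Q\<close>, by the matrix \<open>P c p\<close>.\<close>

locale sequence_data =
  fixes n :: nat and \<gamma> :: int and s w :: "nat \<Rightarrow> int"
    and Q :: "'i vbundle" and f :: "nat \<Rightarrow> point \<Rightarrow> complex" and P :: "'i \<Rightarrow> point \<Rightarrow> complex mat"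
  assumes n_pos: "n \<ge> 1"
    and weights: "\<And>j k. j \<le> n \<Longrightarrow> k \<le> n \<Longrightarrow> 1 \<le> j + k \<Longrightarrow> s j + s k = w (j + k - 1)"
    and Q_bundle: "vector_bundle n Q" and Q_rank: "bundle_rank Q = n"
    and f_reg: "\<And>p k. p \<in> proj_space n \<Longrightarrow> k \<le> n \<Longrightarrow> hreg n (\<gamma> + s k) p (f k)"
    and f_nonzero: "\<And>p. p \<in> proj_space n \<Longrightarrow> \<exists>k\<le>n. f k p \<noteq> 0"
    and P_carrier: "\<And>c p. c \<in> charts Q \<Longrightarrow> p \<in> chart_dom Q c \<Longrightarrow> P c p \<in> carrier_mat n (n + 1)"
    and P_reg: "\<And>c p a k. c \<in> charts Q \<Longrightarrow> p \<in> chart_dom Q c \<Longrightarrow> a < n \<Longrightarrow> k \<le> n \<Longrightarrow>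
        hreg n (- s k) p (\<lambda>p. P c p $$ (a, k))"
    and P_kernel: "\<And>c p v. c \<in> charts Q \<Longrightarrow> p \<in> chart_dom Q c \<Longrightarrow> v \<in> carrier_vec (n + 1) \<Longrightarrow>
        P c p *\<^sub>v v = 0\<^sub>v n \<longleftrightarrow> (\<exists>x. v = x \<cdot>\<^sub>v vec (n + 1) (\<lambda>k. f k p))"
    and P_surj: "\<And>c p u. c \<in> charts Q \<Longrightarrow> p \<in> chart_dom Q c \<Longrightarrow> u \<in> carrier_vec n \<Longrightarrow>
        \<exists>v\<in>carrier_vec (n + 1). P c p *\<^sub>v v = u"
    and P_trans: "\<And>c c' p. c \<in> charts Q \<Longrightarrow> c' \<in> charts Q \<Longrightarrow> p \<in> chart_dom Q c \<Longrightarrow> p \<in> chart_dom Q c' \<Longrightarrow>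
        P c p = transition Q c c' p * P c' p"
begin

abbreviation N :: nat where "N \<equiv> 2 * n - 1"

definition B :: "point \<Rightarrow> complex mat" where
  "B p = wronski n (\<lambda>k. f k p)"

definition fvec :: "point \<Rightarrow> complex vec" where
  "fvec p = vec (n + 1) (\<lambda>k. f k p)"

lemma fvec_carrier [simp]: "fvec p \<in> carrier_vec (n + 1)"
  by (simp add: fvec_def)

lemma fvec_dim [simp]: "dim_vec (fvec p) = n + 1"
  by (simp add: fvec_def)

lemma fvec_index: "k \<le> n \<Longrightarrow> fvec p $ k = f k p"
  by (simp add: fvec_def)

lemma B_carrier [simp]: "B p \<in> carrier_mat N (n + 1)"
  unfolding B_def by (rule wronski_carrier)

text \<open>The simplifier rewrites \<open>n + 1\<close> to \<open>Suc n\<close> and 1 to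
  \<open>Suc 0\<close>; the carrier facts have to match those normal forms too.\<close>

lemmas [simp] = fvec_carrier[simplified] B_carrier[simplified]

lemma B_fvec: "B p *\<^sub>v (x \<cdot>\<^sub>v fvec p) = 0\<^sub>v N"
proof -
  have "B p *\<^sub>v fvec p = 0\<^sub>v N" unfolding B_def fvec_def by (rule wronski_self)
  then show ?thesis using mult_mat_vec[OF B_carrier fvec_carrier, of p x p] by (auto simp: vec_eq_iff)
qed

lemma B_kernel:
  "p \<in> proj_space n \<Longrightarrow> y \<in> carrier_vec (n + 1) \<Longrightarrow> B p *\<^sub>v y = 0\<^sub>v N \<Longrightarrow> \<exists>x. y = x \<cdot>\<^sub>v fvec p"
  unfolding B_def fvec_def by (rule wronski_kernel[OF f_nonzero])

text \<open>Entry \<open>(m, k)\<close> is a constant times \<open>f j\<close> with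
  \<open>j + k = m + 1\<close>, of degree \<open>\<gamma> + s j\<close>. The weight condition turns
  this into a row part plus a column part, as needed for determinants; the zero entries have any
  degree.\<close>

lemma B_reg:
  assumes "p \<in> proj_space n" "m < N" "k \<le> n"
  shows "hreg n (\<gamma> + w m - s k) p (\<lambda>q. B q $$ (m, k))"
proof (cases "k \<le> m + 1 \<and> m + 1 - k \<le> n")
  case True
  have "s (m + 1 - k) + s k = w m"
    using weights[of "m + 1 - k" k] True assms by simp
  then have deg: "0 + (\<gamma> + s (m + 1 - k)) = \<gamma> + w m - s k" by simp
  have "hreg n (0 + (\<gamma> + s (m + 1 - k))) p
      (\<lambda>q. (of_nat k - of_nat (m + 1 - k)) * f (m + 1 - k) q)"
    using True assms by (intro hreg_mult hreg_const f_reg) auto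
  then have "hreg n (\<gamma> + w m - s k) p (\<lambda>q. (of_nat k - of_nat (m + 1 - k)) * f (m + 1 - k) q)"
    unfolding deg .
  then show ?thesis using True assms by (simp add: B_def wronski_def)
next
  case False
  then have "B q $$ (m, k) = 0" for q using assms by (auto simp: B_def wronski_def)
  then show ?thesis using assms by (simp add: hreg_zero)
qed

subsection \<open>The embedding of the twisted quotient\<close>

lemma chart_point: "c \<in> charts Q \<Longrightarrow> p \<in> chart_dom Q c \<Longrightarrow> p \<in> proj_space n"
  using Q_bundle unfolding vector_bundle_def by blast

lemma chart_open: "c \<in> charts Q \<Longrightarrow> zariski_open n (chart_dom Q c)"
  using Q_bundle unfolding vector_bundle_def by blast

text \<open>The kernel of \<open>P c p\<close> is the line of f, and \<open>B p\<close> kills f, so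
  \<open>B p\<close> factors through the surjection \<open>P c p\<close>. The factor is
  \<open>B p\<close> times a right inverse of \<open>P c p\<close>.\<close>

lemma A_exists:
  assumes c: "c \<in> charts Q" "p \<in> chart_dom Q c"
  shows "\<exists>A\<in>carrier_mat N n. A * P c p = B p"
proof -
  have "\<forall>a. \<exists>v. v \<in> carrier_vec (n + 1) \<and> P c p *\<^sub>v v = unit_vec n a"
    using P_surj[OF c] unit_vec_carrier by blast
  then obtain g where g: "\<And>a. g a \<in> carrier_vec (n + 1)" "\<And>a. P c p *\<^sub>v g a = unit_vec n a" by metis
  define R where "R = mat (n + 1) n (\<lambda>(k, a). g a $ k)"
  have R: "R \<in> carrier_mat (n + 1) n" by (simp add: R_def)
  have Pc: "P c p \<in> carrier_mat n (n + 1)" by (rule P_carrier[OF c])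
  have "P c p * R = 1\<^sub>m n"
  proof (rule eq_matI)
    fix i j assume ij: "i < dim_row (1\<^sub>m n)" "j < dim_col (1\<^sub>m n)"
    then have "(P c p * R) $$ (i, j) = (\<Sum>k<n+1. P c p $$ (i, k) * R $$ (k, j))"
      by (intro mult_mat_index[OF Pc R]) auto
    also have "\<dots> = (\<Sum>k<n+1. P c p $$ (i, k) * g j $ k)" using ij by (simp add: R_def)
    also have "\<dots> = (P c p *\<^sub>v g j) $ i" using ij by (intro mult_mat_vec_index[OF Pc g(1), symmetric]) auto
    finally show "(P c p * R) $$ (i, j) = 1\<^sub>m n $$ (i, j)" using ij g(2)[of j] by simp
  qed (use Pc R in auto)
  then have PRP: "P c p *\<^sub>v (R *\<^sub>v (P c p *\<^sub>v v)) = P c p *\<^sub>v v" if "v \<in> carrier_vec (n + 1)" for v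
    using that Pc R by (metis assoc_mult_mat_vec mult_mat_vec_carrier one_mult_mat_vec)
  have BR: "B p * R \<in> carrier_mat N n" by (rule mult_carrier_mat[OF B_carrier R])
  have "B p * R * P c p = B p"
  proof (rule mat_eqI_vec)
    fix v :: "complex vec" assume v: "v \<in> carrier_vec (n + 1)"
    have Pv: "P c p *\<^sub>v v \<in> carrier_vec n" using Pc v by simp
    have RPv: "R *\<^sub>v (P c p *\<^sub>v v) \<in> carrier_vec (n + 1)" using R Pv by simp
    have "P c p *\<^sub>v (R *\<^sub>v (P c p *\<^sub>v v) - v) = 0\<^sub>v n"
      using PRP[OF v] RPv v Pc by (simp add: mult_minus_distrib_mat_vec[OF Pc RPv v])
    then obtain x where x: "R *\<^sub>v (P c p *\<^sub>v v) - v = x \<cdot>\<^sub>v fvec p"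
      using P_kernel[OF c, of "R *\<^sub>v (P c p *\<^sub>v v) - v"] RPv v unfolding fvec_def by auto
    have "B p *\<^sub>v (R *\<^sub>v (P c p *\<^sub>v v) - v) = 0\<^sub>v N" unfolding x by (rule B_fvec)
    then have "B p *\<^sub>v (R *\<^sub>v (P c p *\<^sub>v v)) - B p *\<^sub>v v = 0\<^sub>v N" by (simp add: mult_minus_distrib_mat_vec[OF B_carrier RPv v])
    moreover have "B p *\<^sub>v (R *\<^sub>v (P c p *\<^sub>v v)) \<in> carrier_vec N" "B p *\<^sub>v v \<in> carrier_vec N"
      using RPv v mult_mat_vec_carrier[OF B_carrier] by auto
    ultimately have "B p *\<^sub>v (R *\<^sub>v (P c p *\<^sub>v v)) = B p *\<^sub>v v" by (auto simp: vec_eq_iff)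
    then show "(B p * R * P c p) *\<^sub>v v = B p *\<^sub>v v"
      by (simp add: assoc_mult_mat_vec[OF BR Pc v] assoc_mult_mat_vec[OF B_carrier R Pv])
  next
    show "B p * R * P c p \<in> carrier_mat N (n + 1)" using BR Pc by simp
  qed simp
  then show ?thesis using BR by blast
qed

text \<open>The matrix at \<open>p\<close> of the embedding of the quotient. It is determined by the
  factorisation because \<open>P c p\<close> is surjective, so the choice operator selects the only
  candidate.\<close>

definition A :: "'i \<Rightarrow> point \<Rightarrow> complex mat" where
  "A c p = (SOME A. A \<in> carrier_mat N n \<and> A * P c p = B p)"

lemma A_carrier: "c \<in> charts Q \<Longrightarrow> p \<in> chart_dom Q c \<Longrightarrow> A c p \<in> carrier_mat N n"
  and A_P: "c \<in> charts Q \<Longrightarrow> p \<in> chart_dom Q c \<Longrightarrow> A c p * P c p = B p"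
proof -
  assume "c \<in> charts Q" "p \<in> chart_dom Q c"
  then have "\<exists>A. A \<in> carrier_mat N n \<and> A * P c p = B p" using A_exists by blast
  then have *: "A c p \<in> carrier_mat N n \<and> A c p * P c p = B p" unfolding A_def by (rule someI_ex)
  then show "A c p \<in> carrier_mat N n" by blast
  show "A c p * P c p = B p" using * by blast
qed

lemma A_P_vec:
  assumes "c \<in> charts Q" "p \<in> chart_dom Q c" "v \<in> carrier_vec (n + 1)"
  shows "A c p *\<^sub>v (P c p *\<^sub>v v) = B p *\<^sub>v v"
  using assms by (simp add: assoc_mult_mat_vec[OF A_carrier P_carrier, symmetric] A_P)

text \<open>Column \<open>a\<close> of \<open>A\<close> is \<open>B\<close> applied to any lift of
  the unit vector \<open>a\<close> through \<open>P\<close>. Two lifts differ by a multiple of f.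
  Near a point with \<open>f b p \<noteq> 0\<close> there is exactly one lift with coordinate
  \<open>b\<close> equal to 0, and Cramer's rule makes this one regular.\<close>

lemma A_reg:
  assumes c: "c \<in> charts Q" "p \<in> chart_dom Q c" and ma: "m < N" "a < n"
  shows "hreg n (\<gamma> + w m) p (\<lambda>q. A c q $$ (m, a))"
proof -
  have p: "p \<in> proj_space n" using chart_point[OF c] .
  obtain b where b: "b \<le> n" "f b p \<noteq> 0" using f_nonzero[OF p] by blast
  define U where "U = (\<lambda>q. q \<in> chart_dom Q c \<and> f b q \<noteq> 0)"
  have U: "eventually U (zar n p)"
    unfolding U_def
    using eventually_zar_open[OF chart_open[OF c(1)] c(2)] hreg_nonzero[OF f_reg[OF p b(1)] b(2)]
    by eventually_elim simp
  define y where "y q = (SOME v. v \<in> carrier_vec (n + 1) \<and> P c q *\<^sub>v v = unit_vec n a \<and> v $ b = 0)" for q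
  have y: "y q \<in> carrier_vec (n + 1)" "P c q *\<^sub>v y q = unit_vec n a" "y q $ b = 0" if "U q" for q
  proof -
    have q: "q \<in> chart_dom Q c" "f b q \<noteq> 0" using that by (simp_all add: U_def)
    obtain v where v: "v \<in> carrier_vec (n + 1)" "P c q *\<^sub>v v = unit_vec n a"
      using P_surj[OF c(1) q(1), of "unit_vec n a"] by auto
    define v' where "v' = v - (v $ b / f b q) \<cdot>\<^sub>v fvec q"
    have "P c q *\<^sub>v ((v $ b / f b q) \<cdot>\<^sub>v fvec q) = 0\<^sub>v n"
      using P_kernel[OF c(1) q(1), of "(v $ b / f b q) \<cdot>\<^sub>v fvec q"] unfolding fvec_def by auto
    then have "P c q *\<^sub>v v' = unit_vec n a"
      unfolding v'_def using v by (subst mult_minus_distrib_mat_vec[OF P_carrier[OF c(1) q(1)]]) auto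
    moreover have "v' $ b = 0" "v' \<in> carrier_vec (n + 1)" using v b q by (auto simp: v'_def fvec_index)
    ultimately have "\<exists>v. v \<in> carrier_vec (n + 1) \<and> P c q *\<^sub>v v = unit_vec n a \<and> v $ b = 0" by blast
    then have "y q \<in> carrier_vec (n + 1) \<and> P c q *\<^sub>v y q = unit_vec n a \<and> y q $ b = 0"
      unfolding y_def by (rule someI_ex)
    then show "y q \<in> carrier_vec (n + 1)" "P c q *\<^sub>v y q = unit_vec n a" "y q $ b = 0" by blast+
  qed
  \<comment> \<open>\<open>P\<close> bordered by the unit row \<open>b\<close>. A kernel vector of
    \<open>P\<close> is a multiple of f, and the border forces this multiple to be 0, so the square
    system is invertible at \<open>p\<close>.\<close>
  define M where "M q = mat (n + 1) (n + 1)
     (\<lambda>(i, k). if i < n then P c q $$ (i, k) else if k = b then 1 else 0)" for q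
  have M: "M q \<in> carrier_mat (n + 1) (n + 1)" for q by (simp add: M_def)
  have Mv: "(M q *\<^sub>v v) $ i = (if i < n then (P c q *\<^sub>v v) $ i else v $ b)"
    if "U q" "v \<in> carrier_vec (n + 1)" "i < n + 1" for q v i
  proof (cases "i < n")
    case True
    have "(M q *\<^sub>v v) $ i = (\<Sum>k<n+1. P c q $$ (i, k) * v $ k)"
      using True by (subst mult_mat_vec_index[OF M that(2)]) (auto simp: M_def)
    also have "\<dots> = (P c q *\<^sub>v v) $ i"
      using that True c(1) by (intro mult_mat_vec_index[OF P_carrier, symmetric]) (auto simp: U_def)
    finally show ?thesis using True by simp
  next
    case False
    have "(M q *\<^sub>v v) $ i = (\<Sum>k<n+1. (if k = b then 1 else 0) * v $ k)"
      using False that by (subst mult_mat_vec_index[OF M that(2)]) (auto simp: M_def intro!: sum.cong)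
    also have "\<dots> = 1 * v $ b" by (rule sum_single_left) (use b in auto)
    finally show ?thesis using False by simp
  qed
  have Up: "U p" by (rule eventually_zar_self[OF p U])
  have det: "det (M p) \<noteq> 0"
  proof (rule det_nonzero_if_injective[OF M])
    fix v assume v: "v \<in> carrier_vec (n + 1)" "M p *\<^sub>v v = 0\<^sub>v (n + 1)"
    have "P c p *\<^sub>v v = 0\<^sub>v n"
    proof (rule eq_vecI)
      fix i assume "i < dim_vec (0\<^sub>v n)"
      then show "(P c p *\<^sub>v v) $ i = 0\<^sub>v n $ i" using Mv[OF Up v(1), of i] v(2) by simp
    qed (use P_carrier[OF c] in auto)
    then obtain x where x: "v = x \<cdot>\<^sub>v fvec p" using P_kernel[OF c v(1)] unfolding fvec_def by auto
    have "v $ b = 0" using Mv[OF Up v(1), of n] v(2) by simp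
    then have "x = 0" using b unfolding x by (simp add: fvec_index)
    then show "v = 0\<^sub>v (n + 1)" unfolding x by (auto simp: fvec_def)
  qed
  \<comment> \<open>The border row gets degree \<open>s b\<close> to cancel the column degree
    \<open>- s b\<close> at its only nonzero entry, the constant 1. The right-hand side is a unit
    vector with its 1 in a row of degree 0, so \<open>t = 0\<close>.\<close>
  have y_reg: "hreg n (0 - (- s k)) p (\<lambda>q. y q $ k)" if "k < n + 1" for k
  proof (rule hreg_cramer[where M = M and k = "n + 1" and y = y and t = 0 and c = "\<lambda>k. - s k"
        and r = "\<lambda>i. if i < n then 0 else s b", OF p _ _ det _ _ that])
    show "\<forall>\<^sub>F q in zar n p. M q \<in> carrier_mat (n + 1) (n + 1)" by (intro always_eventually allI M)
    show "\<forall>\<^sub>F q in zar n p. y q \<in> carrier_vec (n + 1)" using U by eventually_elim (rule y)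
    fix i assume i: "i < n + 1"
    {
      fix k assume k: "k < n + 1"
      show "hreg n ((if i < n then 0 else s b) + - s k) p (\<lambda>q. M q $$ (i, k))"
      proof (cases "i < n")
        case True
        then show ?thesis using P_reg[OF c, of i k] k by (simp add: M_def)
      next
        case False
        then show ?thesis using hreg_const[OF p] hreg_zero[OF p] i k by (simp add: M_def)
      qed
    }
    show "hreg n ((if i < n then 0 else s b) + 0) p (\<lambda>q. (M q *\<^sub>v y q) $ i)"
    proof (rule hreg_cong)
      show "hreg n ((if i < n then 0 else s b) + 0) p (\<lambda>q. if i = a then 1 else 0)"
        using hreg_const[OF p] hreg_zero[OF p] ma(2) by auto
      show "\<forall>\<^sub>F q in zar n p. (if i = a then 1 else 0) = (M q *\<^sub>v y q) $ i"
        using U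
      proof eventually_elim
        fix q assume q: "U q"
        show "(if i = a then 1 else 0) = (M q *\<^sub>v y q) $ i"
          using Mv[OF q y(1)[OF q] i] y(2,3)[OF q] i ma(2) by auto
      qed
    qed
  qed
  have "hreg n (\<gamma> + w m) p (\<lambda>q. \<Sum>k<n+1. B q $$ (m, k) * y q $ k)"
  proof (rule hreg_sum[OF p])
    fix k assume "k \<in> {..<n + 1}"
    then have "hreg n ((\<gamma> + w m - s k) + (0 - (- s k))) p (\<lambda>q. B q $$ (m, k) * y q $ k)"
      using p ma by (intro hreg_mult B_reg y_reg) auto
    then show "hreg n (\<gamma> + w m) p (\<lambda>q. B q $$ (m, k) * y q $ k)" by simp
  qed
  then show ?thesis
  proof (rule hreg_cong)
    show "\<forall>\<^sub>F q in zar n p. (\<Sum>k<n+1. B q $$ (m, k) * y q $ k) = A c q $$ (m, a)"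
      using U
    proof eventually_elim
      fix q assume q: "U q"
      then have qc: "q \<in> chart_dom Q c" by (simp add: U_def)
      have "(\<Sum>k<n+1. B q $$ (m, k) * y q $ k) = (B q *\<^sub>v y q) $ m"
        by (rule mult_mat_vec_index[OF B_carrier y(1)[OF q] ma(1), symmetric])
      also have "\<dots> = (A c q *\<^sub>v unit_vec n a) $ m"
        using A_P_vec[OF c(1) qc y(1)[OF q]] y(2)[OF q] by simp
      also have "\<dots> = A c q $$ (m, a)" using A_carrier[OF c(1) qc] ma by simp
      finally show "(\<Sum>k<n+1. B q $$ (m, k) * y q $ k) = A c q $$ (m, a)" .
    qed
  qed
qed

text \<open>Lift \<open>z\<close> to \<open>v\<close> through \<open>P\<close>. Then
  \<open>B\<close> kills \<open>v\<close>, so \<open>v\<close> is a multiple of f by the kernel of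
  the Wronskian, and \<open>P\<close> sends it to 0.\<close>

lemma A_injective:
  assumes c: "c \<in> charts Q" "p \<in> chart_dom Q c" and z: "z \<in> carrier_vec n" "A c p *\<^sub>v z = 0\<^sub>v N"
  shows "z = 0\<^sub>v n"
proof -
  obtain v where v: "v \<in> carrier_vec (n + 1)" "P c p *\<^sub>v v = z" using P_surj[OF c z(1)] by auto
  then have "B p *\<^sub>v v = 0\<^sub>v N" using A_P_vec[OF c v(1)] z by simp
  then obtain x where "v = x \<cdot>\<^sub>v fvec p" using B_kernel[OF chart_point[OF c] v(1)] by blast
  then have "P c p *\<^sub>v v = 0\<^sub>v n" using P_kernel[OF c v(1)] unfolding fvec_def by blast
  then show ?thesis using v by simp
qed

text \<open>Every vector has the form \<open>P c' p *\<^sub>v v\<close>, and both sides send it to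
  \<open>B p *\<^sub>v v\<close>.\<close>

lemma A_trans:
  assumes c: "c \<in> charts Q" "p \<in> chart_dom Q c" "c' \<in> charts Q" "p \<in> chart_dom Q c'"
  shows "A c p * transition Q c c' p = A c' p"
proof -
  have T: "transition Q c c' p \<in> carrier_mat n n"
    using Q_bundle Q_rank c unfolding vector_bundle_def regular_mat_on_def by blast
  show ?thesis
  proof (rule mat_eqI_vec)
    fix u :: "complex vec" assume u: "u \<in> carrier_vec n"
    obtain v where v: "v \<in> carrier_vec (n + 1)" "P c' p *\<^sub>v v = u" using P_surj[OF c(3,4) u] by auto
    have "P c p *\<^sub>v v = transition Q c c' p *\<^sub>v u"
      unfolding P_trans[OF c(1,3,2,4)] v(2)[symmetric]
      by (rule assoc_mult_mat_vec[OF T P_carrier[OF c(3,4)] v(1)])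
    then have "(A c p * transition Q c c' p) *\<^sub>v u = B p *\<^sub>v v"
      using A_P_vec[OF c(1,2) v(1)] by (simp add: assoc_mult_mat_vec[OF A_carrier[OF c(1,2)] T u])
    then show "(A c p * transition Q c c' p) *\<^sub>v u = A c' p *\<^sub>v u"
      using A_P_vec[OF c(3,4) v(1)] v(2) by simp
  qed (rule mult_carrier_mat[OF A_carrier[OF c(1,2)] T] A_carrier[OF c(3,4)])+
qed

subsection \<open>Local splittings\<close>

text \<open>If \<open>a\<close> is the last index with \<open>f a p \<noteq> 0\<close>, then the \<open>k\<close>-th column of \<open>B p\<close> has its lowest
  nonzero entry in row \<open>a + k - 1\<close> for each \<open>k \<noteq> a\<close>; hence the unit vectors of the remaining \<open>n - 1\<close>
  rows span a complement of the image.\<close>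

lemma complementary_rows:
  assumes "a \<le> n"
  obtains h where "bij_betw h {..<n - 1} ({..<N} - (\<lambda>k. a + k - 1) ` ({..n} - {a}))"
proof -
  let ?S = "(\<lambda>k. a + k - 1) ` ({..n} - {a})"
  have "inj_on (\<lambda>k. a + k - 1) ({..n} - {a})" by (rule inj_onI) auto
  then have "card ?S = n" using assms by (simp add: card_image)
  moreover have "?S \<subseteq> {..<N}" using assms by auto
  ultimately have "card ({..<N} - ?S) = n - 1" by (simp add: card_Diff_subset)
  then show ?thesis
    using that ex_bij_betw_nat_finite[of "{..<N} - ?S"] by (auto simp: lessThan_atLeast0)
qed

text \<open>\<open>R q\<close> realises the cokernel of \<open>B q\<close> as a space of dimension
  \<open>n - 1\<close>, and \<open>E q\<close> is a section of it. Row coordinates of V have degree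
  \<open>w m\<close>, so \<open>R\<close> produces coordinates of degree \<gamma>, those of
  F(\<gamma>), and products \<open>R E\<close> have degree 0, as transition matrices of F
  must.\<close>

definition splitting :: "point set \<Rightarrow> (point \<Rightarrow> complex mat) \<Rightarrow> (point \<Rightarrow> complex mat) \<Rightarrow> bool" where
  "splitting W E R \<longleftrightarrow> (\<forall>q\<in>W. E q \<in> carrier_mat N (n - 1) \<and> R q \<in> carrier_mat (n - 1) N \<and>
     R q * E q = 1\<^sub>m (n - 1) \<and> (\<forall>y\<in>carrier_vec (n + 1). R q *\<^sub>v (B q *\<^sub>v y) = 0\<^sub>v (n - 1)) \<and>
     (\<forall>u\<in>carrier_vec N. R q *\<^sub>v u = 0\<^sub>v (n - 1) \<longrightarrow> (\<exists>y\<in>carrier_vec (n + 1). u = B q *\<^sub>v y)) \<and>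
     (\<forall>l<n - 1. \<forall>m<N. hreg n (\<gamma> - w m) q (\<lambda>q. R q $$ (l, m)) \<and> hreg n (w m - \<gamma>) q (\<lambda>q. E q $$ (m, l))))"

text \<open>The n + 1 columns of \<open>B\<close> satisfy one relation, given by f. Together with
  the n - 1 columns of \<open>E\<close> they form a matrix with N rows and N + 1 columns; bordering
  it by the unit row \<open>a\<close> breaks the relation and makes it square and invertible at
  \<open>p\<close>, hence nearby. \<open>R\<close> is read off from the inverse.\<close>

lemma local_splitting:
  assumes p: "p \<in> proj_space n"
  shows "\<exists>W E R. zariski_open n W \<and> p \<in> W \<and> splitting W E R"
proof -
  obtain a where a: "a \<le> n" "f a p \<noteq> 0" "\<And>j. a < j \<Longrightarrow> j \<le> n \<Longrightarrow> f j p = 0"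
    using last_nonzero[of n "\<lambda>k. f k p"] f_nonzero[OF p] by blast
  obtain i where i: "i \<le> n" "coord i p \<noteq> 0" using coord_nonzero[OF p] by blast
  let ?S = "(\<lambda>k. a + k - 1) ` ({..n} - {a})"
  obtain h where h: "bij_betw h {..<n - 1} ({..<N} - ?S)" using complementary_rows[OF a(1)] .
  have hN: "h l < N" "h l \<notin> ?S" if "l < n - 1" for l
    using bij_betwE[OF h] that by auto
  have h_inj: "h l = h l' \<longleftrightarrow> l = l'" if "l < n - 1" "l' < n - 1" for l l'
    using bij_betw_imp_inj_on[OF h] that by (auto dest: inj_onD)
  have NN: "N + 1 = (n + 1) + (n - 1)" using n_pos by simp
  \<comment> \<open>The unit vectors of the complementary rows, multiplied by a power of a
    coordinate nonzero at \<open>p\<close> to give them the degree that \<open>splitting\<close>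
    prescribes.\<close>
  define E where "E q = mat N (n - 1) (\<lambda>(m, l). if m = h l then coord i q powi (w m - \<gamma>) else 0)" for q
  have E: "E q \<in> carrier_mat N (n - 1)" for q by (simp add: E_def)
  \<comment> \<open>The blocks are \<open>B\<close> and \<open>E\<close> side by side in the first N
    rows; the last row extracts coordinate \<open>a\<close> of the part on which \<open>B\<close>
    acts.\<close>
  define X where "X q = mat (N + 1) (N + 1) (\<lambda>(r, c). if r < N then
      (if c < n + 1 then B q $$ (r, c) else E q $$ (r, c - (n + 1))) else if c = a then 1 else 0)" for q
  have X: "X q \<in> carrier_mat (N + 1) (N + 1)" for q by (simp add: X_def)
  define cat where "cat y z = vec (N + 1) (\<lambda>k. if k < n + 1 then y $ k else z $ (k - (n + 1)))"
    for y z :: "complex vec"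
  have cat: "cat y z \<in> carrier_vec (N + 1)" for y z by (simp add: cat_def)
  have X_cat: "(X q *\<^sub>v cat y z) $ r = (if r < N then (B q *\<^sub>v y + E q *\<^sub>v z) $ r else y $ a)"
    if y: "y \<in> carrier_vec (n + 1)" and z: "z \<in> carrier_vec (n - 1)" and r: "r < N + 1" for q y z r
  proof -
    have "(X q *\<^sub>v cat y z) $ r = (\<Sum>c<N+1. X q $$ (r, c) * cat y z $ c)"
      by (rule mult_mat_vec_index[OF X cat r])
    also have "\<dots> = (\<Sum>c<n+1. X q $$ (r, c) * cat y z $ c) + (\<Sum>l<n-1. X q $$ (r, n + 1 + l) * cat y z $ (n + 1 + l))"
      unfolding NN by (rule sum_lessThan_add)
    also have "\<dots> = (if r < N then (B q *\<^sub>v y + E q *\<^sub>v z) $ r else y $ a)"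
    proof (cases "r < N")
      case True
      have "(\<Sum>c<n+1. X q $$ (r, c) * cat y z $ c) = (\<Sum>c<n+1. B q $$ (r, c) * y $ c)"
        using True NN by (intro sum.cong) (auto simp: X_def cat_def)
      moreover have "(\<Sum>l<n-1. X q $$ (r, n + 1 + l) * cat y z $ (n + 1 + l)) = (\<Sum>l<n-1. E q $$ (r, l) * z $ l)"
        using True NN by (intro sum.cong) (auto simp: X_def cat_def)
      moreover have "(B q *\<^sub>v y + E q *\<^sub>v z) $ r = (B q *\<^sub>v y) $ r + (E q *\<^sub>v z) $ r"
        using True E[of q] by simp
      ultimately show ?thesis
        using True by (simp only: mult_mat_vec_index[OF B_carrier y True] mult_mat_vec_index[OF E z True] if_True)
    next
      case False
      have "(\<Sum>c<n+1. X q $$ (r, c) * cat y z $ c) = (\<Sum>c<n+1. (if c = a then 1 else 0) * y $ c)"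
        using False r NN by (intro sum.cong) (auto simp: X_def cat_def)
      also have "\<dots> = 1 * y $ a" by (rule sum_single_left) (use a in auto)
      finally have "(\<Sum>c<n+1. X q $$ (r, c) * cat y z $ c) = y $ a" by simp
      moreover have "(\<Sum>l<n-1. X q $$ (r, n + 1 + l) * cat y z $ (n + 1 + l)) = 0"
        using False r NN a(1) by (intro sum.neutral) (auto simp: X_def)
      ultimately show ?thesis using False by simp
    qed
    finally show ?thesis .
  qed
  have cat_surj: "\<exists>y\<in>carrier_vec (n + 1). \<exists>z\<in>carrier_vec (n - 1). v = cat y z" if v: "v \<in> carrier_vec (N + 1)" for v
    using v NN
    by (intro bexI[of _ "vec (n + 1) (\<lambda>k. v $ k)"] bexI[of _ "vec (n - 1) (\<lambda>l. v $ (n + 1 + l))"])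
       (auto simp: cat_def intro!: eq_vecI)
  have det: "det (X p) \<noteq> 0"
  proof (rule det_nonzero_if_injective[OF X])
    fix v assume v: "v \<in> carrier_vec (N + 1)" "X p *\<^sub>v v = 0\<^sub>v (N + 1)"
    obtain y z where yz: "y \<in> carrier_vec (n + 1)" "z \<in> carrier_vec (n - 1)" "v = cat y z"
      using cat_surj[OF v(1)] by blast
    have Xv: "(X p *\<^sub>v cat y z) $ r = 0" if "r < N + 1" for r using v(2) yz(3) that by simp
    have ya: "y $ a = 0" using X_cat[OF yz(1,2), of N p] Xv[of N] by simp
    have BE: "(B p *\<^sub>v y) $ r + (E p *\<^sub>v z) $ r = 0" if "r < N" for r
    proof -
      have "(B p *\<^sub>v y + E p *\<^sub>v z) $ r = (B p *\<^sub>v y) $ r + (E p *\<^sub>v z) $ r"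
        using that E[of p] by simp
      then show ?thesis using X_cat[OF yz(1,2), of r p] Xv[of r] that by simp
    qed
    \<comment> \<open>In the rows \<open>a + k - 1\<close> the matrix \<open>E\<close> vanishes, so
      the Wronskian condition holds there for \<open>y\<close> alone. Once \<open>y\<close> is 0,
      the rows \<open>h l\<close> give the entries of \<open>z\<close> one by one.\<close>
    have y0: "y = 0\<^sub>v (n + 1)"
    proof (rule wronski_eq_zero[where F = "\<lambda>k. f k p", OF yz(1) a ya])
      fix k assume k: "k \<le> n" "k \<noteq> a"
      have r: "a + k - 1 < N" "a + k - 1 \<in> ?S" using k a(1) by auto
      have "(E p *\<^sub>v z) $ (a + k - 1) = (\<Sum>l<n-1. E p $$ (a + k - 1, l) * z $ l)"
        by (rule mult_mat_vec_index[OF E yz(2) r(1)])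
      also have "\<dots> = 0" using hN(2) r by (intro sum.neutral) (force simp: E_def)
      finally show "(wronski n (\<lambda>k. f k p) *\<^sub>v y) $ (a + k - 1) = 0" using BE[OF r(1)] by (simp add: B_def)
    qed
    have "z $ l = 0" if l: "l < n - 1" for l
    proof -
      have "(B p *\<^sub>v y) $ h l = 0" unfolding y0 mult_mat_vec_zero[OF B_carrier] using hN(1)[OF l] by simp
      then have "0 = (E p *\<^sub>v z) $ h l" using BE[OF hN(1)[OF l]] by simp
      also have "\<dots> = (\<Sum>l'<n-1. E p $$ (h l, l') * z $ l')"
        by (rule mult_mat_vec_index[OF E yz(2) hN(1)[OF l]])
      also have "\<dots> = (\<Sum>l'<n-1. (if l' = l then coord i p powi (w (h l) - \<gamma>) else 0) * z $ l')"
        using l hN(1)[OF l] by (intro sum.cong) (auto simp: E_def h_inj)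
      also have "\<dots> = coord i p powi (w (h l) - \<gamma>) * z $ l" by (rule sum_single_left) (use l in auto)
      finally show ?thesis using i by simp
    qed
    then show "v = 0\<^sub>v (N + 1)"
      unfolding yz(3) y0 using NN by (intro eq_vecI) (auto simp: cat_def)
  qed
  \<comment> \<open>Row and column degrees of \<open>X\<close>. The last row must have degree
    \<open>s a - \<gamma>\<close> because column \<open>a\<close> has degree
    \<open>\<gamma> - s a\<close> and they meet in the constant 1.\<close>
  define r where "r m = (if m < N then w m else s a - \<gamma>)" for m
  define c where "c k = (if k < n + 1 then \<gamma> - s k else - \<gamma>)" for k
  have E_reg: "hreg n (w m - \<gamma>) q (\<lambda>q. E q $$ (m, l))"
    if "q \<in> proj_space n" "coord i q \<noteq> 0" "m < N" "l < n - 1" for q m l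
    using that hreg_coord_powi[OF that(1) i(1) that(2)] hreg_zero[OF that(1)]
    by (cases "m = h l") (simp_all add: E_def)
  have X_reg: "hreg n (r b + c k) q (\<lambda>q. X q $$ (b, k))"
    if q: "q \<in> proj_space n" "coord i q \<noteq> 0" and bk: "b < N + 1" "k < N + 1" for q b k
  proof -
    consider "b < N" "k < n + 1" | "b < N" "n + 1 \<le> k" | "b = N" "k = a" | "b = N" "k \<noteq> a"
      using bk by linarith
    then show ?thesis
    proof cases
      case 1
      then have "hreg n (\<gamma> + w b - s k) q (\<lambda>q. B q $$ (b, k))" by (intro B_reg q) auto
      then show ?thesis using 1 bk by (simp add: X_def r_def c_def algebra_simps)
    next
      case 2
      then have "hreg n (w b - \<gamma>) q (\<lambda>q. E q $$ (b, k - (n + 1)))" using bk NN by (intro E_reg q) auto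
      then show ?thesis using 2 bk by (simp add: X_def r_def c_def)
    next
      case 3
      then show ?thesis using hreg_const[OF q(1)] a(1) bk by (simp add: X_def r_def c_def)
    next
      case 4
      then show ?thesis using hreg_zero[OF q(1)] bk by (simp add: X_def)
    qed
  qed
  have "hreg n ((\<Sum>b<N + 1. r b) + (\<Sum>k<N + 1. c k)) p (\<lambda>q. det (X q))"
    by (rule hreg_det[where M = X, OF p]) (use X X_reg[OF p i(2)] in \<open>auto intro: always_eventually\<close>)
  then have "\<forall>\<^sub>F q in zar n p. det (X q) \<noteq> 0" using det by (rule hreg_nonzero)
  then have "\<forall>\<^sub>F q in zar n p. q \<in> proj_space n \<and> coord i q \<noteq> 0 \<and> f a q \<noteq> 0 \<and> det (X q) \<noteq> 0"
    using eventually_zar_open[OF zariski_open_proj_space p] hreg_nonzero[OF hreg_coord[OF p i(1)] i(2)]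
      hreg_nonzero[OF f_reg[OF p a(1)] a(2)]
    by eventually_elim simp
  \<comment> \<open>Besides invertibility of \<open>X\<close>, all of \<open>W\<close> has
    \<open>coord i q \<noteq> 0\<close>, for the frame in \<open>E\<close>, and
    \<open>f a q \<noteq> 0\<close>, so that coordinate \<open>a\<close> can be removed by
    subtracting a multiple of f. Index \<open>a\<close> need not remain the last nonzero one on
    \<open>W\<close>.\<close>
  then obtain W where W: "zariski_open n W" "p \<in> W"
    and good: "\<And>q. q \<in> W \<Longrightarrow> q \<in> proj_space n" "\<And>q. q \<in> W \<Longrightarrow> coord i q \<noteq> 0"
      "\<And>q. q \<in> W \<Longrightarrow> f a q \<noteq> 0" "\<And>q. q \<in> W \<Longrightarrow> det (X q) \<noteq> 0"
    unfolding eventually_zar[OF p] by blast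
  have "\<forall>q\<in>W. \<exists>Y. Y \<in> carrier_mat (N + 1) (N + 1) \<and> X q * Y = 1\<^sub>m (N + 1) \<and> Y * X q = 1\<^sub>m (N + 1)"
    using inverse_mat_exists[OF X good(4)] by metis
  then obtain Y where Y: "\<And>q. q \<in> W \<Longrightarrow> Y q \<in> carrier_mat (N + 1) (N + 1)"
    "\<And>q. q \<in> W \<Longrightarrow> X q * Y q = 1\<^sub>m (N + 1)" "\<And>q. q \<in> W \<Longrightarrow> Y q * X q = 1\<^sub>m (N + 1)" by metis
  \<comment> \<open>The rows of the inverse that recover the coefficients along \<open>E\<close>.
    The last column of \<open>Y\<close> is dropped: it meets only the border entry
    \<open>y $ a\<close>, which is 0 wherever \<open>R_split\<close> is applied.\<close>
  define R where "R q = mat (n - 1) N (\<lambda>(l, m). Y q $$ (n + 1 + l, m))" for q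
  have R: "R q \<in> carrier_mat (n - 1) N" for q by (simp add: R_def)
  have R_split: "R q *\<^sub>v (B q *\<^sub>v y + E q *\<^sub>v z) = z"
    if q: "q \<in> W" and y: "y \<in> carrier_vec (n + 1)" "y $ a = 0" and z: "z \<in> carrier_vec (n - 1)" for q y z
  proof (rule eq_vecI)
    fix l assume "l < dim_vec z"
    then have l: "l < n - 1" using z by simp
    have u: "B q *\<^sub>v y + E q *\<^sub>v z \<in> carrier_vec N" using E[of q] by (intro carrier_vecI) auto
    have "(R q *\<^sub>v (B q *\<^sub>v y + E q *\<^sub>v z)) $ l = (\<Sum>m<N. R q $$ (l, m) * (B q *\<^sub>v y + E q *\<^sub>v z) $ m)"
      by (rule mult_mat_vec_index[OF R u l])
    also have "\<dots> = (\<Sum>m<N. Y q $$ (n + 1 + l, m) * (X q *\<^sub>v cat y z) $ m)"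
      using l X_cat[OF y(1) z] by (intro sum.cong) (auto simp: R_def)
    also have "\<dots> = (\<Sum>m<N+1. Y q $$ (n + 1 + l, m) * (X q *\<^sub>v cat y z) $ m)"
      using X_cat[OF y(1) z, of N q] y(2) by simp
    also have "\<dots> = (Y q *\<^sub>v (X q *\<^sub>v cat y z)) $ (n + 1 + l)"
      by (rule mult_mat_vec_index[OF Y(1)[OF q] mult_mat_vec_carrier[OF X cat], symmetric]) (use l NN in auto)
    also have "Y q *\<^sub>v (X q *\<^sub>v cat y z) = cat y z"
      using assoc_mult_mat_vec[OF Y(1)[OF q] X cat, symmetric] Y(3)[OF q] cat by simp
    finally show "(R q *\<^sub>v (B q *\<^sub>v y + E q *\<^sub>v z)) $ l = z $ l" using l NN by (simp add: cat_def)
  qed (use R[of q] z in auto)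
  have R_reg: "hreg n (\<gamma> - w m) q (\<lambda>q. R q $$ (l, m))" if q: "q \<in> W" and lm: "l < n - 1" "m < N" for q l m
  proof -
    have k: "n + 1 + l < N + 1" using lm NN by simp
    have qP: "q \<in> proj_space n" using good q by blast
    have evW: "\<forall>\<^sub>F q in zar n q. q \<in> W" by (rule eventually_zar_open[OF W(1) q])
    \<comment> \<open>Column \<open>m\<close> of the inverse solves \<open>X\<close> against the
      unit vector \<open>m\<close>. Its entry 1 sits in a row of degree \<open>w m\<close>, whence
      \<open>t = - w m\<close>.\<close>
    have "hreg n (- w m - c (n + 1 + l)) q (\<lambda>q. col (Y q) m $ (n + 1 + l))"
    proof (rule hreg_cramer[where M = X and k = "N + 1" and y = "\<lambda>q. col (Y q) m" and t = "- w m"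
          and c = c and r = r, OF qP _ X_reg[OF qP good(2)[OF q]] good(4)[OF q] _ _ k])
      show "\<forall>\<^sub>F q in zar n q. X q \<in> carrier_mat (N + 1) (N + 1)" by (intro always_eventually allI X)
      show "\<forall>\<^sub>F q in zar n q. col (Y q) m \<in> carrier_vec (N + 1)"
        using evW by eventually_elim (use carrier_matD(1)[OF Y(1)] in \<open>auto intro!: carrier_vecI\<close>)
      fix b assume b: "b < N + 1"
      show "hreg n (r b + - w m) q (\<lambda>q. (X q *\<^sub>v col (Y q) m) $ b)"
      proof (rule hreg_cong)
        show "hreg n (r b + - w m) q (\<lambda>q. if b = m then 1 else 0)"
          using hreg_const[OF qP] hreg_zero[OF qP] lm by (auto simp: r_def)
        show "\<forall>\<^sub>F q in zar n q. (if b = m then 1 else 0) = (X q *\<^sub>v col (Y q) m) $ b"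
          using evW
        proof eventually_elim
          fix q assume q: "q \<in> W"
          have "(X q *\<^sub>v col (Y q) m) $ b = (X q * Y q) $$ (b, m)"
            using b lm(2) carrier_matD[OF X] carrier_matD[OF Y(1)[OF q]] by simp
          then show "(if b = m then 1 else 0) = (X q *\<^sub>v col (Y q) m) $ b"
            using b lm(2) Y(2)[OF q] by simp
        qed
      qed
    qed
    then have "hreg n (\<gamma> - w m) q (\<lambda>q. col (Y q) m $ (n + 1 + l))" by (simp add: c_def)
    then show ?thesis
      by (rule hreg_eq_on_open[OF _ W(1) q])
         (use lm NN carrier_matD[OF Y(1)] in \<open>simp add: R_def\<close>)
  qed
  have "splitting W E R"
    unfolding splitting_def
  proof (intro ballI conjI allI impI)
    fix q assume q: "q \<in> W"
    show "R q * E q = 1\<^sub>m (n - 1)"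
    proof (rule mat_eqI_vec)
      fix z :: "complex vec" assume z: "z \<in> carrier_vec (n - 1)"
      have "R q *\<^sub>v (B q *\<^sub>v 0\<^sub>v (n + 1) + E q *\<^sub>v z) = z" using a(1) by (intro R_split q z) auto
      then have "R q *\<^sub>v (E q *\<^sub>v z) = z"
        unfolding mult_mat_vec_zero[OF B_carrier] using E[of q] z by simp
      then show "(R q * E q) *\<^sub>v z = 1\<^sub>m (n - 1) *\<^sub>v z" using z by (simp add: assoc_mult_mat_vec[OF R E z])
    qed (rule mult_carrier_mat[OF R E] one_carrier_mat)+
    show "R q *\<^sub>v (B q *\<^sub>v y) = 0\<^sub>v (n - 1)" if y: "y \<in> carrier_vec (n + 1)" for y
    proof -
      \<comment> \<open>Changing \<open>y\<close> along f does not affect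
        \<open>B q *\<^sub>v y\<close>, so coordinate \<open>a\<close> may be made 0 before using
        \<open>R_split\<close>.\<close>
      define t where "t = (y $ a / f a q) \<cdot>\<^sub>v fvec q"
      have t: "t \<in> carrier_vec (n + 1)" by (simp add: t_def)
      have "(y - t) $ a = 0" using a(1) y good(3)[OF q] by (simp add: t_def fvec_index)
      then have "R q *\<^sub>v (B q *\<^sub>v (y - t) + E q *\<^sub>v 0\<^sub>v (n - 1)) = 0\<^sub>v (n - 1)"
        using y t by (intro R_split q) auto
      moreover have "B q *\<^sub>v (y - t) = B q *\<^sub>v y"
        unfolding mult_minus_distrib_mat_vec[OF B_carrier y t] using B_fvec[of q "y $ a / f a q"] mult_mat_vec_carrier[OF B_carrier y]
        by (simp add: t_def)
      ultimately show ?thesis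
        unfolding mult_mat_vec_zero[OF E] using mult_mat_vec_carrier[OF B_carrier y] by simp
    qed
    show "\<exists>y\<in>carrier_vec (n + 1). u = B q *\<^sub>v y" if u: "u \<in> carrier_vec N" "R q *\<^sub>v u = 0\<^sub>v (n - 1)" for u
    proof -
      \<comment> \<open>Appending 0 in the border row makes the solution of the bordered system
        satisfy \<open>y $ a = 0\<close>; then \<open>R\<close> reads off the part along
        \<open>E\<close>, which must vanish.\<close>
      define v where "v = vec (N + 1) (\<lambda>k. if k < N then u $ k else 0)"
      have v: "v \<in> carrier_vec (N + 1)" by (simp add: v_def)
      obtain y z where yz: "y \<in> carrier_vec (n + 1)" "z \<in> carrier_vec (n - 1)" "Y q *\<^sub>v v = cat y z"
        using cat_surj[OF mult_mat_vec_carrier[OF Y(1)[OF q] v]] by blast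
      have "X q *\<^sub>v cat y z = v"
        unfolding yz(3)[symmetric] using assoc_mult_mat_vec[OF X Y(1)[OF q] v, symmetric] Y(2)[OF q] v by simp
      then have Xv: "(X q *\<^sub>v cat y z) $ k = v $ k" for k by simp
      have "y $ a = 0" using X_cat[OF yz(1,2), of N q] Xv[of N] by (simp add: v_def)
      moreover have u_eq: "u = B q *\<^sub>v y + E q *\<^sub>v z"
      proof (rule eq_vecI)
        fix k assume "k < dim_vec (B q *\<^sub>v y + E q *\<^sub>v z)"
        then have "k < N" using E[of q] by simp
        then show "u $ k = (B q *\<^sub>v y + E q *\<^sub>v z) $ k" using X_cat[OF yz(1,2), of k q] Xv[of k] by (simp add: v_def)
      qed (use u E[of q] in auto)
      ultimately have "z = 0\<^sub>v (n - 1)" using R_split[OF q yz(1) _ yz(2)] u(2) by simp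
      then have "u = B q *\<^sub>v y"
        unfolding u_eq using mult_mat_vec_zero[OF E[of q]] mult_mat_vec_carrier[OF B_carrier yz(1)] by simp
      then show ?thesis using yz(1) by blast
    qed
  qed (use E R R_reg E_reg good in auto)
  then show ?thesis using W by blast
qed

subsection \<open>The bundle \<open>F\<close> and the exact sequence\<close>

text \<open>The local cokernels of \<open>B\<close> are glued. The transition from chart
  \<open>p'\<close> to chart \<open>p\<close> lifts by \<open>E p'\<close> and projects by
  \<open>R p\<close>; the lift matters only modulo the image of \<open>B\<close>, which every
  \<open>R p\<close> kills.\<close>

theorem quotient_sequence:
  fixes V :: "'v vbundle"
  assumes V: "diag_bundle n V N w \<theta>"
  shows "\<exists>F :: point vbundle. vector_bundle n F \<and> bundle_rank F = n - 1 \<and>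
    short_exact n (twist n Q (- \<gamma>)) V (twist n F \<gamma>)"
proof -
  have "\<forall>p\<in>proj_space n. \<exists>T. zariski_open n (fst T) \<and> p \<in> fst T \<and> splitting (fst T) (fst (snd T)) (snd (snd T))"
    using local_splitting by force
  then obtain T where T: "\<And>p. p \<in> proj_space n \<Longrightarrow> zariski_open n (fst (T p)) \<and> p \<in> fst (T p) \<and>
      splitting (fst (T p)) (fst (snd (T p))) (snd (snd (T p)))"
    by metis
  define W E R where "W p = fst (T p)" and "E p = fst (snd (T p))" and "R p = snd (snd (T p))" for p
  have W: "zariski_open n (W p)" "p \<in> W p" if "p \<in> proj_space n" for p
    using T[OF that] by (simp_all add: W_def)
  have split: "splitting (W p) (E p) (R p)" if "p \<in> proj_space n" for p
    using T[OF that] by (simp add: W_def E_def R_def)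
  have E: "E p q \<in> carrier_mat N (n - 1)" and R: "R p q \<in> carrier_mat (n - 1) N"
    and RE: "R p q * E p q = 1\<^sub>m (n - 1)"
    and RB: "\<And>y. y \<in> carrier_vec (n + 1) \<Longrightarrow> R p q *\<^sub>v (B q *\<^sub>v y) = 0\<^sub>v (n - 1)"
    and kerR: "\<And>u. u \<in> carrier_vec N \<Longrightarrow> R p q *\<^sub>v u = 0\<^sub>v (n - 1) \<Longrightarrow> \<exists>y\<in>carrier_vec (n + 1). u = B q *\<^sub>v y"
    and R_reg: "\<And>l m. l < n - 1 \<Longrightarrow> m < N \<Longrightarrow> hreg n (\<gamma> - w m) q (\<lambda>q. R p q $$ (l, m))"
    and E_reg: "\<And>l m. l < n - 1 \<Longrightarrow> m < N \<Longrightarrow> hreg n (w m - \<gamma>) q (\<lambda>q. E p q $$ (m, l))"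
    if "p \<in> proj_space n" "q \<in> W p" for p q
    using split[OF that(1)] that(2) unfolding splitting_def by blast+
  have RE_vec: "R p q *\<^sub>v (E p q *\<^sub>v z) = z" if "p \<in> proj_space n" "q \<in> W p" "z \<in> carrier_vec (n - 1)" for p q z
    using assoc_mult_mat_vec[OF R[OF that(1,2)] E[OF that(1,2)] that(3)] RE[OF that(1,2)] that(3) by simp
  \<comment> \<open>\<open>E p' R p'\<close> changes a vector only by an element of the kernel of
    \<open>R p'\<close>, that is of the image of \<open>B\<close>, and \<open>R p\<close> does not
    see it. This gives both the cocycle rule and compatibility of the projection with the
    charts.\<close>
  have RER: "R p q * E p' q * R p' q = R p q"
    if p: "p \<in> proj_space n" "q \<in> W p" and p': "p' \<in> proj_space n" "q \<in> W p'" for p p' q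
  proof (rule mat_eqI_vec)
    fix u :: "complex vec" assume u: "u \<in> carrier_vec N"
    let ?v = "E p' q *\<^sub>v (R p' q *\<^sub>v u)"
    have Ru: "R p' q *\<^sub>v u \<in> carrier_vec (n - 1)" by (rule mult_mat_vec_carrier[OF R[OF p'] u])
    have v: "?v \<in> carrier_vec N" by (rule mult_mat_vec_carrier[OF E[OF p'] Ru])
    have "R p' q *\<^sub>v (u - ?v) = 0\<^sub>v (n - 1)"
      using mult_minus_distrib_mat_vec[OF R[OF p'] u v] RE_vec[OF p' Ru] Ru by simp
    then obtain y where y: "y \<in> carrier_vec (n + 1)" "u - ?v = B q *\<^sub>v y"
      using kerR[OF p', of "u - ?v"] u v by auto
    have "R p q *\<^sub>v u - R p q *\<^sub>v ?v = 0\<^sub>v (n - 1)"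
      using RB[OF p y(1)] unfolding y(2)[symmetric] mult_minus_distrib_mat_vec[OF R[OF p] u v] .
    moreover have "R p q *\<^sub>v u \<in> carrier_vec (n - 1)" "R p q *\<^sub>v ?v \<in> carrier_vec (n - 1)"
      using mult_mat_vec_carrier[OF R[OF p]] u v by auto
    ultimately have "R p q *\<^sub>v ?v = R p q *\<^sub>v u" by (auto simp: vec_eq_iff)
    then show "(R p q * E p' q * R p' q) *\<^sub>v u = R p q *\<^sub>v u"
      by (simp add: assoc_mult_mat_vec[OF mult_carrier_mat[OF R[OF p] E[OF p']] R[OF p'] u]
          assoc_mult_mat_vec[OF R[OF p] E[OF p'] Ru])
  qed (rule mult_carrier_mat[OF mult_carrier_mat[OF R[OF p] E[OF p']] R[OF p']] R[OF p])+
  \<comment> \<open>One chart for each point, with the neighbourhood on which its splitting was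
    obtained.\<close>
  define F :: "point vbundle" where
    "F = \<lparr>charts = proj_space n, chart_dom = W, bundle_rank = n - 1, transition = (\<lambda>p p' q. R p q * E p' q)\<rparr>"
  have F [simp]: "charts F = proj_space n" "chart_dom F = W" "bundle_rank F = n - 1"
    by (simp_all add: F_def)
  have F_trans: "transition F p p' q = R p q * E p' q" for p p' q
    by (simp add: F_def)
  have F_bundle: "vector_bundle n F"
    unfolding vector_bundle_def F
  proof (intro conjI ballI)
    show "\<And>p. p \<in> proj_space n \<Longrightarrow> zariski_open n (W p)" by (rule W)
    show "(\<Union>p\<in>proj_space n. W p) = proj_space n" using W zariski_open_subset by blast
    fix p p' assume p: "p \<in> proj_space n" "p' \<in> proj_space n"
    show "regular_mat_on n (W p \<inter> W p') (n - 1) (n - 1) (transition F p p')"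
    proof (rule regular_mat_onI)
      show op: "zariski_open n (W p \<inter> W p')" using W p by (intro zariski_open_Int) auto
      fix q assume q: "q \<in> W p \<inter> W p'"
      show "transition F p p' q \<in> carrier_mat (n - 1) (n - 1)"
        unfolding F_trans using p q by (intro mult_carrier_mat[OF R E]) auto
      fix l l' assume l: "l < n - 1" "l' < n - 1"
      have qP: "q \<in> proj_space n" using q W(1)[OF p(1)] zariski_open_subset by blast
      have "hreg n 0 q (\<lambda>q. \<Sum>m<N. R p q $$ (l, m) * E p' q $$ (m, l'))"
      proof (rule hreg_sum[OF qP])
        fix m assume "m \<in> {..<N}"
        then have "hreg n ((\<gamma> - w m) + (w m - \<gamma>)) q (\<lambda>q. R p q $$ (l, m) * E p' q $$ (m, l'))"
          using p q l by (intro hreg_mult R_reg E_reg) auto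
        then show "hreg n 0 q (\<lambda>q. R p q $$ (l, m) * E p' q $$ (m, l'))" by simp
      qed
      then show "hreg n 0 q (\<lambda>q. transition F p p' q $$ (l, l'))"
      proof (rule hreg_eq_on_open[OF _ op q])
        fix q assume "q \<in> W p \<inter> W p'"
        then show "transition F p p' q $$ (l, l') = (\<Sum>m<N. R p q $$ (l, m) * E p' q $$ (m, l'))"
          unfolding F_trans using p l by (intro mult_mat_index[OF R E]) auto
      qed
    qed
    fix p'' q assume p'': "p'' \<in> proj_space n" and q: "q \<in> W p \<inter> W p' \<inter> W p''"
    then have q: "q \<in> W p" "q \<in> W p'" "q \<in> W p''" by auto
    have "R p q * E p' q * (R p' q * E p'' q) = R p q * E p' q * R p' q * E p'' q"
      by (rule assoc_mult_mat[OF mult_carrier_mat[OF R[OF p(1) q(1)] E[OF p(2) q(2)]] R[OF p(2) q(2)] E[OF p'' q(3)], symmetric])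
    then show "transition F p p' q * transition F p' p'' q = transition F p p'' q"
      unfolding F_trans RER[OF p(1) q(1) p(2) q(2)] .
  next
    fix p q assume "p \<in> proj_space n" "q \<in> W p"
    then show "transition F p p q = 1\<^sub>m (n - 1)" unfolding F_trans by (rule RE)
  qed
  have V_rank: "bundle_rank V = N" using V by (simp add: diag_bundle_def)
  have V_open: "zariski_open n (chart_dom V j)" if "j \<in> charts V" for j using V that by (simp add: diag_bundle_def)
  have \<theta>: "\<theta> j m p \<noteq> 0" "hreg n (w m) p (\<theta> j m)" if "j \<in> charts V" "p \<in> chart_dom V j" "m < N" for j p m
    using V that unfolding diag_bundle_def by blast+
  have V_trans: "transition V j j' p = diag N (\<lambda>m. \<theta> j' m p / \<theta> j m p)"
    if "j \<in> charts V" "j' \<in> charts V" "p \<in> chart_dom V j" "p \<in> chart_dom V j'" for j j' p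
    using V that unfolding diag_bundle_def by blast
  \<comment> \<open>Chart coordinates become homogeneous ones by multiplication with the frame of
    the source, \<open>coord i p powi (- \<gamma>)\<close> for the twist of Q, and become chart
    coordinates again by division by the frame of the target. For \<open>\<Psi>\<close> the target
    frame is \<open>coord i p powi \<gamma>\<close>, so the same scalar appears.\<close>
  define \<Phi> where "\<Phi> j = (\<lambda>(c, i) p. (coord i p powi (- \<gamma>)) \<cdot>\<^sub>m (diag N (\<lambda>m. 1 / \<theta> j m p) * A c p))" for j
  define \<Psi> where "\<Psi> = (\<lambda>(x, i) j p. (coord i p powi (- \<gamma>)) \<cdot>\<^sub>m (R x p * diag N (\<lambda>m. \<theta> j m p)))"
  have \<Phi>: "bundle_morphism n (twist n Q (- \<gamma>)) V \<Phi>"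
    unfolding bundle_morphism_def twist_charts(1,3) Q_rank V_rank
  proof (intro conjI ballI)
    fix ci j assume ci: "ci \<in> charts Q \<times> {..n}" and j: "j \<in> charts V"
    then obtain c i where ci_eq [simp]: "ci = (c, i)" and c: "c \<in> charts Q" "i \<le> n" by auto
    have dom: "chart_dom (twist n Q (- \<gamma>)) ci = chart_dom Q c \<inter> {p \<in> proj_space n. coord i p \<noteq> 0}"
      using c by (simp add: twist_charts)
    show "regular_mat_on n (chart_dom (twist n Q (- \<gamma>)) ci \<inter> chart_dom V j) N n (\<Phi> j ci)"
    proof (rule regular_mat_onI)
      show op: "zariski_open n (chart_dom (twist n Q (- \<gamma>)) ci \<inter> chart_dom V j)"
        unfolding dom using c j by (intro zariski_open_Int chart_open zariski_open_coord V_open)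
      fix p assume p: "p \<in> chart_dom (twist n Q (- \<gamma>)) ci \<inter> chart_dom V j"
      then have p': "p \<in> chart_dom Q c" "p \<in> proj_space n" "coord i p \<noteq> 0" "p \<in> chart_dom V j" by (auto simp: dom[unfolded ci_eq])
      show "\<Phi> j ci p \<in> carrier_mat N n"
        using mult_carrier_mat[OF diag_carrier(1) A_carrier[OF c(1) p'(1)]] by (simp add: \<Phi>_def)
      fix m a assume ma: "m < N" "a < n"
      have "hreg n (- \<gamma> + (\<gamma> + w m - w m)) p (\<lambda>q. coord i q powi (- \<gamma>) * (A c q $$ (m, a) / \<theta> j m q))"
        using p' c j ma by (intro hreg_mult hreg_divide hreg_coord_powi A_reg \<theta>) auto
      then have "hreg n 0 p (\<lambda>q. coord i q powi (- \<gamma>) * (A c q $$ (m, a) / \<theta> j m q))" by simp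
      then show "hreg n 0 p (\<lambda>q. \<Phi> j ci q $$ (m, a))"
      proof (rule hreg_eq_on_open[OF _ op p])
        fix q assume "q \<in> chart_dom (twist n Q (- \<gamma>)) ci \<inter> chart_dom V j"
        then have Ac: "A c q \<in> carrier_mat N n" using c by (intro A_carrier) (auto simp: dom[unfolded ci_eq])
        show "\<Phi> j ci q $$ (m, a) = coord i q powi (- \<gamma>) * (A c q $$ (m, a) / \<theta> j m q)"
          using ma diag_mult_index[OF Ac ma, of "\<lambda>m. 1 / \<theta> j m q"] carrier_matD[OF Ac]
          by (simp add: \<Phi>_def del: index_mult_mat(1))
      qed
    qed
    fix ci' j' p assume ci': "ci' \<in> charts Q \<times> {..n}" and j': "j' \<in> charts V"
      and p: "p \<in> chart_dom (twist n Q (- \<gamma>)) ci \<inter> chart_dom (twist n Q (- \<gamma>)) ci' \<inter> chart_dom V j \<inter> chart_dom V j'"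
    then obtain c' i' where [simp]: "ci' = (c', i')" and c': "c' \<in> charts Q" "i' \<le> n" by auto
    have p: "p \<in> chart_dom Q c" "p \<in> chart_dom Q c'" "coord i p \<noteq> 0" "coord i' p \<noteq> 0" "p \<in> chart_dom V j" "p \<in> chart_dom V j'"
      using p c c' by (auto simp: twist_charts)
    let ?D = "\<lambda>j. diag N (\<lambda>m. 1 / \<theta> j m p)" and ?x = "coord i p powi (- \<gamma>)" and ?y = "(coord i' p / coord i p) powi (- \<gamma>)"
    have Ac: "A c p \<in> carrier_mat N n" and Tc: "transition Q c c' p \<in> carrier_mat n n"
      using A_carrier[OF c(1) p(1)] Q_bundle Q_rank c c' p unfolding vector_bundle_def regular_mat_on_def by blast+
    have "transition V j' j p * ?D j = ?D j'"
      unfolding V_trans[OF j' j p(6,5)] diag_mult_diag using \<theta>(1)[OF j p(5)] by (auto intro!: diag_cong)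
    then have D: "transition V j' j p * (?D j * A c p) = ?D j' * A c p"
      unfolding V_trans[OF j' j p(6,5)]
      by (subst assoc_mult_mat[OF diag_carrier(1) diag_carrier(1) Ac, symmetric]) simp
    have "transition V j' j p * \<Phi> j ci p * transition (twist n Q (- \<gamma>)) ci ci' p =
      transition V j' j p * (?x \<cdot>\<^sub>m (?D j * A c p)) * (?y \<cdot>\<^sub>m transition Q c c' p)"
      by (simp add: \<Phi>_def twist_charts)
    also have "transition V j' j p * (?x \<cdot>\<^sub>m (?D j * A c p)) = ?x \<cdot>\<^sub>m (?D j' * A c p)"
      unfolding D[symmetric] unfolding V_trans[OF j' j p(6,5)]
      by (rule mult_smult_distrib[OF diag_carrier(1) mult_carrier_mat[OF diag_carrier(1) Ac]])
    also have "?x \<cdot>\<^sub>m (?D j' * A c p) * (?y \<cdot>\<^sub>m transition Q c c' p) = (?x * ?y) \<cdot>\<^sub>m (?D j' * A c p * transition Q c c' p)"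
      by (rule smult_mult_smult[OF mult_carrier_mat[OF diag_carrier(1) Ac] Tc])
    also have "?D j' * A c p * transition Q c c' p = ?D j' * A c' p"
      unfolding assoc_mult_mat[OF diag_carrier(1) Ac Tc] A_trans[OF c(1) p(1) c'(1) p(2)] ..
    also have "?x * ?y = coord i' p powi (- \<gamma>)"
      using p(3) by (simp add: power_int_divide_distrib)
    finally show "\<Phi> j' ci' p = transition V j' j p * \<Phi> j ci p * transition (twist n Q (- \<gamma>)) ci ci' p"
      by (simp add: \<Phi>_def)
  qed
  have \<Psi>: "bundle_morphism n V (twist n F \<gamma>) \<Psi>"
    unfolding bundle_morphism_def twist_charts(1,3) F V_rank
  proof (intro conjI ballI)
    fix j xi assume j: "j \<in> charts V" and xi: "xi \<in> proj_space n \<times> {..n}"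
    then obtain x i where xi_eq [simp]: "xi = (x, i)" and x: "x \<in> proj_space n" "i \<le> n" by auto
    have dom: "chart_dom (twist n F \<gamma>) xi = W x \<inter> {p \<in> proj_space n. coord i p \<noteq> 0}"
      using x by (simp add: twist_charts)
    show "regular_mat_on n (chart_dom V j \<inter> chart_dom (twist n F \<gamma>) xi) (n - 1) N (\<Psi> xi j)"
    proof (rule regular_mat_onI)
      show op: "zariski_open n (chart_dom V j \<inter> chart_dom (twist n F \<gamma>) xi)"
        unfolding dom using x j by (intro zariski_open_Int W zariski_open_coord V_open)
      fix p assume p: "p \<in> chart_dom V j \<inter> chart_dom (twist n F \<gamma>) xi"
      then have p': "p \<in> W x" "p \<in> proj_space n" "coord i p \<noteq> 0" "p \<in> chart_dom V j" by (auto simp: dom[unfolded xi_eq])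
      show "\<Psi> xi j p \<in> carrier_mat (n - 1) N"
        using mult_carrier_mat[OF R[OF x(1) p'(1)] diag_carrier(1)] by (simp add: \<Psi>_def)
      fix l m assume lm: "l < n - 1" "m < N"
      have "hreg n (- \<gamma> + (\<gamma> - w m + w m)) p (\<lambda>q. coord i q powi (- \<gamma>) * (R x q $$ (l, m) * \<theta> j m q))"
        using p' x j lm by (intro hreg_mult hreg_coord_powi R_reg \<theta>) auto
      then have "hreg n 0 p (\<lambda>q. coord i q powi (- \<gamma>) * (R x q $$ (l, m) * \<theta> j m q))" by simp
      then show "hreg n 0 p (\<lambda>q. \<Psi> xi j q $$ (l, m))"
      proof (rule hreg_eq_on_open[OF _ op p])
        fix q assume "q \<in> chart_dom V j \<inter> chart_dom (twist n F \<gamma>) xi"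
        then have Rc: "R x q \<in> carrier_mat (n - 1) N" using x by (intro R) (auto simp: dom[unfolded xi_eq])
        show "\<Psi> xi j q $$ (l, m) = coord i q powi (- \<gamma>) * (R x q $$ (l, m) * \<theta> j m q)"
          using lm mult_diag_index[OF Rc lm, of "\<lambda>m. \<theta> j m q"] carrier_matD[OF Rc]
          by (simp add: \<Psi>_def del: index_mult_mat(1))
      qed
    qed
    fix j' xi' p assume j': "j' \<in> charts V" and xi': "xi' \<in> proj_space n \<times> {..n}"
      and p: "p \<in> chart_dom V j \<inter> chart_dom V j' \<inter> chart_dom (twist n F \<gamma>) xi \<inter> chart_dom (twist n F \<gamma>) xi'"
    then obtain x' i' where [simp]: "xi' = (x', i')" and x': "x' \<in> proj_space n" "i' \<le> n" by auto
    have p: "p \<in> W x" "p \<in> W x'" "coord i p \<noteq> 0" "coord i' p \<noteq> 0" "p \<in> chart_dom V j" "p \<in> chart_dom V j'"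
      using p x x' by (auto simp: twist_charts)
    let ?D = "\<lambda>j. diag N (\<lambda>m. \<theta> j m p)" and ?x = "coord i p powi (- \<gamma>)" and ?y = "(coord i p / coord i' p) powi \<gamma>"
    note Rc = R[OF x(1) p(1)] and Rc' = R[OF x'(1) p(2)] and Ec = E[OF x(1) p(1)]
    have D: "?D j * transition V j j' p = ?D j'"
      unfolding V_trans[OF j j' p(5,6)] diag_mult_diag using \<theta>(1)[OF j p(5)] by (auto intro!: diag_cong)
    have "transition (twist n F \<gamma>) xi' xi p * \<Psi> xi j p =
      (?y \<cdot>\<^sub>m (R x' p * E x p)) * (?x \<cdot>\<^sub>m (R x p * ?D j))"
      by (simp add: \<Psi>_def twist_charts F_trans)
    also have "\<dots> = (?y * ?x) \<cdot>\<^sub>m (R x' p * E x p * (R x p * ?D j))"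
      by (rule smult_mult_smult[OF mult_carrier_mat[OF Rc' Ec] mult_carrier_mat[OF Rc diag_carrier(1)]])
    also have "R x' p * E x p * (R x p * ?D j) = R x' p * ?D j"
      using assoc_mult_mat[OF mult_carrier_mat[OF Rc' Ec] Rc diag_carrier(1), symmetric]
      unfolding RER[OF x'(1) p(2) x(1) p(1)] .
    also have "?y * ?x = coord i' p powi (- \<gamma>)"
      using p(3,4) by (simp add: power_int_divide_distrib power_int_minus field_simps)
    finally have "transition (twist n F \<gamma>) xi' xi p * \<Psi> xi j p * transition V j j' p =
       (coord i' p powi (- \<gamma>)) \<cdot>\<^sub>m (R x' p * ?D j) * transition V j j' p" by simp
    also have "\<dots> = (coord i' p powi (- \<gamma>)) \<cdot>\<^sub>m (R x' p * ?D j * transition V j j' p)"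
      unfolding V_trans[OF j j' p(5,6)]
      by (rule mult_smult_assoc_mat[OF mult_carrier_mat[OF Rc' diag_carrier(1)] diag_carrier(1)])
    also have "R x' p * ?D j * transition V j j' p = R x' p * ?D j'"
      unfolding D[symmetric] unfolding V_trans[OF j j' p(5,6)]
      by (rule assoc_mult_mat[OF Rc' diag_carrier(1) diag_carrier(1)])
    finally show "\<Psi> xi' j' p = transition (twist n F \<gamma>) xi' xi p * \<Psi> xi j p * transition V j j' p"
      by (simp add: \<Psi>_def)
  qed
  have "inj_on (\<lambda>v. \<Phi> j ci p *\<^sub>v v) (carrier_vec (bundle_rank (twist n Q (- \<gamma>)))) \<and>
     (\<lambda>v. \<Phi> j ci p *\<^sub>v v) ` carrier_vec (bundle_rank (twist n Q (- \<gamma>))) = mat_kernel (\<Psi> xi j p) \<and>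
     (\<lambda>u. \<Psi> xi j p *\<^sub>v u) ` carrier_vec (bundle_rank V) = carrier_vec (bundle_rank (twist n F \<gamma>))"
    if "ci \<in> charts (twist n Q (- \<gamma>))" "j \<in> charts V" "xi \<in> charts (twist n F \<gamma>)"
      "p \<in> chart_dom (twist n Q (- \<gamma>)) ci \<inter> chart_dom V j \<inter> chart_dom (twist n F \<gamma>) xi" for ci j xi p
  proof -
    obtain c i x i' where eq [simp]: "ci = (c, i)" "xi = (x, i')" by (cases ci, cases xi)
    have c: "c \<in> charts Q" "p \<in> chart_dom Q c" "coord i p \<noteq> 0" and j: "j \<in> charts V" "p \<in> chart_dom V j"
      and x: "x \<in> proj_space n" "p \<in> W x" "coord i' p \<noteq> 0"
      using that by (auto simp: twist_charts)
    note ex = exact_rescale[where g = "\<lambda>m. \<theta> j m p", OF A_carrier[OF c(1,2)] R[OF x(1,2)] \<theta>(1)[OF j],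
        of "coord i p powi (- \<gamma>)" "coord i' p powi (- \<gamma>)"]
    \<comment> \<open>\<open>A\<close> and \<open>B\<close> have the same image, by lifting through
      \<open>P\<close>; so what was shown for \<open>R\<close> relative to \<open>B\<close> passes
      to \<open>A\<close>.\<close>
    have AB: "\<exists>y\<in>carrier_vec (n + 1). A c p *\<^sub>v z = B p *\<^sub>v y" if "z \<in> carrier_vec n" for z
      using P_surj[OF c(1,2) that] A_P_vec[OF c(1,2)] by metis
    have RA: "R x p *\<^sub>v (A c p *\<^sub>v z) = 0\<^sub>v (n - 1)" if "z \<in> carrier_vec n" for z
      using AB[OF that] RB[OF x(1,2)] by auto
    have ker: "\<exists>z\<in>carrier_vec n. u = A c p *\<^sub>v z" if u: "u \<in> carrier_vec N" "R x p *\<^sub>v u = 0\<^sub>v (n - 1)" for u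
      using kerR[OF x(1,2) u] A_P_vec[OF c(1,2)] mult_mat_vec_carrier[OF P_carrier[OF c(1,2)]] by metis
    have surj: "\<exists>v\<in>carrier_vec N. R x p *\<^sub>v v = u" if "u \<in> carrier_vec (n - 1)" for u
      using RE_vec[OF x(1,2) that] mult_mat_vec_carrier[OF E[OF x(1,2)] that] by blast
    show ?thesis
      unfolding twist_charts F Q_rank V_rank
      using ex[OF _ _ _ A_injective[OF c(1,2)] RA ker surj] c(3) x(3) by (simp add: \<Phi>_def \<Psi>_def)
  qed
  then have "short_exact n (twist n Q (- \<gamma>)) V (twist n F \<gamma>)"
    unfolding short_exact_def
    using twist_vector_bundle[OF Q_bundle] twist_vector_bundle[OF F_bundle] diag_bundle_vector_bundle[OF V] \<Phi> \<Psi>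
    by blast
  then show ?thesis using F_bundle F(3) by blast
qed

end

section \<open>Homogeneous data of the given sequence\<close>

lemma proj_space_nonempty: "proj_space n \<noteq> {}"
proof -
  have "unit_vec (n + 1) 0 \<noteq> (0\<^sub>v (n + 1) :: complex vec)" by simp
  then have "proportional n `` {unit_vec (n + 1) 0} \<in> proj_space n"
    unfolding proj_space_def by (intro quotientI) auto
  then show ?thesis by blast
qed

text \<open>Rank and nullity by \<open>wide_mat_kernel\<close>. If \<open>r < n\<close>, adjoin a
  unit row at an index \<open>a\<close> with \<open>x $ a \<noteq> 0\<close>: a nonzero kernel
  vector would be a multiple of \<open>x\<close> with coordinate \<open>a\<close> equal to 0. If
  \<open>n < r\<close>, preimages of the \<open>r\<close> unit vectors together with
  \<open>x\<close> are too many vectors in dimension n + 1; applying \<open>M\<close> to a relation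
  kills all coefficients but that of \<open>x\<close>, and \<open>x \<noteq> 0\<close> kills the
  last.\<close>

lemma cokernel_rank:
  fixes M :: "complex mat"
  assumes M: "M \<in> carrier_mat r (n + 1)" and x: "x \<in> carrier_vec (n + 1)" "x \<noteq> 0\<^sub>v (n + 1)"
    and ker: "\<And>v. v \<in> carrier_vec (n + 1) \<Longrightarrow> M *\<^sub>v v = 0\<^sub>v r \<longleftrightarrow> (\<exists>c. v = c \<cdot>\<^sub>v x)"
    and surj: "\<And>u. u \<in> carrier_vec r \<Longrightarrow> \<exists>v\<in>carrier_vec (n + 1). M *\<^sub>v v = u"
  shows "r = n"
proof (rule ccontr)
  obtain a where a: "a < n + 1" "x $ a \<noteq> 0"
    using x by (metis eq_vecI carrier_vecD index_zero_vec)
  assume "r \<noteq> n"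
  then consider "r < n" | "n < r" by linarith
  then show False
  proof cases
    case 1
    define K where "K = mat (r + 1) (n + 1) (\<lambda>(i, j). if i < r then M $$ (i, j) else if j = a then 1 else 0)"
    have K: "K \<in> carrier_mat (r + 1) (n + 1)" by (simp add: K_def)
    obtain v where v: "v \<in> carrier_vec (n + 1)" "v \<noteq> 0\<^sub>v (n + 1)" "K *\<^sub>v v = 0\<^sub>v (r + 1)"
      using wide_mat_kernel[OF K] 1 by auto
    have "M *\<^sub>v v = 0\<^sub>v r"
    proof (rule eq_vecI)
      fix i assume "i < dim_vec (0\<^sub>v r)"
      then have i: "i < r" by simp
      have "(M *\<^sub>v v) $ i = (\<Sum>j<n+1. M $$ (i, j) * v $ j)" by (rule mult_mat_vec_index[OF M v(1) i])
      also have "\<dots> = (\<Sum>j<n+1. K $$ (i, j) * v $ j)" using i by (intro sum.cong) (auto simp: K_def)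
      also have "\<dots> = (K *\<^sub>v v) $ i" by (rule mult_mat_vec_index[OF K v(1), symmetric]) (use i in simp)
      finally show "(M *\<^sub>v v) $ i = 0\<^sub>v r $ i" using v(3) i by simp
    qed (use M in auto)
    then obtain c where c: "v = c \<cdot>\<^sub>v x" using ker[OF v(1)] by auto
    have "0 = (K *\<^sub>v v) $ r" using v(3) by simp
    also have "\<dots> = (\<Sum>j<n+1. K $$ (r, j) * v $ j)" by (rule mult_mat_vec_index[OF K v(1)]) simp
    also have "\<dots> = (\<Sum>j<n+1. (if j = a then 1 else 0) * v $ j)" by (intro sum.cong) (auto simp: K_def)
    also have "\<dots> = 1 * v $ a" by (rule sum_single_left) (use a in auto)
    finally have "c = 0" using a x(1) unfolding c by simp
    then have "v = 0\<^sub>v (n + 1)" unfolding c using x(1) by (intro eq_vecI) auto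
    then show False using v(2) by simp
  next
    case 2
    have "\<forall>i. \<exists>v. v \<in> carrier_vec (n + 1) \<and> M *\<^sub>v v = unit_vec r i"
      using surj unit_vec_carrier by blast
    then obtain g where g: "\<And>i. g i \<in> carrier_vec (n + 1)" "\<And>i. M *\<^sub>v g i = unit_vec r i" by metis
    define K where "K = mat (n + 1) (r + 1) (\<lambda>(k, i). if i < r then g i $ k else x $ k)"
    have K: "K \<in> carrier_mat (n + 1) (r + 1)" by (simp add: K_def)
    obtain v where v: "v \<in> carrier_vec (r + 1)" "v \<noteq> 0\<^sub>v (r + 1)" "K *\<^sub>v v = 0\<^sub>v (n + 1)"
      using wide_mat_kernel[OF K] 2 by auto
    have Kv: "(\<Sum>i<r. g i $ k * v $ i) + x $ k * v $ r = 0" if k: "k < n + 1" for k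
    proof -
      have "0 = (K *\<^sub>v v) $ k" using v(3) k by simp
      also have "\<dots> = (\<Sum>i<r+1. K $$ (k, i) * v $ i)" by (rule mult_mat_vec_index[OF K v(1) k])
      also have "\<dots> = (\<Sum>i<r. g i $ k * v $ i) + x $ k * v $ r" using k by (simp add: K_def)
      finally show ?thesis by simp
    qed
    have "M *\<^sub>v x = 0\<^sub>v r" using ker[OF x(1)] by (metis one_smult_vec)
    then have Mx: "(\<Sum>k<n+1. M $$ (i, k) * x $ k) = 0" if "i < r" for i
      using mult_mat_vec_index[OF M x(1) that] that by simp
    have Mg: "(\<Sum>k<n+1. M $$ (i, k) * g j $ k) = (if i = j then 1 else 0)" if "i < r" for i j
      using mult_mat_vec_index[OF M g(1) that, of j] g(2)[of j] that by (auto simp: unit_vec_def)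
    have vi: "v $ i = 0" if i: "i < r" for i
    proof -
      have "0 = (\<Sum>k<n+1. M $$ (i, k) * ((\<Sum>j<r. g j $ k * v $ j) + x $ k * v $ r))"
        using Kv by (intro sum.neutral[symmetric]) auto
      also have "\<dots> = (\<Sum>k<n+1. \<Sum>j<r. (M $$ (i, k) * g j $ k) * v $ j) + (\<Sum>k<n+1. (M $$ (i, k) * x $ k) * v $ r)"
        by (simp only: distrib_left sum.distrib sum_distrib_left mult.assoc)
      also have "(\<Sum>k<n+1. (M $$ (i, k) * x $ k) * v $ r) = 0"
        unfolding sum_distrib_right[symmetric] Mx[OF i] by simp
      also have "(\<Sum>k<n+1. \<Sum>j<r. (M $$ (i, k) * g j $ k) * v $ j) = (\<Sum>j<r. (\<Sum>k<n+1. M $$ (i, k) * g j $ k) * v $ j)"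
        by (subst sum.swap) (simp only: sum_distrib_right)
      also have "\<dots> = (\<Sum>j<r. (if i = j then 1 else 0) * v $ j)" unfolding Mg[OF i] ..
      also have "\<dots> = 1 * v $ i" by (rule sum_single_left) (use i in auto)
      finally show ?thesis by simp
    qed
    then have "x $ a * v $ r = 0" using Kv[OF a(1)] by simp
    then have "v $ r = 0" using a by simp
    then have "v = 0\<^sub>v (r + 1)" using v(1) vi by (intro eq_vecI) (auto simp: less_Suc_eq)
    then show False using v(2) by simp
  qed
qed

lemma bundle_morphism_regular:
  "bundle_morphism n E F \<phi> \<Longrightarrow> i \<in> charts E \<Longrightarrow> j \<in> charts F \<Longrightarrow>
    regular_mat_on n (chart_dom E i \<inter> chart_dom F j) (bundle_rank F) (bundle_rank E) (\<phi> j i)"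
  unfolding bundle_morphism_def by blast

lemma bundle_morphism_trans:
  "bundle_morphism n E F \<phi> \<Longrightarrow> i \<in> charts E \<Longrightarrow> i' \<in> charts E \<Longrightarrow> j \<in> charts F \<Longrightarrow> j' \<in> charts F \<Longrightarrow>
    p \<in> chart_dom E i \<Longrightarrow> p \<in> chart_dom E i' \<Longrightarrow> p \<in> chart_dom F j \<Longrightarrow> p \<in> chart_dom F j' \<Longrightarrow>
    \<phi> j' i' p = transition F j' j p * \<phi> j i p * transition E i i' p"
  unfolding bundle_morphism_def by blast

text \<open>The scalar identities showing that chart entries of the two given morphisms, multiplied
  by the right powers of coordinates, do not depend on the chart. The left sides have the shape in
  which the transition rules deliver them.\<close>

lemma powi_rescale:
  fixes x y z :: complex
  assumes "x \<noteq> 0" "y \<noteq> 0"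
  shows "(x / y) powi t * z * (y / x) powi (- u) * y powi (u + t) = z * x powi (u + t)"
    and "z * (y / x) powi t * y powi (- t) = z * x powi (- t)"
proof -
  have eq: "(x / y) powi t = x powi t / y powi t" "(y / x) powi t = y powi t / x powi t"
    "(y / x) powi (- u) = x powi u / y powi u" "x powi (u + t) = x powi u * x powi t"
    "y powi (u + t) = y powi u * y powi t" "x powi (- t) = 1 / x powi t" "y powi (- t) = 1 / y powi t"
    using assms by (simp_all add: power_int_divide_distrib power_int_add power_int_minus_divide)
  show "(x / y) powi t * z * (y / x) powi (- u) * y powi (u + t) = z * x powi (u + t)"
    unfolding eq using assms by simp
  show "z * (y / x) powi t * y powi (- t) = z * x powi (- t)"
    unfolding eq using assms by simp
qed

text \<open>A morphism from O(-\<gamma>) to O(s) is multiplication by a function of degree \<gamma>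
  + s. It is recovered from a chart by multiplying with the power of the coordinate by which the
  chart divides. The second map is made homogeneous only on its source side; on the side of Q chart
  coordinates are kept.\<close>

lemma sequence_data_exists:
  fixes Q :: "'i vbundle" and s w :: "nat \<Rightarrow> int"
  assumes n: "n \<ge> 1"
    and weights: "\<And>j k. j \<le> n \<Longrightarrow> k \<le> n \<Longrightarrow> 1 \<le> j + k \<Longrightarrow> s j + s k = w (j + k - 1)"
    and Q: "vector_bundle n Q"
    and ex: "short_exact n (line_bundle n (- \<gamma>)) (bundle_sum n (map (line_bundle n) (map s [0..<n + 1]))) Q"
  shows "\<exists>f P. sequence_data n \<gamma> s w Q f P"
proof -
  define S where "S = bundle_sum n (map (line_bundle n) (map s [0..<n + 1]))"
  let ?L = "line_bundle n (- \<gamma>)"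
  have "short_exact n ?L S Q" using ex unfolding S_def .
  then obtain \<phi> \<psi> where \<phi>: "bundle_morphism n ?L S \<phi>" and \<psi>: "bundle_morphism n S Q \<psi>"
    and exact: "\<forall>i\<in>charts ?L. \<forall>j\<in>charts S. \<forall>c\<in>charts Q. \<forall>p\<in>chart_dom ?L i \<inter> chart_dom S j \<inter> chart_dom Q c.
         inj_on (\<lambda>v. \<phi> j i p *\<^sub>v v) (carrier_vec (bundle_rank ?L)) \<and>
         (\<lambda>v. \<phi> j i p *\<^sub>v v) ` carrier_vec (bundle_rank ?L) = mat_kernel (\<psi> c j p) \<and>
         (\<lambda>w. \<psi> c j p *\<^sub>v w) ` carrier_vec (bundle_rank S) = carrier_vec (bundle_rank Q)"
    unfolding short_exact_def by (elim conjE exE) (rule that)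
  \<comment> \<open>A chart of the direct sum picks one affine chart for each summand. The constant
    choices already cover the space, and they use a single coordinate throughout.\<close>
  define J where "J i = replicate (n + 1) i" for i :: nat
  have J_nth: "length (J i) = n + 1" "k < n + 1 \<Longrightarrow> J i ! k = i" for i k
    unfolding J_def by (simp_all del: replicate_Suc)
  define U where "U i = {p \<in> proj_space n. coord i p \<noteq> 0}" for i
  have J: "J i \<in> charts S" "chart_dom S (J i) = U i" if "i \<le> n" for i
  proof -
    show Ji: "J i \<in> charts S" unfolding S_def using that by (subst line_sum_charts(1)) (simp add: J_nth)
    show "chart_dom S (J i) = U i"
      using Ji unfolding S_def U_def by (subst line_sum_charts(3)) (auto simp: J_nth)
  qed
  have S_rank: "bundle_rank S = n + 1" unfolding S_def by (subst line_sum_charts(2)) simp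
  have S_trans: "transition S (J i) (J i') p = diag (n + 1) (\<lambda>k. (coord i' p / coord i p) powi s k)" for i i' p
    unfolding S_def by (subst line_sum_charts(4)) (auto simp: J_nth simp del: upt_Suc intro!: diag_cong)
  have L: "i \<in> charts ?L" "chart_dom ?L i = U i" if "i \<le> n" for i
    using that by (auto simp: line_bundle_charts line_bundle_chart_dom U_def)
  have U_open: "zariski_open n (U i)" if "i \<le> n" for i unfolding U_def by (rule zariski_open_coord[OF that])
  have Q_chart: "zariski_open n (chart_dom Q c)" "p \<in> chart_dom Q c \<Longrightarrow> p \<in> proj_space n"
     "p \<in> chart_dom Q c \<Longrightarrow> transition Q c c p = 1\<^sub>m (bundle_rank Q)" if "c \<in> charts Q" for c p
    using Q that unfolding vector_bundle_def by blast+
  define r where "r = bundle_rank Q"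
  have \<phi>_reg: "regular_mat_on n (U i) (n + 1) 1 (\<phi> (J i) i)" if "i \<le> n" for i
    using bundle_morphism_regular[OF \<phi> L(1)[OF that] J(1)[OF that]]
    unfolding S_rank line_bundle_charts(2) L(2)[OF that] J(2)[OF that] Int_absorb .
  have \<psi>_reg: "regular_mat_on n (U i \<inter> chart_dom Q c) r (n + 1) (\<psi> c (J i))" if "i \<le> n" "c \<in> charts Q" for i c
    using bundle_morphism_regular[OF \<psi> J(1)[OF that(1)] that(2)]
    unfolding S_rank J(2)[OF that(1)] r_def .
  have \<phi>_trans: "\<phi> (J i') i' p $$ (k, 0) * coord i' p powi (\<gamma> + s k) = \<phi> (J i) i p $$ (k, 0) * coord i p powi (\<gamma> + s k)"
    if i: "i \<le> n" "p \<in> U i" "i' \<le> n" "p \<in> U i'" and k: "k < n + 1" for i i' p k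
  proof -
    have c: "\<phi> (J i) i p \<in> carrier_mat (n + 1) 1" using \<phi>_reg i regular_mat_onD(1) by blast
    have "\<phi> (J i') i' p = transition S (J i') (J i) p * \<phi> (J i) i p * transition ?L i i' p"
      using i L J by (intro bundle_morphism_trans[OF \<phi>]) simp_all
    also have "\<dots> $$ (k, 0) = (\<Sum>h<1. (transition S (J i') (J i) p * \<phi> (J i) i p) $$ (k, h) * transition ?L i i' p $$ (h, 0))"
      unfolding S_trans using k by (intro mult_mat_index[OF mult_carrier_mat[OF diag_carrier(1) c]]) (auto simp: line_bundle_charts)
    also have "\<dots> = (transition S (J i') (J i) p * \<phi> (J i) i p) $$ (k, 0) * transition ?L i i' p $$ (0, 0)"
      by (simp del: index_mult_mat(1))
    also have "(transition S (J i') (J i) p * \<phi> (J i) i p) $$ (k, 0) = (coord i p / coord i' p) powi s k * \<phi> (J i) i p $$ (k, 0)"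
      unfolding S_trans by (rule diag_mult_index[OF c k]) simp
    also have "transition ?L i i' p $$ (0, 0) = (coord i' p / coord i p) powi (- \<gamma>)"
      by (simp add: line_bundle_charts)
    finally have eq: "\<phi> (J i') i' p $$ (k, 0) =
        (coord i p / coord i' p) powi s k * \<phi> (J i) i p $$ (k, 0) * (coord i' p / coord i p) powi (- \<gamma>)" .
    have "coord i p \<noteq> 0" "coord i' p \<noteq> 0" using i by (auto simp: U_def)
    then show ?thesis unfolding eq by (rule powi_rescale(1))
  qed
  have \<psi>_trans: "\<psi> c (J i') p $$ (a, k) * coord i' p powi (- s k) = \<psi> c (J i) p $$ (a, k) * coord i p powi (- s k)"
    if i: "i \<le> n" "p \<in> U i" "i' \<le> n" "p \<in> U i'" and c: "c \<in> charts Q" "p \<in> chart_dom Q c"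
      and ak: "a < r" "k < n + 1" for i i' p c a k
  proof -
    have m: "\<psi> c (J i) p \<in> carrier_mat r (n + 1)" using \<psi>_reg[OF i(1) c(1)] i c regular_mat_onD(1) by blast
    have "\<psi> c (J i') p = transition Q c c p * \<psi> c (J i) p * transition S (J i) (J i') p"
      using i c J by (intro bundle_morphism_trans[OF \<psi>]) simp_all
    also have "transition Q c c p * \<psi> c (J i) p = \<psi> c (J i) p"
      using Q_chart(3)[OF c] m by (simp add: r_def)
    also have "(\<psi> c (J i) p * transition S (J i) (J i') p) $$ (a, k) = \<psi> c (J i) p $$ (a, k) * (coord i' p / coord i p) powi s k"
      unfolding S_trans by (rule mult_diag_index[OF m ak])
    finally have eq: "\<psi> c (J i') p $$ (a, k) = \<psi> c (J i) p $$ (a, k) * (coord i' p / coord i p) powi s k" .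
    have "coord i p \<noteq> 0" "coord i' p \<noteq> 0" using i by (auto simp: U_def)
    then show ?thesis unfolding eq by (rule powi_rescale(2))
  qed
  \<comment> \<open>An arbitrary admissible index, with no regularity in \<open>p\<close>. By
    \<open>f_eq\<close> and \<open>P_eq\<close> any other index gives the same values, so locally
    the index can be held fixed.\<close>
  define I where "I p = (SOME i. i \<le> n \<and> coord i p \<noteq> 0)" for p
  have I: "I p \<le> n" "p \<in> U (I p)" if "p \<in> proj_space n" for p
  proof -
    have "I p \<le> n \<and> coord (I p) p \<noteq> 0" unfolding I_def using coord_nonzero[OF that] by (rule someI_ex)
    then show "I p \<le> n" "p \<in> U (I p)" using that by (auto simp: U_def)
  qed
  have UP: "p \<in> proj_space n" "coord i p \<noteq> 0" if "p \<in> U i" for p i using that by (auto simp: U_def)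
  \<comment> \<open>In chart \<open>i\<close> the section \<open>f k\<close> of degree
    \<open>\<gamma> + s k\<close> appears as its quotient by that power of coordinate
    \<open>i\<close>.\<close>
  define f where "f k p = \<phi> (J (I p)) (I p) p $$ (k, 0) * coord (I p) p powi (\<gamma> + s k)" for k p
  define P where "P c p = \<psi> c (J (I p)) p * diag (n + 1) (\<lambda>k. coord (I p) p powi (- s k))" for c p
  have f_eq: "f k p = \<phi> (J i) i p $$ (k, 0) * coord i p powi (\<gamma> + s k)"
    if "i \<le> n" "p \<in> U i" "k < n + 1" for i p k
    unfolding f_def using that I[OF UP(1)[OF that(2)]] by (intro \<phi>_trans) auto
  have P_eq: "P c p = \<psi> c (J i) p * diag (n + 1) (\<lambda>k. coord i p powi (- s k))"
    if i: "i \<le> n" "p \<in> U i" and c: "c \<in> charts Q" "p \<in> chart_dom Q c" for i p c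
  proof (rule eq_matI)
    have p: "p \<in> proj_space n" using UP(1)[OF i(2)] .
    have m: "\<psi> c (J i) p \<in> carrier_mat r (n + 1)" "\<psi> c (J (I p)) p \<in> carrier_mat r (n + 1)"
      using \<psi>_reg[OF i(1) c(1)] \<psi>_reg[OF I(1)[OF p] c(1)] i c I[OF p] regular_mat_onD(1) by blast+
    show "dim_row (P c p) = dim_row (\<psi> c (J i) p * diag (n + 1) (\<lambda>k. coord i p powi (- s k)))"
       "dim_col (P c p) = dim_col (\<psi> c (J i) p * diag (n + 1) (\<lambda>k. coord i p powi (- s k)))"
      using m by (simp_all add: P_def)
    fix a k assume "a < dim_row (\<psi> c (J i) p * diag (n + 1) (\<lambda>k. coord i p powi (- s k)))"
      "k < dim_col (\<psi> c (J i) p * diag (n + 1) (\<lambda>k. coord i p powi (- s k)))"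
    then have ak: "a < r" "k < n + 1" using m by auto
    show "P c p $$ (a, k) = (\<psi> c (J i) p * diag (n + 1) (\<lambda>k. coord i p powi (- s k))) $$ (a, k)"
      unfolding P_def mult_diag_index[OF m(1) ak] mult_diag_index[OF m(2) ak]
      by (rule \<psi>_trans[OF i I[OF p] c ak])
  qed
  have facts: "fvec \<noteq> 0\<^sub>v (n + 1) \<and> P c p \<in> carrier_mat r (n + 1) \<and>
      (\<forall>v\<in>carrier_vec (n + 1). P c p *\<^sub>v v = 0\<^sub>v r \<longleftrightarrow> (\<exists>x. v = x \<cdot>\<^sub>v fvec)) \<and>
      (\<forall>u\<in>carrier_vec r. \<exists>v\<in>carrier_vec (n + 1). P c p *\<^sub>v v = u)"
    if c: "c \<in> charts Q" "p \<in> chart_dom Q c" and fvec: "fvec = vec (n + 1) (\<lambda>k. f k p)" for c p fvec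
  proof -
    have p: "p \<in> proj_space n" using Q_chart(2)[OF c] .
    define i where "i = I p"
    have i: "i \<le> n" "p \<in> U i" "coord i p \<noteq> 0" using I[OF p] UP by (auto simp: i_def)
    let ?M = "\<psi> c (J i) p" and ?F = "\<phi> (J i) i p"
    let ?D = "diag (n + 1) (\<lambda>k. coord i p powi (s k))" and ?D' = "diag (n + 1) (\<lambda>k. coord i p powi (- s k))"
    have M: "?M \<in> carrier_mat r (n + 1)" using \<psi>_reg[OF i(1) c(1)] i c regular_mat_onD(1) by blast
    have F: "?F \<in> carrier_mat (n + 1) 1" using \<phi>_reg[OF i(1)] i regular_mat_onD(1) by blast
    have D': "?D' = diag (n + 1) (\<lambda>k. 1 / coord i p powi (s k))"
      by (intro diag_cong) (simp add: power_int_minus field_simps)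
    have DD: "?D *\<^sub>v (?D' *\<^sub>v v) = v" "?D' *\<^sub>v (?D *\<^sub>v v) = v" if "v \<in> carrier_vec (n + 1)" for v
      unfolding D' using diag_inverse_vec[OF that, of "\<lambda>k. coord i p powi (s k)"] i(3) by auto
    have Pv: "P c p *\<^sub>v v = ?M *\<^sub>v (?D' *\<^sub>v v)" if "v \<in> carrier_vec (n + 1)" for v
      unfolding P_eq[OF i(1,2) c] by (rule assoc_mult_mat_vec[OF M diag_carrier(1) that])
    have ex: "inj_on (\<lambda>v. ?F *\<^sub>v v) (carrier_vec 1)" "(\<lambda>v. ?F *\<^sub>v v) ` carrier_vec 1 = mat_kernel ?M"
      "(\<lambda>w. ?M *\<^sub>v w) ` carrier_vec (n + 1) = carrier_vec r"
      using exact[rule_format, OF L(1)[OF i(1)] J(1)[OF i(1)] c(1), of p] i(2) c(2)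
      unfolding line_bundle_charts(2) S_rank r_def L(2)[OF i(1)] J(2)[OF i(1)] by simp_all
    have FD: "?D *\<^sub>v (?F *\<^sub>v v) = (v $ 0 * coord i p powi (- \<gamma>)) \<cdot>\<^sub>v fvec" if v: "v \<in> carrier_vec 1" for v
    proof (rule eq_vecI)
      fix k assume "k < dim_vec ((v $ 0 * coord i p powi (- \<gamma>)) \<cdot>\<^sub>v fvec)"
      then have k: "k < n + 1" by (simp add: fvec)
      have Fv: "?F *\<^sub>v v \<in> carrier_vec (n + 1)" by (rule mult_mat_vec_carrier[OF F v])
      have "(?D *\<^sub>v (?F *\<^sub>v v)) $ k = (\<Sum>h<n+1. (if k = h then coord i p powi s h else 0) * (?F *\<^sub>v v) $ h)"
        using k by (subst mult_mat_vec_index[OF diag_carrier(1) Fv k]) (intro sum.cong; auto simp: diag_index)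
      also have "\<dots> = coord i p powi s k * (?F *\<^sub>v v) $ k" by (rule sum_single_left) (use k in auto)
      also have "(?F *\<^sub>v v) $ k = ?F $$ (k, 0) * v $ 0" by (subst mult_mat_vec_index[OF F v k]) simp
      also have "coord i p powi s k * (?F $$ (k, 0) * v $ 0) = (v $ 0 * coord i p powi (- \<gamma>)) * f k p"
        unfolding f_eq[OF i(1,2) k] using i(3) by (simp add: power_int_add power_int_minus)
      finally show "(?D *\<^sub>v (?F *\<^sub>v v)) $ k = ((v $ 0 * coord i p powi (- \<gamma>)) \<cdot>\<^sub>v fvec) $ k"
        using k by (simp add: fvec)
    qed (simp add: fvec)
    have f_nz: "fvec \<noteq> 0\<^sub>v (n + 1)"
    proof
      assume f0: "fvec = 0\<^sub>v (n + 1)"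
      let ?e = "unit_vec 1 0 :: complex vec"
      have "?D *\<^sub>v (?F *\<^sub>v ?e) = 0\<^sub>v (n + 1)" unfolding FD[OF unit_vec_carrier] f0 by (intro eq_vecI) auto
      then have "?D' *\<^sub>v (?D *\<^sub>v (?F *\<^sub>v ?e)) = 0\<^sub>v (n + 1)" by (simp add: mult_mat_vec_zero[OF diag_carrier(1)])
      then have "?F *\<^sub>v ?e = ?F *\<^sub>v 0\<^sub>v 1"
        using DD(2)[OF mult_mat_vec_carrier[OF F unit_vec_carrier]] mult_mat_vec_zero[OF F] by simp
      then have "?e = 0\<^sub>v 1" by (rule inj_onD[OF ex(1)]) simp_all
      then have "?e $ 0 = 0\<^sub>v 1 $ 0" by (rule arg_cong)
      then show False by simp
    qed
    have ker: "P c p *\<^sub>v v = 0\<^sub>v r \<longleftrightarrow> (\<exists>x. v = x \<cdot>\<^sub>v fvec)" if v: "v \<in> carrier_vec (n + 1)" for v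
    proof
      assume "P c p *\<^sub>v v = 0\<^sub>v r"
      then have "?D' *\<^sub>v v \<in> mat_kernel ?M" unfolding Pv[OF v] by (intro mat_kernelI[OF M]) auto
      then obtain z where z: "z \<in> carrier_vec 1" "?D' *\<^sub>v v = ?F *\<^sub>v z" unfolding ex(2)[symmetric] by (rule imageE)
      have "v = ?D *\<^sub>v (?F *\<^sub>v z)" unfolding z(2)[symmetric] by (rule DD(1)[OF v, symmetric])
      then show "\<exists>x. v = x \<cdot>\<^sub>v fvec" unfolding FD[OF z(1)] by blast
    next
      assume "\<exists>x. v = x \<cdot>\<^sub>v fvec"
      then obtain x where x: "v = x \<cdot>\<^sub>v fvec" by blast
      \<comment> \<open>Compensates the frame of O(-\<gamma>), which enters \<open>FD\<close> as the
        factor \<open>coord i p powi (- \<gamma>)\<close>.\<close>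
      define z where "z = vec 1 (\<lambda>_. x * coord i p powi \<gamma>)"
      have z: "z \<in> carrier_vec 1" "z $ 0 * coord i p powi (- \<gamma>) = x"
        using i(3) by (simp_all add: z_def power_int_minus)
      have "v = ?D *\<^sub>v (?F *\<^sub>v z)" unfolding FD[OF z(1)] z(2) x ..
      then have "?D' *\<^sub>v v = ?F *\<^sub>v z" by (simp only: DD(2)[OF mult_mat_vec_carrier[OF F z(1)]])
      then have "?D' *\<^sub>v v \<in> mat_kernel ?M" unfolding ex(2)[symmetric] by (rule image_eqI[OF _ z(1)])
      then show "P c p *\<^sub>v v = 0\<^sub>v r" unfolding Pv[OF v] by (rule mat_kernelD(2)[OF M])
    qed
    have "\<exists>v\<in>carrier_vec (n + 1). P c p *\<^sub>v v = u" if "u \<in> carrier_vec r" for u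
    proof -
      obtain v where v: "v \<in> carrier_vec (n + 1)" "?M *\<^sub>v v = u" using \<open>u \<in> carrier_vec r\<close>[folded ex(3)] by auto
      have "P c p *\<^sub>v (?D *\<^sub>v v) = u" unfolding Pv[OF diag_vec_carrier] DD(2)[OF v(1)] by (rule v(2))
      then show ?thesis by (intro bexI[of _ "?D *\<^sub>v v"]) simp_all
    qed
    moreover have "P c p \<in> carrier_mat r (n + 1)"
      unfolding P_eq[OF i(1,2) c] by (rule mult_carrier_mat[OF M diag_carrier(1)])
    ultimately show ?thesis by (intro conjI ballI f_nz ker)
  qed
  \<comment> \<open>The rank of Q is not part of the data; it is computed in the fibre over one
    point from the kernel and surjectivity just found.\<close>
  have rn: "r = n"
  proof -
    obtain p where p: "p \<in> proj_space n" using proj_space_nonempty[of n] by blast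
    then obtain c where c: "c \<in> charts Q" "p \<in> chart_dom Q c" using Q unfolding vector_bundle_def by blast
    show ?thesis
      using facts[OF c refl] by (intro cokernel_rank[of "P c p" r n "vec (n + 1) (\<lambda>k. f k p)"]) auto
  qed
  have "sequence_data n \<gamma> s w Q f P"
  proof
    show "bundle_rank Q = n" using rn by (simp add: r_def)
    show "hreg n (\<gamma> + s k) p (f k)" if p: "p \<in> proj_space n" and k: "k \<le> n" for p k
    proof (rule hreg_eq_on_open[OF _ U_open[OF I(1)[OF p]] I(2)[OF p]])
      have "hreg n (0 + (\<gamma> + s k)) p (\<lambda>q. \<phi> (J (I p)) (I p) q $$ (k, 0) * coord (I p) q powi (\<gamma> + s k))"
        using I[OF p] UP k by (intro hreg_mult hreg_coord_powi regular_mat_onD(2)[OF \<phi>_reg]) auto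
      then show "hreg n (\<gamma> + s k) p (\<lambda>q. \<phi> (J (I p)) (I p) q $$ (k, 0) * coord (I p) q powi (\<gamma> + s k))" by simp
    qed (use I[OF p] k in \<open>auto intro!: f_eq\<close>)
    show "\<exists>k\<le>n. f k p \<noteq> 0" if p: "p \<in> proj_space n" for p
    proof -
      obtain c where c: "c \<in> charts Q" "p \<in> chart_dom Q c" using Q p unfolding vector_bundle_def by blast
      then have "vec (n + 1) (\<lambda>k. f k p) \<noteq> 0\<^sub>v (n + 1)" using facts[OF c refl] by blast
      then show ?thesis by (auto simp: vec_eq_iff less_Suc_eq_le)
    qed
    fix c p assume c: "c \<in> charts Q" "p \<in> chart_dom Q c"
    have p: "p \<in> proj_space n" using Q_chart(2)[OF c] .
    show "P c p \<in> carrier_mat n (n + 1)" using facts[OF c refl] rn by blast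
    show "P c p *\<^sub>v v = 0\<^sub>v n \<longleftrightarrow> (\<exists>x. v = x \<cdot>\<^sub>v vec (n + 1) (\<lambda>k. f k p))" if "v \<in> carrier_vec (n + 1)" for v
      using facts[OF c refl] that rn by blast
    show "\<exists>v\<in>carrier_vec (n + 1). P c p *\<^sub>v v = u" if "u \<in> carrier_vec n" for u
      using facts[OF c refl] that rn by blast
    have op: "zariski_open n (U (I p) \<inter> chart_dom Q c)" "p \<in> U (I p) \<inter> chart_dom Q c"
      using zariski_open_Int[OF U_open[OF I(1)[OF p]] Q_chart(1)[OF c(1)]] I[OF p] c by auto
    show "hreg n (- s k) p (\<lambda>p. P c p $$ (a, k))" if ak: "a < n" "k \<le> n" for a k
    proof (rule hreg_eq_on_open[OF _ op])
      have "hreg n (0 + - s k) p (\<lambda>q. \<psi> c (J (I p)) q $$ (a, k) * coord (I p) q powi (- s k))"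
        using I[OF p] UP ak rn op
        by (intro hreg_mult hreg_coord_powi regular_mat_onD(2)[OF \<psi>_reg[OF I(1)[OF p] c(1)]]) auto
      then show "hreg n (- s k) p (\<lambda>q. \<psi> c (J (I p)) q $$ (a, k) * coord (I p) q powi (- s k))" by simp
      fix q assume q: "q \<in> U (I p) \<inter> chart_dom Q c"
      have m: "\<psi> c (J (I p)) q \<in> carrier_mat r (n + 1)"
        using regular_mat_onD(1)[OF \<psi>_reg[OF I(1)[OF p] c(1)] q] .
      have "P c q = \<psi> c (J (I p)) q * diag (n + 1) (\<lambda>k. coord (I p) q powi (- s k))"
        using q by (intro P_eq I(1)[OF p] c(1)) auto
      then show "P c q $$ (a, k) = \<psi> c (J (I p)) q $$ (a, k) * coord (I p) q powi (- s k)"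
        using ak rn by (simp only:) (rule mult_diag_index[OF m], auto)
    qed
    fix c' assume c': "c' \<in> charts Q" "p \<in> chart_dom Q c'"
    have i: "I p \<le> n" "p \<in> U (I p)" using I[OF p] .
    have M: "\<psi> c' (J (I p)) p \<in> carrier_mat r (n + 1)"
      using \<psi>_reg[OF i(1) c'(1)] i c' regular_mat_onD(1) by blast
    have T: "transition Q c c' p \<in> carrier_mat r r"
      using Q c c' unfolding vector_bundle_def regular_mat_on_def r_def by blast
    have S1: "transition S (J (I p)) (J (I p)) p = 1\<^sub>m (n + 1)"
      unfolding S_trans diag_one[symmetric] using UP(2)[OF i(2)] by (intro diag_cong) simp
    have "\<psi> c (J (I p)) p = transition Q c c' p * \<psi> c' (J (I p)) p * transition S (J (I p)) (J (I p)) p"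
      using i c c' J[OF i(1)] by (intro bundle_morphism_trans[OF \<psi>]) simp_all
    also have "\<dots> = transition Q c c' p * \<psi> c' (J (I p)) p"
      unfolding S1 by (rule right_mult_one_mat[OF mult_carrier_mat[OF T M]])
    finally have eq: "\<psi> c (J (I p)) p = transition Q c c' p * \<psi> c' (J (I p)) p" .
    show "P c p = transition Q c c' p * P c' p"
      unfolding P_def eq by (rule assoc_mult_mat[OF T M diag_carrier(1)])
  qed (use n weights Q in auto)
  then show ?thesis by blast
qed

section \<open>Specialisation to the weights of the given sequence and of the symmetric
  power\<close>

theorem mainTheorem3:
  fixes n :: nat and \<alpha> \<gamma> :: int
    and Q :: "'i vbundle" and V :: "nat list vbundle"
  assumes "n \<ge> 3"
    and "\<gamma> > int n * \<alpha>" and "int n * \<alpha> \<ge> 0"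
    and "vector_bundle n Q"
    and "short_exact n
           (line_bundle n (- \<gamma>))
           (bundle_sum n (map (\<lambda>k. line_bundle n ((int n - 2 * int k) * \<alpha>)) [0..<n + 1]))
           Q"
    and "V = sym_power (2 * (n - 1)) (bundle_sum n [line_bundle n \<alpha>, line_bundle n (- \<alpha>)])"
  shows "isomorphic_bundles n V
           (bundle_sum n
             (map (\<lambda>k. line_bundle n ((2 * int n - 2 - 2 * int k) * \<alpha>)) [0..<2 * (n - 1) + 1]))
         \<and> (\<exists>F :: point vbundle.
              vector_bundle n F \<and> bundle_rank F = n - 1 \<and>
              short_exact n (twist n Q (- \<gamma>)) V (twist n F \<gamma>))"
proof -
  define s w where "s k = (int n - 2 * int k) * \<alpha>" and "w k = (2 * int n - 2 - 2 * int k) * \<alpha>" for k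
  have N: "2 * (n - 1) + 1 = 2 * n - 1" using assms(1) by simp
  obtain \<theta> where V: "diag_bundle n V (2 * n - 1) w \<theta>"
  proof -
    have w_eq: "int (2 * (n - 1) - m) * \<alpha> + int m * (- \<alpha>) = w m" if "m < 2 * n - 1" for m
      using that assms(1) by (auto simp: w_def of_nat_diff algebra_simps)
    have "diag_bundle n V (2 * n - 1) w (\<lambda>is m p. (coord (is ! 0) p powi \<alpha>) ^ (2 * (n - 1) - m) *
        (coord (is ! 1) p powi (- \<alpha>)) ^ m)"
      using sym_power_diag_bundle[of n "2 * (n - 1)" \<alpha> "- \<alpha>"] w_eq
      unfolding assms(6) N by (rule diag_bundle_cong_degree)
    then show ?thesis by (rule that)
  qed
  have "diag_bundle n (bundle_sum n (map (line_bundle n) (map w [0..<2 * n - 1]))) (2 * n - 1) w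
      (\<lambda>is k p. coord (is ! k) p powi (map w [0..<2 * n - 1] ! k))"
    using diag_bundle_cong_degree[OF line_sum_diag_bundle[of n "map w [0..<2 * n - 1]"], of w] by simp
  with V have iso: "isomorphic_bundles n V (bundle_sum n (map (line_bundle n) (map w [0..<2 * n - 1])))"
    by (rule diag_bundle_isomorphic)
  have "short_exact n (line_bundle n (- \<gamma>)) (bundle_sum n (map (line_bundle n) (map s [0..<n + 1]))) Q"
    using assms(5) by (simp add: s_def comp_def)
  \<comment> \<open>Both sides are (2n - 2j - 2k)\<alpha>. The bound on \<open>j + k\<close> guards
    the natural-number subtraction; in row \<open>m\<close> of the Wronskian the indices satisfy
    \<open>j + k = m + 1\<close>, so it always holds there.\<close>
  moreover have "s j + s k = w (j + k - 1)" if "1 \<le> j + k" for j k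
    using that by (auto simp: s_def w_def of_nat_diff algebra_simps)
  ultimately obtain f P where "sequence_data n \<gamma> s w Q f P"
    using sequence_data_exists[of n s w Q \<gamma>] assms(1,4) by auto
  then have "\<exists>F :: point vbundle. vector_bundle n F \<and> bundle_rank F = n - 1 \<and>
      short_exact n (twist n Q (- \<gamma>)) V (twist n F \<gamma>)"
    by (rule sequence_data.quotient_sequence[OF _ V])
  then show ?thesis
    using iso unfolding N by (simp add: w_def comp_def)
qed

end
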